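(* Let $r=\sum_i x_i\otimes y_i$ be a quasitriangular $r$-matrix on a Lie algebra $\mathfrak g$, let $(Y_j,\pi_j,\lambda_j)$, $1\le j\le n$, be left $(\mathfrak g,r)$-Poisson spaces, let $Y=Y_1\times\cdots\times Y_n$, let $\lambda=(\lambda_1,\ldots,\lambda_n)$ be the direct product left action of $\mathfrak g^n$ on $Y$, $\lambda(x_1,\ldots,x_n)=(\lambda_1(x_1),\ldots,\lambda_n(x_n))$, and let $$\pi_Y=(\pi_1,\ldots,\pi_n)+\lambda(\mathrm{Mix}^n(r)),\qquad \mathrm{Mix}^n(r)=\sum_{1\le j<k\le n}\sum_i(y_i)_j\wedge(x_i)_k\in\wedge^2(\mathfrak g^n),$$ where $(\pi_1,\ldots,\pi_n)$ is the direct product Poisson structure. Then the triple $(Y,\pi_Y,\lambda)$ is a left $(\mathfrak g^n,r^{(n)})$-Poisson space, and $(Y,\pi_Y,\lambda_{\rm diag})$ is a left $(\mathfrak g,r)$-Poisson space, where $\lambda_{\rm diag}(x)=(\lambda_1(x),\ldots,\lambda_n(x))$, $x\in\mathfrak g$, is the diagonal action of $\mathfrak g$ on $Y$. If, in addition, $\pi_j=-\lambda_j(r)$ for each $1\le j\le n$, then $\pi_Y=-\lambda(r^{(n)})$.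
   Context: Everything is over $\mathbf k=\mathbb R$ (smooth) or $\mathbb C$ (holomorphic), finite dimensional; $u\wedge v=u\otimes v-v\otimes u$. $r\in\mathfrak g\otimes\mathfrak g$ is a quasitriangular $r$-matrix if its symmetric part is ad-invariant and $[r_{12},r_{13}]+[r_{12},r_{23}]+[r_{13},r_{23}]=0$; then $(\mathfrak g,\delta_r)$ with $\delta_r(x)=\mathrm{ad}_xr$ is a Lie bialgebra. A left action of $\mathfrak g$ on a manifold $Y$ is a Lie algebra anti-homomorphism $\lambda$ from $\mathfrak g$ to vector fields on $Y$, extended to tensors by $\lambda(u\otimes v)=\lambda(u)\otimes\lambda(v)$. A left $(\mathfrak g,r)$-Poisson space is a triple $(Y,\pi_Y,\lambda)$ with $(Y,\pi_Y)$ a Poisson manifold and $\lambda$ a left action of $\mathfrak g$ with $[\lambda(x),\pi_Y]=\lambda(\delta_r(x))$ for all $x\in\mathfrak g$ (Schouten bracket); the same definition applies to the pair $(\mathfrak g^n,r^{(n)})$. On a product manifold, $(A_1,\ldots,A_n)$ denotes the sum of the tensor fields $A_j$ on the factors, each regarded as a tensor field on the product. For $X\in\mathfrak g^{\otimes k}$, $(X)_j$ is its image under the embedding of $\mathfrak g$ as the $j$-th summand of $\mathfrak g^n$. With $r^{21}=\sum_i y_i\otimes x_i$, $$r^{(n)}=\sum_{j\ \mathrm{odd}}(r)_j+\sum_{j\ \mathrm{even}}(-r^{21})_j-\mathrm{Mix}^n(r)\in\mathfrak g^n\otimes\mathfrak g^n,$$ which is a quasitriangular $r$-matrix on the direct product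 Lie algebra $\mathfrak g^n$. *)

theory Defs
  imports "HOL-Analysis.Analysis" "HOL-Library.Function_Algebras"
begin

(* The ground field is a type 'k of sort {real_normed_field, euclidean_space}.  A
   finite-dimensional real field with a multiplicative norm is the real or the complex field,
   so this covers exactly the two cases k = R and k = C, with real and complex as instances.
   Function_Algebras makes +, - and sums of functions pointwise. *)

section \<open>Manifolds over the ground field\<close>

definition coord_space :: "nat \<Rightarrow> (nat \<Rightarrow> 'k::zero) set" where
  "coord_space d = {x. \<forall>i\<ge>d. x i = 0}"

definition pderiv_at :: "nat \<Rightarrow> ((nat \<Rightarrow> 'k::real_normed_field) \<Rightarrow> 'k) \<Rightarrow> (nat \<Rightarrow> 'k) \<Rightarrow> 'k" where
  "pderiv_at i f x = deriv (\<lambda>t. f (x(i := t))) (x i)"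

primrec Ck_on :: "nat \<Rightarrow> nat \<Rightarrow> (nat \<Rightarrow> 'k::real_normed_field) set \<Rightarrow> ((nat \<Rightarrow> 'k) \<Rightarrow> 'k) \<Rightarrow> bool" where
  "Ck_on 0 d V f \<longleftrightarrow> continuous_on V f"
| "Ck_on (Suc m) d V f \<longleftrightarrow> continuous_on V f \<and>
     (\<forall>i<d. (\<forall>x\<in>V. (\<lambda>t. f (x(i := t))) field_differentiable at (x i)) \<and>
            Ck_on m d V (pderiv_at i f))"

(* For relatively open V in coord_space d.  Differentiation is over 'k: this is C-infinity for
   the real field, and holomorphic for the complex field (where continuous partial derivatives
   of first order already give all the others). *)
definition smooth_coord :: "nat \<Rightarrow> (nat \<Rightarrow> 'k::real_normed_field) set \<Rightarrow> ((nat \<Rightarrow> 'k) \<Rightarrow> 'k) \<Rightarrow> bool" where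
  "smooth_coord d V f \<longleftrightarrow> (\<forall>m. Ck_on m d V f)"

type_synonym ('a, 'k) chart = "'a set \<times> ('a \<Rightarrow> nat \<Rightarrow> 'k)"

record ('a, 'k) mfd =
  mtop :: "'a topology"
  mdim :: nat
  matlas :: "('a, 'k) chart set"

definition second_countable_top :: "'a topology \<Rightarrow> bool" where
  "second_countable_top T \<longleftrightarrow>
     (\<exists>B. countable B \<and> (\<forall>V\<in>B. openin T V) \<and>
          (\<forall>U p. openin T U \<and> p \<in> U \<longrightarrow> (\<exists>V\<in>B. p \<in> V \<and> V \<subseteq> U)))"

definition is_chart :: "('a, 'k::real_normed_field) mfd \<Rightarrow> ('a, 'k) chart \<Rightarrow> bool" where
  "is_chart M c \<longleftrightarrow> (case c of (U, \<phi>) \<Rightarrow>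
     openin (mtop M) U \<and>
     openin (top_of_set (coord_space (mdim M))) (\<phi> ` U) \<and>
     homeomorphic_map (subtopology (mtop M) U) (top_of_set (\<phi> ` U)) \<phi>)"

(* The atlas need not be maximal. *)
definition manifold :: "('a, 'k::real_normed_field) mfd \<Rightarrow> bool" where
  "manifold M \<longleftrightarrow>
     Hausdorff_space (mtop M) \<and> second_countable_top (mtop M) \<and>
     (\<forall>c\<in>matlas M. is_chart M c) \<and> \<Union>(fst ` matlas M) = topspace (mtop M) \<and>
     (\<forall>(U, \<phi>)\<in>matlas M. \<forall>(V, \<psi>)\<in>matlas M. \<forall>i<mdim M.
        smooth_coord (mdim M) (\<phi> ` (U \<inter> V)) (\<lambda>x. \<psi> (inv_into U \<phi> x) i))"

definition smooth_on :: "('a, 'k::real_normed_field) mfd \<Rightarrow> 'a set \<Rightarrow> ('a \<Rightarrow> 'k) \<Rightarrow> bool" where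
  "smooth_on M W f \<longleftrightarrow> openin (mtop M) W \<and>
     (\<forall>(U, \<phi>)\<in>matlas M. smooth_coord (mdim M) (\<phi> ` (U \<inter> W)) (f \<circ> inv_into U \<phi>))"

definition smooth_at :: "('a, 'k::real_normed_field) mfd \<Rightarrow> 'a \<Rightarrow> ('a \<Rightarrow> 'k) \<Rightarrow> bool" where
  "smooth_at M p f \<longleftrightarrow> (\<exists>W. p \<in> W \<and> smooth_on M W f)"

section \<open>Contravariant tensor fields\<close>

(* A contravariant tensor field A is given by the values A p f g of A at p on the differentials
   of functions f, g that are smooth (only) near p; this also makes sense for holomorphic
   manifolds, which may lack global functions.  The value is 0 when an argument is not smooth
   near p (in particular when p is not a point of the manifold), so that equality of tensor
   fields is equality of functions.  The product is (X tensor Z) p f g = X p f * Z p g. *)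

type_synonym ('a, 'k) tfield1 = "'a \<Rightarrow> ('a \<Rightarrow> 'k) \<Rightarrow> 'k"
type_synonym ('a, 'k) tfield2 = "'a \<Rightarrow> ('a \<Rightarrow> 'k) \<Rightarrow> ('a \<Rightarrow> 'k) \<Rightarrow> 'k"

definition chart_deriv :: "('a, 'k::real_normed_field) chart \<Rightarrow> nat \<Rightarrow> ('a \<Rightarrow> 'k) \<Rightarrow> 'a \<Rightarrow> 'k" where
  "chart_deriv c i f p = pderiv_at i (f \<circ> inv_into (fst c) (snd c)) (snd c p)"

definition vector_field :: "('a, 'k::real_normed_field) mfd \<Rightarrow> ('a, 'k) tfield1 \<Rightarrow> bool" where
  "vector_field M X \<longleftrightarrow>
     (\<forall>p f. \<not> smooth_at M p f \<longrightarrow> X p f = 0) \<and>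
     (\<forall>c\<in>matlas M. \<exists>a. (\<forall>i<mdim M. smooth_on M (fst c) (a i)) \<and>
        (\<forall>p\<in>fst c. \<forall>f. smooth_at M p f \<longrightarrow>
           X p f = (\<Sum>i<mdim M. a i p * chart_deriv c i f p)))"

definition bivector_field :: "('a, 'k::real_normed_field) mfd \<Rightarrow> ('a, 'k) tfield2 \<Rightarrow> bool" where
  "bivector_field M P \<longleftrightarrow>
     (\<forall>p f g. \<not> (smooth_at M p f \<and> smooth_at M p g) \<longrightarrow> P p f g = 0) \<and>
     (\<forall>p f g. P p f g = - P p g f) \<and>
     (\<forall>c\<in>matlas M. \<exists>a. (\<forall>i<mdim M. \<forall>k<mdim M. smooth_on M (fst c) (a i k)) \<and>
        (\<forall>p\<in>fst c. \<forall>f g. smooth_at M p f \<and> smooth_at M p g \<longrightarrow>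
           P p f g = (\<Sum>i<mdim M. \<Sum>k<mdim M. a i k p * chart_deriv c i f p * chart_deriv c k g p)))"

definition vf_bracket :: "('a, 'k::real_normed_field) mfd \<Rightarrow> ('a, 'k) tfield1 \<Rightarrow> ('a, 'k) tfield1 \<Rightarrow> ('a, 'k) tfield1" where
  "vf_bracket M X Z = (\<lambda>p f. if smooth_at M p f
     then X p (\<lambda>q. Z q f) - Z p (\<lambda>q. X q f) else 0)"

(* Schouten bracket [X, P] of a vector field with a bivector field; it satisfies
   [X, A wedge B] = [X, A] wedge B + A wedge [X, B] for vector fields A, B. *)
definition schouten :: "('a, 'k::real_normed_field) mfd \<Rightarrow> ('a, 'k) tfield1 \<Rightarrow> ('a, 'k) tfield2 \<Rightarrow> ('a, 'k) tfield2" where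
  "schouten M X P = (\<lambda>p f g. if smooth_at M p f \<and> smooth_at M p g
     then X p (\<lambda>q. P q f g) - P p (\<lambda>q. X q f) g - P p f (\<lambda>q. X q g) else 0)"

definition poisson_manifold :: "('a, 'k::real_normed_field) mfd \<Rightarrow> ('a, 'k) tfield2 \<Rightarrow> bool" where
  "poisson_manifold M P \<longleftrightarrow> manifold M \<and> bivector_field M P \<and>
     (\<forall>p f g h. smooth_at M p f \<and> smooth_at M p g \<and> smooth_at M p h \<longrightarrow>
        P p f (\<lambda>q. P q g h) + P p g (\<lambda>q. P q h f) + P p h (\<lambda>q. P q f g) = 0)"

section \<open>Lie algebras and their tensors\<close>

(* A Lie algebra lives on a subspace (the carrier) of a vector space. *)
record ('k, 'g) lie_alg =
  lcarrier :: "'g set"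
  lscale :: "'k \<Rightarrow> 'g \<Rightarrow> 'g"
  lbr :: "'g \<Rightarrow> 'g \<Rightarrow> 'g"

definition lie_algebra :: "('k::field, 'g::ab_group_add) lie_alg \<Rightarrow> bool" where
  "lie_algebra L \<longleftrightarrow>
     vector_space (lscale L) \<and>
     (\<exists>B. finite B \<and> lcarrier L = module.span (lscale L) B) \<and>
     (\<forall>u\<in>lcarrier L. \<forall>v\<in>lcarrier L. lbr L u v \<in> lcarrier L) \<and>
     (\<forall>u\<in>lcarrier L. \<forall>v\<in>lcarrier L. \<forall>w\<in>lcarrier L.
        lbr L (u + v) w = lbr L u w + lbr L v w \<and> lbr L w (u + v) = lbr L w u + lbr L w v) \<and>
     (\<forall>c. \<forall>u\<in>lcarrier L. \<forall>v\<in>lcarrier L.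
        lbr L (lscale L c u) v = lscale L c (lbr L u v) \<and>
        lbr L u (lscale L c v) = lscale L c (lbr L u v)) \<and>
     (\<forall>u\<in>lcarrier L. lbr L u u = 0) \<and>
     (\<forall>u\<in>lcarrier L. \<forall>v\<in>lcarrier L. \<forall>w\<in>lcarrier L.
        lbr L u (lbr L v w) + lbr L v (lbr L w u) + lbr L w (lbr L u v) = 0)"

definition lie_dual :: "('k::field, 'g::ab_group_add) lie_alg \<Rightarrow> ('g \<Rightarrow> 'k) set" where
  "lie_dual L = {\<xi>.
     (\<forall>u\<in>lcarrier L. \<forall>v\<in>lcarrier L. \<xi> (u + v) = \<xi> u + \<xi> v) \<and>
     (\<forall>c. \<forall>u\<in>lcarrier L. \<xi> (lscale L c u) = c * \<xi> u)}"

(* As the Lie algebra g is finite-dimensional, its tensor square is the space of bilinear forms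
   on the dual, with u tensor v acting as (xi, eta) |-> xi u * eta v, and likewise for the
   tensor cube.  Only values on elements of lie_dual carry information: identities between
   tensors are always required on lie_dual only. *)
type_synonym ('k, 'g) tens2 = "('g \<Rightarrow> 'k) \<Rightarrow> ('g \<Rightarrow> 'k) \<Rightarrow> 'k"

definition tens :: "'g \<Rightarrow> 'g \<Rightarrow> ('k::field, 'g) tens2" (infixl \<open>\<otimes>\<close> 70) where
  "u \<otimes> v = (\<lambda>\<xi> \<eta>. \<xi> u * \<eta> v)"

definition wedge :: "'g \<Rightarrow> 'g \<Rightarrow> ('k::field, 'g) tens2" where
  "wedge u v = u \<otimes> v - v \<otimes> u"

definition tens_square :: "('k::field, 'g) lie_alg \<Rightarrow> ('k, 'g) tens2 set" where
  "tens_square L = module.span (\<lambda>c T \<xi> \<eta>. c * T \<xi> \<eta>) {u \<otimes> v | u v. u \<in> lcarrier L \<and> v \<in> lcarrier L}"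

definition tens_flip :: "('k, 'g) tens2 \<Rightarrow> ('k, 'g) tens2" where
  "tens_flip T = (\<lambda>\<xi> \<eta>. T \<eta> \<xi>)"

definition sym_part :: "('k::field, 'g) tens2 \<Rightarrow> ('k, 'g) tens2" where
  "sym_part T = (\<lambda>\<xi> \<eta>. (T \<xi> \<eta> + tens_flip T \<xi> \<eta>) / 2)"

(* ad_x (u tensor v) = [x, u] tensor v + u tensor [x, v]; with T = r this is delta_r x. *)
definition tens_ad :: "('k::field, 'g) lie_alg \<Rightarrow> 'g \<Rightarrow> ('k, 'g) tens2 \<Rightarrow> ('k, 'g) tens2" where
  "tens_ad L x T = (\<lambda>\<xi> \<eta>. T (\<lambda>u. \<xi> (lbr L x u)) \<eta> + T \<xi> (\<lambda>v. \<eta> (lbr L x v)))"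

(* The three brackets in the tensor cube, evaluated on three elements of the dual; see the
   lemmas below for their expansions. *)
definition br12_13 :: "('k::field, 'g) lie_alg \<Rightarrow> ('k, 'g) tens2 \<Rightarrow> ('g \<Rightarrow> 'k) \<Rightarrow> ('g \<Rightarrow> 'k) \<Rightarrow> ('g \<Rightarrow> 'k) \<Rightarrow> 'k" where
  "br12_13 L r \<xi> \<eta> \<zeta> = r (\<lambda>u. r (\<lambda>v. \<xi> (lbr L u v)) \<zeta>) \<eta>"

definition br12_23 :: "('k::field, 'g) lie_alg \<Rightarrow> ('k, 'g) tens2 \<Rightarrow> ('g \<Rightarrow> 'k) \<Rightarrow> ('g \<Rightarrow> 'k) \<Rightarrow> ('g \<Rightarrow> 'k) \<Rightarrow> 'k" where
  "br12_23 L r \<xi> \<eta> \<zeta> = r \<xi> (\<lambda>u. r (\<lambda>v. \<eta> (lbr L u v)) \<zeta>)"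

definition br13_23 :: "('k::field, 'g) lie_alg \<Rightarrow> ('k, 'g) tens2 \<Rightarrow> ('g \<Rightarrow> 'k) \<Rightarrow> ('g \<Rightarrow> 'k) \<Rightarrow> ('g \<Rightarrow> 'k) \<Rightarrow> 'k" where
  "br13_23 L r \<xi> \<eta> \<zeta> = r \<xi> (\<lambda>u. r \<eta> (\<lambda>v. \<zeta> (lbr L u v)))"

lemma sum_apply2: "(\<Sum>i\<in>I. F i) \<xi> \<eta> = (\<Sum>i\<in>I. F i \<xi> \<eta>)"
  for F :: "'i \<Rightarrow> ('k::field, 'g) tens2"
  by (induction I rule: infinite_finite_induct) auto

lemma br12_13_expand:
  "br12_13 L (\<Sum>i\<in>I. x i \<otimes> y i) \<xi> \<eta> \<zeta> =
     (\<Sum>i\<in>I. \<Sum>j\<in>I. \<xi> (lbr L (x i) (x j)) * \<eta> (y i) * \<zeta> (y j))"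
  by (simp add: br12_13_def sum_apply2 tens_def sum_distrib_right sum_distrib_left mult_ac)

lemma br12_23_expand:
  "br12_23 L (\<Sum>i\<in>I. x i \<otimes> y i) \<xi> \<eta> \<zeta> =
     (\<Sum>i\<in>I. \<Sum>j\<in>I. \<xi> (x i) * \<eta> (lbr L (y i) (x j)) * \<zeta> (y j))"
  by (simp add: br12_23_def sum_apply2 tens_def sum_distrib_right sum_distrib_left mult_ac)

lemma br13_23_expand:
  "br13_23 L (\<Sum>i\<in>I. x i \<otimes> y i) \<xi> \<eta> \<zeta> =
     (\<Sum>i\<in>I. \<Sum>j\<in>I. \<xi> (x i) * \<eta> (x j) * \<zeta> (lbr L (y i) (y j)))"
  by (simp add: br13_23_def sum_apply2 tens_def sum_distrib_right sum_distrib_left mult_ac)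

definition quasitriangular :: "('k::field, 'g::ab_group_add) lie_alg \<Rightarrow> ('k, 'g) tens2 \<Rightarrow> bool" where
  "quasitriangular L r \<longleftrightarrow> r \<in> tens_square L \<and>
     (\<forall>x\<in>lcarrier L. \<forall>\<xi>\<in>lie_dual L. \<forall>\<eta>\<in>lie_dual L. tens_ad L x (sym_part r) \<xi> \<eta> = 0) \<and>
     (\<forall>\<xi>\<in>lie_dual L. \<forall>\<eta>\<in>lie_dual L. \<forall>\<zeta>\<in>lie_dual L.
        br12_13 L r \<xi> \<eta> \<zeta> + br12_23 L r \<xi> \<eta> \<zeta> + br13_23 L r \<xi> \<eta> \<zeta> = 0)"

section \<open>Poisson spaces\<close>

definition left_action ::
  "('k::real_normed_field, 'g::ab_group_add) lie_alg \<Rightarrow> ('a, 'k) mfd \<Rightarrow> ('g \<Rightarrow> ('a, 'k) tfield1) \<Rightarrow> bool" where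
  "left_action L M l \<longleftrightarrow>
     (\<forall>u\<in>lcarrier L. vector_field M (l u)) \<and>
     (\<forall>u\<in>lcarrier L. \<forall>v\<in>lcarrier L. l (u + v) = l u + l v) \<and>
     (\<forall>c. \<forall>u\<in>lcarrier L. l (lscale L c u) = (\<lambda>p f. c * l u p f)) \<and>
     (\<forall>u\<in>lcarrier L. \<forall>v\<in>lcarrier L. l (lbr L u v) = - vf_bracket M (l u) (l v))"

(* The linear extension of (u tensor v) |-> l u tensor l v: pull the covectors back along l. *)
definition act2 :: "('g \<Rightarrow> ('a, 'k) tfield1) \<Rightarrow> ('k, 'g) tens2 \<Rightarrow> ('a, 'k) tfield2" where
  "act2 l T = (\<lambda>p f g. T (\<lambda>u. l u p f) (\<lambda>v. l v p g))"

lemma act2_tens_sum: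
  "act2 l (\<Sum>i\<in>I. x i \<otimes> y i) p f g = (\<Sum>i\<in>I. l (x i) p f * l (y i) p g)"
  by (simp add: act2_def sum_apply2 tens_def)

definition left_poisson_space ::
  "('k::real_normed_field, 'g::ab_group_add) lie_alg \<Rightarrow> ('k, 'g) tens2 \<Rightarrow>
   ('a, 'k) mfd \<Rightarrow> ('a, 'k) tfield2 \<Rightarrow> ('g \<Rightarrow> ('a, 'k) tfield1) \<Rightarrow> bool" where
  "left_poisson_space L r M P l \<longleftrightarrow>
     lie_algebra L \<and> quasitriangular L r \<and> poisson_manifold M P \<and> left_action L M l \<and>
     (\<forall>x\<in>lcarrier L. schouten M (l x) P = act2 l (tens_ad L x r))"

section \<open>Direct powers and products\<close>

(* Elements of the n-fold direct power are families indexed by {1..n}, extended by 0. *)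
definition lie_power :: "nat \<Rightarrow> ('k::field, 'g::ab_group_add) lie_alg \<Rightarrow> ('k, nat \<Rightarrow> 'g) lie_alg" where
  "lie_power n L = \<lparr>
     lcarrier = {z. (\<forall>j\<in>{1..n}. z j \<in> lcarrier L) \<and> (\<forall>j. j \<notin> {1..n} \<longrightarrow> z j = 0)},
     lscale = (\<lambda>c z j. lscale L c (z j)),
     lbr = (\<lambda>z w j. lbr L (z j) (w j))\<rparr>"

definition summand :: "nat \<Rightarrow> 'g \<Rightarrow> nat \<Rightarrow> 'g::zero" where
  "summand j u = (\<lambda>k. if k = j then u else 0)"

definition tens_summand :: "nat \<Rightarrow> ('k, 'g::zero) tens2 \<Rightarrow> ('k, nat \<Rightarrow> 'g) tens2" where
  "tens_summand j T = (\<lambda>\<xi> \<eta>. T (\<lambda>u. \<xi> (summand j u)) (\<lambda>v. \<eta> (summand j v)))"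

definition Mix :: "nat \<Rightarrow> 'i set \<Rightarrow> ('i \<Rightarrow> 'g) \<Rightarrow> ('i \<Rightarrow> 'g) \<Rightarrow> ('k::field, nat \<Rightarrow> 'g::zero) tens2" where
  "Mix n I x y = (\<Sum>j\<in>{1..n}. \<Sum>k\<in>{j<..n}. \<Sum>i\<in>I. wedge (summand j (y i)) (summand k (x i)))"

definition r_power :: "nat \<Rightarrow> 'i set \<Rightarrow> ('i \<Rightarrow> 'g) \<Rightarrow> ('i \<Rightarrow> 'g) \<Rightarrow> ('k::field, nat \<Rightarrow> 'g::zero) tens2" where
  "r_power n I x y =
     (\<Sum>j\<in>{j\<in>{1..n}. odd j}. tens_summand j (\<Sum>i\<in>I. x i \<otimes> y i)) +
     (\<Sum>j\<in>{j\<in>{1..n}. even j}. tens_summand j (- (\<Sum>i\<in>I. y i \<otimes> x i))) -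
     Mix n I x y"

(* Product charts concatenate coordinates: those of the j-th factor occupy the positions
   d 1 + ... + d (j - 1), ..., d 1 + ... + d j - 1, where d is the family of dimensions. *)
definition concat_coords ::
  "nat \<Rightarrow> (nat \<Rightarrow> nat) \<Rightarrow> (nat \<Rightarrow> 'a \<Rightarrow> nat \<Rightarrow> 'k) \<Rightarrow> (nat \<Rightarrow> 'a) \<Rightarrow> nat \<Rightarrow> 'k::comm_monoid_add" where
  "concat_coords n d \<phi> p = (\<lambda>i. \<Sum>j\<in>{1..n}.
     if sum d {1..<j} \<le> i \<and> i < sum d {1..<j} + d j then \<phi> j (p j) (i - sum d {1..<j}) else 0)"

definition prod_mfd :: "nat \<Rightarrow> (nat \<Rightarrow> ('a, 'k::comm_monoid_add) mfd) \<Rightarrow> (nat \<Rightarrow> 'a, 'k) mfd" where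
  "prod_mfd n Y = \<lparr>
     mtop = product_topology (\<lambda>j. mtop (Y j)) {1..n},
     mdim = (\<Sum>j\<in>{1..n}. mdim (Y j)),
     matlas = {(\<Pi>\<^sub>E j\<in>{1..n}. fst (c j), concat_coords n (\<lambda>j. mdim (Y j)) (\<lambda>j. snd (c j))) | c.
                 \<forall>j\<in>{1..n}. c j \<in> matlas (Y j)}\<rparr>"

(* A tensor field on the j-th factor, regarded as a tensor field on the product M: at p it is
   applied to the restrictions of functions to the slice through p in direction j. *)
definition lift1 :: "(nat \<Rightarrow> 'a, 'k::real_normed_field) mfd \<Rightarrow> nat \<Rightarrow> ('a, 'k) tfield1 \<Rightarrow> (nat \<Rightarrow> 'a, 'k) tfield1" where
  "lift1 M j X = (\<lambda>p f. if smooth_at M p f then X (p j) (\<lambda>t. f (p(j := t))) else 0)"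

definition lift2 :: "(nat \<Rightarrow> 'a, 'k::real_normed_field) mfd \<Rightarrow> nat \<Rightarrow> ('a, 'k) tfield2 \<Rightarrow> (nat \<Rightarrow> 'a, 'k) tfield2" where
  "lift2 M j P = (\<lambda>p f g. if smooth_at M p f \<and> smooth_at M p g
     then P (p j) (\<lambda>t. f (p(j := t))) (\<lambda>t. g (p(j := t))) else 0)"

definition prod_tfield1 ::
  "nat \<Rightarrow> (nat \<Rightarrow> ('a, 'k::real_normed_field) mfd) \<Rightarrow> (nat \<Rightarrow> ('a, 'k) tfield1) \<Rightarrow> (nat \<Rightarrow> 'a, 'k) tfield1" where
  "prod_tfield1 n Y X = (\<Sum>j\<in>{1..n}. lift1 (prod_mfd n Y) j (X j))"

definition prod_tfield2 ::
  "nat \<Rightarrow> (nat \<Rightarrow> ('a, 'k::real_normed_field) mfd) \<Rightarrow> (nat \<Rightarrow> ('a, 'k) tfield2) \<Rightarrow> (nat \<Rightarrow> 'a, 'k) tfield2" where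
  "prod_tfield2 n Y P = (\<Sum>j\<in>{1..n}. lift2 (prod_mfd n Y) j (P j))"

definition prod_action ::
  "nat \<Rightarrow> (nat \<Rightarrow> ('a, 'k::real_normed_field) mfd) \<Rightarrow> (nat \<Rightarrow> 'g \<Rightarrow> ('a, 'k) tfield1) \<Rightarrow>
   (nat \<Rightarrow> 'g) \<Rightarrow> (nat \<Rightarrow> 'a, 'k) tfield1" where
  "prod_action n Y l z = prod_tfield1 n Y (\<lambda>j. l j (z j))"

definition diag_action ::
  "nat \<Rightarrow> (nat \<Rightarrow> ('a, 'k::real_normed_field) mfd) \<Rightarrow> (nat \<Rightarrow> 'g \<Rightarrow> ('a, 'k) tfield1) \<Rightarrow>
   'g \<Rightarrow> (nat \<Rightarrow> 'a, 'k) tfield1" where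
  "diag_action n Y l u = prod_tfield1 n Y (\<lambda>j. l j u)"

definition mixed_bivector ::
  "nat \<Rightarrow> 'i set \<Rightarrow> ('i \<Rightarrow> 'g) \<Rightarrow> ('i \<Rightarrow> 'g) \<Rightarrow> (nat \<Rightarrow> ('a, 'k::real_normed_field) mfd) \<Rightarrow>
   (nat \<Rightarrow> ('a, 'k) tfield2) \<Rightarrow> (nat \<Rightarrow> 'g::zero \<Rightarrow> ('a, 'k) tfield1) \<Rightarrow> (nat \<Rightarrow> 'a, 'k) tfield2" where
  "mixed_bivector n I x y Y P l =
     prod_tfield2 n Y P + act2 (prod_action n Y l) (Mix n I x y)"

end

theory Submission
  imports Defs
begin

text \<open>
  Write \<open>\<lambda>\<close> for the product action, \<open>\<pi>\<^sub>0\<close> for the direct product of the bivector fields and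
  \<open>r\<^sub>0\<close> for the block diagonal part of \<open>r\<^sup>(\<^sup>n\<^sup>)\<close>, so that \<open>r\<^sup>(\<^sup>n\<^sup>) = r\<^sub>0 - Mix\<close> and
  \<open>\<pi>\<^sub>Y = \<pi>\<^sub>0 + \<lambda>(r\<^sub>0 - r\<^sup>(\<^sup>n\<^sup>))\<close>.  The two combinations \<open>\<pi>\<^sub>0 + \<lambda>(r\<^sub>0)\<close> and \<open>\<pi>\<^sub>Y + \<lambda>(r\<^sup>(\<^sup>n\<^sup>))\<close> are
  therefore the same bidifferential operator \<open>Q\<close>, and, \<open>Mix\<close> being skew, \<open>r\<^sub>0\<close> and \<open>r\<^sup>(\<^sup>n\<^sup>)\<close> have the
  same symmetric part.

  The central observation (\<open>jacobi_via_invariant\<close>) is that for any bivector field \<open>P\<close> that is compatible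
  with an action and a quasitriangular \<open>R\<close>, the operator \<open>Q = P + \<lambda>(R)\<close> is invariant under the action,
  and the Jacobiator of \<open>P\<close> can be expressed by \<open>Q\<close> and the symmetric part of \<open>R\<close> alone: after
  substituting \<open>P = Q - \<lambda>(R)\<close>, what remains of \<open>R\<close> is a cyclic sum of brackets
  \<open>[R\<^sub>1\<^sub>2, R\<^sub>2\<^sub>3]\<close>, which the classical Yang-Baxter equation turns into a bracket of the symmetric part
  (\<open>cyclic_br12_23\<close>).  Consequently a skew change of \<open>R\<close> that keeps it quasitriangular, compensated in
  \<open>P\<close>, does not change the Jacobiator and preserves Poisson spaces (\<open>left_poisson_space_twist\<close>).
  It is applied to the step from \<open>(\<pi>\<^sub>0, r\<^sub>0)\<close> to \<open>(\<pi>\<^sub>Y, r\<^sup>(\<^sup>n\<^sup>))\<close>.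

  For this, \<open>r\<^sup>(\<^sup>n\<^sup>)\<close> must be quasitriangular.  All its blocks are \<open>r\<close> or \<open>- r\<^sup>2\<^sup>1\<close>, which differ by the
  invariant tensor \<open>r + r\<^sup>2\<^sup>1\<close>.  Invariance allows exchanging one for the other in all three-slot
  components of the Yang-Baxter equation except for two sign patterns (\<open>cyb_signed\<close>), and those two
  do not occur because the sign of a block compares the two slot numbers.
  Invariance also gives every block the adjoint variation of \<open>r\<close>; this settles the compatibility of
  \<open>\<pi>\<^sub>0\<close> with \<open>r\<^sub>0\<close> and shows that the diagonal embedding intertwines the cobrackets, so that the diagonal
  action inherits the Poisson property (\<open>left_poisson_space_diag\<close>).

  That \<open>\<pi>\<^sub>0\<close> is Poisson, and that brackets on the product are computed factor by factor, rests on calculus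
  in product charts.  A field coming from one factor involves only the coordinates of its block, both in
  the derivatives it takes and in its coefficients.  It commutes with the derivatives along other blocks,
  by the symmetry of mixed partial derivatives, and all terms that mix two factors cancel.
  As tensor fields take values on functions that are smooth near a point only, all of this is
  done with germs; chart independence of smoothness needs the chain rule, which holds over the ground
  field because continuous partial derivatives imply total differentiability.
\<close>

section \<open>Calculus on coordinate spaces\<close>

abbreviation copen :: "nat \<Rightarrow> (nat \<Rightarrow> 'k::real_normed_field) set \<Rightarrow> bool" where
  "copen d V \<equiv> openin (top_of_set (coord_space d)) V"

lemma copen_subset: "copen d V \<Longrightarrow> V \<subseteq> coord_space d"
  by (rule openin_imp_subset)

lemma coord_space_upd: "x \<in> coord_space d \<Longrightarrow> i < d \<Longrightarrow> x(i := t) \<in> coord_space d"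
  by (auto simp: coord_space_def)

text \<open>All points of the coordinate space agree from index \<open>d\<close> on, so finitely many coordinates control
  the product topology.\<close>

lemma copen_box:
  fixes y :: "nat \<Rightarrow> 'k::real_normed_field"
  assumes "copen d V" "y \<in> V"
  obtains e where "e > 0"
    "\<And>z. z \<in> coord_space d \<Longrightarrow> (\<And>i. i < d \<Longrightarrow> dist (z i) (y i) < e) \<Longrightarrow> z \<in> V"
proof -
  obtain T where T: "open T" "V = coord_space d \<inter> T"
    using assms(1) by (auto simp: openin_open)
  from T(1) have "openin (product_topology (\<lambda>i. euclidean) UNIV) T"
    by (simp add: open_fun_def)
  with assms(2) T(2) obtain X where X: "y \<in> PiE UNIV X" "\<And>i. open (X i)" "PiE UNIV X \<subseteq> T"
    using product_topology_open_contains_basis[of "\<lambda>i. euclidean" UNIV T y] by auto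
  have "\<exists>e>0. ball (y i) e \<subseteq> X i" for i
    using X(1) X(2)[of i] open_contains_ball[of "X i"] by (auto simp: PiE_def)
  then obtain e where e: "\<And>i. e i > 0" "\<And>i. ball (y i) (e i) \<subseteq> X i"
    by metis
  define \<epsilon> where "\<epsilon> = Min (insert 1 (e ` {..<d}))"
  have "\<epsilon> > 0" using e(1) by (auto simp: \<epsilon>_def)
  moreover have "z \<in> V" if z: "z \<in> coord_space d" "\<And>i. i < d \<Longrightarrow> dist (z i) (y i) < \<epsilon>" for z
  proof -
    have "z i \<in> X i" for i
    proof (cases "i < d")
      case True
      then have "\<epsilon> \<le> e i" by (auto simp: \<epsilon>_def)
      with z(2)[OF True] have "z i \<in> ball (y i) (e i)" by (simp add: dist_commute)
      then show ?thesis using e(2) by blast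
    next
      case False
      have "y \<in> coord_space d" using assms(2) T(2) by auto
      with z(1) False have "z i = y i" by (auto simp: coord_space_def)
      then show ?thesis using X(1) by (auto simp: PiE_def)
    qed
    then have "z \<in> T" using X(3) by (auto simp: PiE_def)
    then show ?thesis using z(1) T(2) by auto
  qed
  ultimately show ?thesis by (rule that)
qed

lemma copen_line:
  assumes "copen d V" "x \<in> V" "i < d"
  shows "\<forall>\<^sub>F t in nhds (x i). x(i := t) \<in> V"
proof -
  obtain e where e: "e > 0"
    "\<And>z. z \<in> coord_space d \<Longrightarrow> (\<And>k. k < d \<Longrightarrow> dist (z k) (x k) < e) \<Longrightarrow> z \<in> V"
    using copen_box[OF assms(1,2)] by metis
  have "x \<in> coord_space d" using copen_subset[OF assms(1)] assms(2) by auto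
  then have "x(i := t) \<in> V" if "dist t (x i) < e" for t
    using that e(1) assms(3) by (intro e(2) coord_space_upd) auto
  then show ?thesis using e(1) by (auto simp: eventually_nhds_metric)
qed

lemma pderiv_at_cong:
  assumes "copen d V" "x \<in> V" "i < d" "\<And>z. z \<in> V \<Longrightarrow> f z = g z"
  shows "pderiv_at i f x = pderiv_at i g x"
  unfolding pderiv_at_def
  using eventually_mono[OF copen_line[OF assms(1-3)]] assms(4) by (intro deriv_cong_ev) auto

lemma field_differentiable_cong_ev:
  assumes "f field_differentiable at a" "\<forall>\<^sub>F t in nhds a. f t = g t"
  shows "g field_differentiable at a"
  using assms by (auto simp: field_differentiable_def dest: DERIV_cong_ev[OF refl _ refl, THEN iffD1])

lemma Ck_on_subset: "Ck_on m d V f \<Longrightarrow> W \<subseteq> V \<Longrightarrow> Ck_on m d W f"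
  by (induction m arbitrary: f) (auto intro: continuous_on_subset)

lemma Ck_on_continuous: "Ck_on m d V f \<Longrightarrow> continuous_on V f"
  by (cases m) auto

lemma Ck_on_lower: "Ck_on (Suc m) d V f \<Longrightarrow> Ck_on m d V f"
  by (induction m arbitrary: f) auto

text \<open>Openness enters because a partial derivative at a point of \<open>V\<close> depends on values off that point,
  on a piece of a coordinate line.\<close>

lemma Ck_on_cong:
  assumes "copen d V" "Ck_on m d V f" "\<And>z. z \<in> V \<Longrightarrow> f z = g z"
  shows "Ck_on m d V g"
  using assms(2,3)
proof (induction m arbitrary: f g)
  case 0
  then show ?case by (metis Ck_on.simps(1) continuous_on_cong)
next
  case (Suc m)
  have "continuous_on V g" using Suc.prems by (metis Ck_on.simps(2) continuous_on_cong)
  moreover have "(\<lambda>t. g (x(i := t))) field_differentiable at (x i)" if "i < d" "x \<in> V" for i x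
  proof (rule field_differentiable_cong_ev)
    show "(\<lambda>t. f (x(i := t))) field_differentiable at (x i)" using Suc.prems(1) that by simp
    show "\<forall>\<^sub>F t in nhds (x i). f (x(i := t)) = g (x(i := t))"
      using copen_line[OF assms(1) that(2,1)] by eventually_elim (rule Suc.prems(2))
  qed
  moreover have "Ck_on m d V (pderiv_at i g)" if "i < d" for i
  proof (rule Suc.IH)
    show "Ck_on m d V (pderiv_at i f)" using Suc.prems(1) that by simp
    show "pderiv_at i f z = pderiv_at i g z" if "z \<in> V" for z
      using pderiv_at_cong[OF assms(1) that \<open>i < d\<close>] Suc.prems(2) by blast
  qed
  ultimately show ?case by simp
qed

lemma pderiv_at_const [simp]: "pderiv_at i (\<lambda>z. c) = (\<lambda>z. 0)"
  by (simp add: pderiv_at_def fun_eq_iff)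

lemma Ck_on_const: "Ck_on m d V (\<lambda>z. c)"
  by (induction m arbitrary: c) auto

lemma Ck_on_coord: "Ck_on m d V (\<lambda>z::nat \<Rightarrow> 'k::real_normed_field. z k)"
proof -
  have cont: "continuous_on V (\<lambda>z::nat \<Rightarrow> 'k. z k)"
    by (rule continuous_on_subset[OF continuous_on_product_coordinates]) simp
  have *: "(\<lambda>t. (x(i := t)) k) = (if i = k then (\<lambda>t. t) else (\<lambda>t. x k))"
    for x :: "nat \<Rightarrow> 'k" and i by auto
  have "pderiv_at i (\<lambda>z. z k) = (\<lambda>z::nat \<Rightarrow> 'k. if i = k then 1 else 0)" for i
    by (rule ext) (simp add: pderiv_at_def * del: fun_upd_apply)
  then have "Ck_on m' d V (pderiv_at i (\<lambda>z. z k))" for i m'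
    using Ck_on_const[of m' d V "1::'k"] Ck_on_const[of m' d V "0::'k"] by simp
  moreover have "(\<lambda>t. (x(i := t)) k) field_differentiable at (x i)" for x :: "nat \<Rightarrow> 'k" and i
    by (simp add: * del: fun_upd_apply)
  ultimately show ?thesis using cont by (cases m) (simp_all del: fun_upd_apply)
qed

lemma Ck_on_add:
  assumes "copen d V" "Ck_on m d V f" "Ck_on m d V g"
  shows "Ck_on m d V (\<lambda>z. f z + g z)"
  using assms(2,3)
proof (induction m arbitrary: f g)
  case 0
  then show ?case by (auto intro: continuous_on_add)
next
  case (Suc m)
  have eq: "pderiv_at i f x + pderiv_at i g x = pderiv_at i (\<lambda>z. f z + g z) x"
    if "i < d" "x \<in> V" for i x
    using Suc.prems that by (simp add: pderiv_at_def deriv_add)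
  have "Ck_on m d V (pderiv_at i (\<lambda>z. f z + g z))" if "i < d" for i
  proof (rule Ck_on_cong[OF assms(1)])
    show "Ck_on m d V (\<lambda>x. pderiv_at i f x + pderiv_at i g x)"
      using Suc.prems that by (intro Suc.IH) auto
  qed (rule eq[OF that])
  then show ?case
    using Suc.prems by (auto intro!: continuous_on_add field_differentiable_add)
qed

lemma Ck_on_mult:
  assumes "copen d V" "Ck_on m d V f" "Ck_on m d V g"
  shows "Ck_on m d V (\<lambda>z. f z * g z)"
  using assms(2,3)
proof (induction m arbitrary: f g)
  case 0
  then show ?case by (auto intro: continuous_on_mult)
next
  case (Suc m)
  have eq: "f x * pderiv_at i g x + pderiv_at i f x * g x = pderiv_at i (\<lambda>z. f z * g z) x"
    if "i < d" "x \<in> V" for i x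
    using Suc.prems that by (simp add: pderiv_at_def deriv_mult)
  have "Ck_on m d V (pderiv_at i (\<lambda>z. f z * g z))" if "i < d" for i
  proof (rule Ck_on_cong[OF assms(1)])
    have *: "Ck_on m d V (pderiv_at i f)" "Ck_on m d V (pderiv_at i g)" using Suc.prems that by auto
    show "Ck_on m d V (\<lambda>x. f x * pderiv_at i g x + pderiv_at i f x * g x)"
      by (rule Ck_on_add[OF assms(1)])
        (rule Suc.IH * Ck_on_lower[OF Suc.prems(1)] Ck_on_lower[OF Suc.prems(2)])+
  qed (rule eq[OF that])
  then show ?case
    using Suc.prems by (auto intro!: continuous_on_mult field_differentiable_mult)
qed

lemma Ck_on_sum:
  assumes "copen d V" "\<And>s. s \<in> S \<Longrightarrow> Ck_on m d V (f s)"
  shows "Ck_on m d V (\<lambda>z. \<Sum>s\<in>S. f s z)"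
  using assms(2)
  by (induction S rule: infinite_finite_induct) (auto intro: Ck_on_const Ck_on_add[OF assms(1)])

text \<open>A function with continuous partial derivatives is totally differentiable over the ground
  field: change one coordinate at a time and apply the mean value inequality on each step.\<close>

lemma total_differentiability:
  fixes F :: "(nat \<Rightarrow> 'k::real_normed_field) \<Rightarrow> 'k"
  assumes V: "copen m V" and F: "Ck_on (Suc 0) m V F" and y: "y \<in> V" and e: "e > 0"
  obtains \<delta> where "\<delta> > 0"
    "\<And>z. z \<in> coord_space m \<Longrightarrow> (\<And>k. k < m \<Longrightarrow> dist (z k) (y k) < \<delta>) \<Longrightarrow>
       norm (F z - F y - (\<Sum>k<m. pderiv_at k F y * (z k - y k))) \<le> e * (\<Sum>k<m. norm (z k - y k))"
proof -
  let ?V = "{w \<in> V. \<forall>k<m. dist (pderiv_at k F w) (pderiv_at k F y) < e}"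
  have "openin (top_of_set V) {w \<in> V. pderiv_at k F w \<in> ball (pderiv_at k F y) e}" if "k < m" for k
    using continuous_openin_preimage_gen[of V "pderiv_at k F" "ball (pderiv_at k F y) e"] F that
    by (simp add: vimage_def Int_def)
  then have "openin (top_of_set V) (V \<inter> (\<Inter>k\<in>{..<m}. {w \<in> V. pderiv_at k F w \<in> ball (pderiv_at k F y) e}))"
    by (intro openin_Int_Inter) auto
  also have "V \<inter> (\<Inter>k\<in>{..<m}. {w \<in> V. pderiv_at k F w \<in> ball (pderiv_at k F y) e}) = ?V"
    by (auto simp: dist_commute)
  finally have W: "copen m ?V" using V openin_trans by blast
  have yW: "y \<in> ?V" using y e by auto
  obtain \<delta> where \<delta>: "\<delta> > 0"
    "\<And>z. z \<in> coord_space m \<Longrightarrow> (\<And>k. k < m \<Longrightarrow> dist (z k) (y k) < \<delta>) \<Longrightarrow> z \<in> ?V"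
    using copen_box[OF W yW] by blast
  \<comment> \<open>\<open>h j\<close> runs from \<open>y\<close> to \<open>z\<close>, taking over one coordinate at each step.\<close>
  have "norm (F z - F y - (\<Sum>k<m. pderiv_at k F y * (z k - y k))) \<le> e * (\<Sum>k<m. norm (z k - y k))"
    if z: "z \<in> coord_space m" "\<And>k. k < m \<Longrightarrow> dist (z k) (y k) < \<delta>" for z
  proof -
    define h where "h j = (\<lambda>i. if i < j then z i else y i)" for j
    have ycs: "y \<in> coord_space m" using y copen_subset[OF V] by auto
    have h0: "h 0 = y" by (simp add: h_def)
    have hm: "h m = z" using z(1) ycs by (auto simp: h_def coord_space_def)
    have hS: "h (Suc k) = (h k)(k := z k)" for k by (auto simp: h_def)
    have step: "norm (F (h (Suc k)) - F (h k) - pderiv_at k F y * (z k - y k)) \<le> e * norm (z k - y k)"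
      if k: "k < m" for k
    proof -
      define g where "g t = F ((h k)(k := t)) - pderiv_at k F y * t" for t
      have der: "(g has_field_derivative (pderiv_at k F ((h k)(k := t)) - pderiv_at k F y))
                   (at t within ball (y k) \<delta>)"
        and bd: "norm (pderiv_at k F ((h k)(k := t)) - pderiv_at k F y) \<le> e"
        if t: "t \<in> ball (y k) \<delta>" for t
      proof -
        have "(h k)(k := t) \<in> ?V"
          using t z k ycs \<delta>(1) by (intro \<delta>(2)) (auto simp: h_def coord_space_def dist_commute)
        then have w: "(h k)(k := t) \<in> V"
          "dist (pderiv_at k F ((h k)(k := t))) (pderiv_at k F y) < e" using k by auto
        from w(2) show "norm (pderiv_at k F ((h k)(k := t)) - pderiv_at k F y) \<le> e"
          by (simp add: dist_norm)
        have "\<forall>x\<in>V. (\<lambda>s. F (x(k := s))) field_differentiable at (x k)"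
          using F k by simp
        from bspec[OF this w(1)]
        have "(\<lambda>s. F ((h k)(k := s))) field_differentiable at t" by simp
        then have "((\<lambda>s. F ((h k)(k := s))) has_field_derivative pderiv_at k F ((h k)(k := t))) (at t)"
          by (simp add: DERIV_deriv_iff_field_differentiable pderiv_at_def)
        then have "(g has_field_derivative (pderiv_at k F ((h k)(k := t)) - pderiv_at k F y)) (at t)"
          unfolding g_def by (auto intro!: derivative_eq_intros)
        then show "(g has_field_derivative (pderiv_at k F ((h k)(k := t)) - pderiv_at k F y))
                   (at t within ball (y k) \<delta>)"
          by (rule has_field_derivative_at_within)
      qed
      have "norm (g (z k) - g (y k)) \<le> e * norm (z k - y k)"
        using field_differentiable_bound[of "ball (y k) \<delta>" g _ e "z k" "y k", OF _ der bd] z(2)[OF k] \<delta>(1)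
        by (simp add: dist_commute)
      moreover have "(h k)(k := y k) = h k" by (auto simp: h_def)
      ultimately show ?thesis by (simp add: g_def hS algebra_simps)
    qed
    have "F z - F y = (\<Sum>k<m. F (h (Suc k)) - F (h k))"
      using sum_lessThan_telescope[of "\<lambda>k. F (h k)" m] h0 hm by simp
    then have "norm (F z - F y - (\<Sum>k<m. pderiv_at k F y * (z k - y k)))
        = norm (\<Sum>k<m. F (h (Suc k)) - F (h k) - pderiv_at k F y * (z k - y k))"
      by (simp add: sum_subtractf)
    also have "\<dots> \<le> (\<Sum>k<m. e * norm (z k - y k))"
      using step by (intro sum_norm_le) auto
    finally show ?thesis by (simp add: sum_distrib_left)
  qed
  with \<delta>(1) show ?thesis by (rule that)
qed

lemma chain_rule_coord:
  fixes F :: "(nat \<Rightarrow> 'k::real_normed_field) \<Rightarrow> 'k"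
  assumes V: "copen m V" and F: "Ck_on (Suc 0) m V F" and y: "\<gamma> t0 \<in> V"
    and cs: "\<forall>\<^sub>F t in nhds t0. \<gamma> t \<in> coord_space m"
    and der: "\<And>k. k < m \<Longrightarrow> ((\<lambda>t. \<gamma> t k) has_field_derivative \<gamma>' k) (at t0)"
  shows "((\<lambda>t. F (\<gamma> t)) has_field_derivative (\<Sum>k<m. pderiv_at k F (\<gamma> t0) * \<gamma>' k)) (at t0)"
proof -
  let ?c = "\<lambda>k. pderiv_at k F (\<gamma> t0)"
  define q where "q k t = (\<gamma> t k - \<gamma> t0 k) / (t - t0)" for k t
  have q: "(q k \<longlongrightarrow> \<gamma>' k) (at t0)" if "k < m" for k
    using der[OF that] by (simp add: has_field_derivative_iff q_def[abs_def])
  \<comment> \<open>The error between the difference quotient and what the linear approximation of \<open>F\<close> predicts.\<close>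
  define E where "E t = (F (\<gamma> t) - F (\<gamma> t0)) / (t - t0) - (\<Sum>k<m. ?c k * q k t)" for t
  have "(E \<longlongrightarrow> 0) (at t0)"
  proof (rule tendstoI)
    fix e :: real assume e: "e > 0"
    define B where "B = (\<Sum>k<m. norm (\<gamma>' k)) + 1"
    have B: "B > 0" by (simp add: B_def add_nonneg_pos sum_nonneg)
    obtain \<delta> where \<delta>: "\<delta> > 0"
      "\<And>z. z \<in> coord_space m \<Longrightarrow> (\<And>k. k < m \<Longrightarrow> dist (z k) (\<gamma> t0 k) < \<delta>) \<Longrightarrow>
       norm (F z - F (\<gamma> t0) - (\<Sum>k<m. ?c k * (z k - \<gamma> t0 k))) \<le> e / B * (\<Sum>k<m. norm (z k - \<gamma> t0 k))"
      using total_differentiability[OF V F y, of "e / B"] e B by auto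
    have ev1: "\<forall>\<^sub>F t in at t0. \<gamma> t \<in> coord_space m"
      using cs by (simp add: eventually_nhds_conv_at)
    have "\<forall>\<^sub>F t in at t0. dist (\<gamma> t k) (\<gamma> t0 k) < \<delta>" if "k < m" for k
      using DERIV_isCont[OF der[OF that]] \<delta>(1) by (auto simp: isCont_def dest: tendstoD)
    then have ev2: "\<forall>\<^sub>F t in at t0. \<forall>k\<in>{..<m}. dist (\<gamma> t k) (\<gamma> t0 k) < \<delta>"
      by (intro eventually_ball_finite) auto
    have "((\<lambda>t. \<Sum>k<m. norm (q k t)) \<longlongrightarrow> (\<Sum>k<m. norm (\<gamma>' k))) (at t0)"
      using q by (intro tendsto_sum tendsto_norm) auto
    then have ev3: "\<forall>\<^sub>F t in at t0. (\<Sum>k<m. norm (q k t)) < B"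
      by (rule order_tendstoD) (simp add: B_def)
    have ev4: "\<forall>\<^sub>F t in at t0. t \<noteq> t0" by (simp add: eventually_at_filter)
    show "\<forall>\<^sub>F t in at t0. dist (E t) 0 < e"
      using ev1 ev2 ev3 ev4
    proof eventually_elim
      case (elim t)
      then have nz: "t - t0 \<noteq> 0" by simp
      have "E t = (F (\<gamma> t) - F (\<gamma> t0) - (\<Sum>k<m. ?c k * (\<gamma> t k - \<gamma> t0 k))) / (t - t0)"
        by (simp only: E_def q_def diff_divide_distrib[of _ "sum _ _"] sum_divide_distrib times_divide_eq_right)
      then have "norm (E t) \<le> e / B * (\<Sum>k<m. norm (\<gamma> t k - \<gamma> t0 k)) / norm (t - t0)"
        using \<delta>(2)[of "\<gamma> t"] elim by (simp only: norm_divide) (rule divide_right_mono, auto)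
      also have "\<dots> = e / B * (\<Sum>k<m. norm (q k t))"
        by (simp add: q_def norm_divide sum_divide_distrib sum_distrib_left)
      also have "\<dots> < e / B * B" using elim e B by (intro mult_strict_left_mono) auto
      finally show ?case using B by simp
    qed
  qed
  then have "((\<lambda>t. E t + (\<Sum>k<m. ?c k * q k t)) \<longlongrightarrow> 0 + (\<Sum>k<m. ?c k * \<gamma>' k)) (at t0)"
    using q by (intro tendsto_add tendsto_sum tendsto_mult tendsto_const) auto
  then show ?thesis by (simp add: has_field_derivative_iff E_def)
qed

text \<open>Induction on the order: by the chain rule, the partial derivatives of the composite are sums of
  products of functions to which the hypotheses apply with the order lowered by one.\<close>

lemma Ck_on_compose:
  fixes F :: "(nat \<Rightarrow> 'k::real_normed_field) \<Rightarrow> 'k"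
  assumes V: "copen n V" and V': "copen m V'"
    and G: "\<And>k. k < m \<Longrightarrow> Ck_on r n V (\<lambda>x. G x k)" and GV: "G ` V \<subseteq> V'"
    and F: "Ck_on r m V' F"
  shows "Ck_on r n V (\<lambda>x. F (G x))"
  using G F
proof (induction r arbitrary: F)
  have cG: "continuous_on V G" if "\<And>k. k < m \<Longrightarrow> Ck_on r n V (\<lambda>x. G x k)" for r
  proof (rule continuous_on_coordinatewise_then_product)
    fix k
    show "continuous_on V (\<lambda>x. G x k)"
    proof (cases "k < m")
      case True
      then show ?thesis using that Ck_on_continuous by blast
    next
      case False
      then have "\<And>x. x \<in> V \<Longrightarrow> 0 = G x k"
        using GV copen_subset[OF V'] by (fastforce simp: coord_space_def)
      then show ?thesis using continuous_on_const[of V "0::'k"] by (simp cong: continuous_on_cong)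
    qed
  qed
  {
    case 0
    then show ?case
      using continuous_on_compose2[OF _ cG[OF 0(1)] GV] by simp
  next
    case (Suc r)
    have G1: "Ck_on r n V (\<lambda>x. G x k)" if "k < m" for k using Suc.prems(1)[OF that] by (rule Ck_on_lower)
    have F1: "Ck_on (Suc 0) m V' F" using Suc.prems(2)
      by (auto intro: Ck_on_continuous[where m = r and d = m])
    have chain: "((\<lambda>t. F (G (x(i := t)))) has_field_derivative
        (\<Sum>k<m. pderiv_at k F (G x) * pderiv_at i (\<lambda>x. G x k) x)) (at (x i))"
      if i: "i < n" and x: "x \<in> V" for i x
    proof -
      have "((\<lambda>t. F (G (x(i := t)))) has_field_derivative
          (\<Sum>k<m. pderiv_at k F (G (x(i := x i))) * pderiv_at i (\<lambda>x. G x k) x)) (at (x i))"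
      proof (rule chain_rule_coord[OF V' F1])
        show "G (x(i := x i)) \<in> V'" using x GV by auto
        show "\<forall>\<^sub>F t in nhds (x i). G (x(i := t)) \<in> coord_space m"
          using copen_line[OF V x i] by eventually_elim (use GV copen_subset[OF V'] in blast)
        show "((\<lambda>t. G (x(i := t)) k) has_field_derivative pderiv_at i (\<lambda>x. G x k) x) (at (x i))"
          if "k < m" for k
          using Suc.prems(1)[OF that] i x by (simp add: pderiv_at_def DERIV_deriv_iff_field_differentiable)
      qed
      then show ?thesis by simp
    qed
    have "Ck_on r n V (pderiv_at i (\<lambda>x. F (G x)))" if i: "i < n" for i
    proof (rule Ck_on_cong[OF V])
      show "Ck_on r n V (\<lambda>x. \<Sum>k<m. pderiv_at k F (G x) * pderiv_at i (\<lambda>x. G x k) x)"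
      proof (rule Ck_on_sum[OF V], rule Ck_on_mult[OF V])
        fix k assume "k \<in> {..<m}"
        then have k: "k < m" by simp
        show "Ck_on r n V (\<lambda>x. pderiv_at k F (G x))"
          using Suc.prems(2) k by - (rule Suc.IH[OF G1], auto)
        show "Ck_on r n V (pderiv_at i (\<lambda>x. G x k))"
          using Suc.prems(1)[OF k] i by simp
      qed
      show "(\<Sum>k<m. pderiv_at k F (G x) * pderiv_at i (\<lambda>x. G x k) x) = pderiv_at i (\<lambda>x. F (G x)) x"
        if "x \<in> V" for x
        using DERIV_imp_deriv[OF chain[OF i that]] by (simp add: pderiv_at_def)
    qed
    moreover have "continuous_on V (\<lambda>x. F (G x))"
      using continuous_on_compose2[OF Ck_on_continuous[OF F1] cG[OF G1] GV] by simp
    ultimately show ?case using chain by (auto simp: field_differentiable_def)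
  }
qed

text \<open>The second difference of \<open>f\<close> over a small parallelogram is approximated by either mixed
  second derivative, which forces the two to agree.\<close>

lemma second_difference_bound:
  fixes f :: "(nat \<Rightarrow> 'k::real_normed_field) \<Rightarrow> 'k"
  assumes V: "copen d V" and f: "Ck_on 2 d V f" and x: "x \<in> V"
    and ij: "i < d" "j < d" "i \<noteq> j" and e: "e > 0"
  obtains \<delta> where "\<delta> > 0"
    "\<And>h k. norm h < \<delta> \<Longrightarrow> norm k < \<delta> \<Longrightarrow>
      norm (f (x(i := x i + h, j := x j + k)) - f (x(i := x i + h)) - f (x(j := x j + k)) + f x
            - pderiv_at j (pderiv_at i f) x * h * k) \<le> e * norm h * norm k"
proof -
  define c where "c = pderiv_at j (pderiv_at i f) x"
  let ?V = "{w \<in> V. dist (pderiv_at j (pderiv_at i f) w) c < e}"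
  have "continuous_on V (pderiv_at j (pderiv_at i f))"
    using f ij by (simp add: eval_nat_numeral)
  then have "openin (top_of_set V) ?V"
    using continuous_openin_preimage_gen[of V "pderiv_at j (pderiv_at i f)" "ball c e"]
    by (simp add: vimage_def Int_def dist_commute)
  then have W: "copen d ?V" using V openin_trans by blast
  have xW: "x \<in> ?V" using x e by (simp add: c_def)
  obtain \<delta> where \<delta>: "\<delta> > 0"
    "\<And>z. z \<in> coord_space d \<Longrightarrow> (\<And>k. k < d \<Longrightarrow> dist (z k) (x k) < \<delta>) \<Longrightarrow> z \<in> ?V"
    using copen_box[OF W xW] by blast
  have xcs: "x \<in> coord_space d" using x copen_subset[OF V] by auto
  have inV: "x(i := s, j := t) \<in> ?V" if "s \<in> ball (x i) \<delta>" "t \<in> ball (x j) \<delta>" for s t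
    using that xcs ij \<delta>(1) by (intro \<delta>(2) coord_space_upd) (auto simp: dist_commute)
  have inV': "x(i := s) \<in> ?V" if "s \<in> ball (x i) \<delta>" for s
    using inV[OF that, of "x j"] \<delta>(1) ij by (auto simp: fun_upd_idem)
  have d1: "((\<lambda>s. f (w(i := s))) has_field_derivative pderiv_at i f w) (at (w i))" if "w \<in> V" for w
    using f ij that by (simp add: eval_nat_numeral pderiv_at_def DERIV_deriv_iff_field_differentiable)
  have d2: "((\<lambda>s. pderiv_at i f (w(j := s))) has_field_derivative
      pderiv_at j (pderiv_at i f) w) (at (w j))" if "w \<in> V" for w
  proof -
    have "(\<lambda>s. pderiv_at i f (w(j := s))) field_differentiable at (w j)"
      using f ij that by (simp add: eval_nat_numeral)
    then have "((\<lambda>s. pderiv_at i f (w(j := s))) has_field_derivative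
      deriv (\<lambda>s. pderiv_at i f (w(j := s))) (w j)) (at (w j))"
      by (simp add: DERIV_deriv_iff_field_differentiable)
    then show ?thesis by (simp only: pderiv_at_def[of j])
  qed
  have "norm (f (x(i := x i + h, j := x j + k)) - f (x(i := x i + h)) - f (x(j := x j + k)) + f x
            - c * h * k) \<le> e * norm h * norm k" if h: "norm h < \<delta>" and k: "norm k < \<delta>" for h k
  proof -
    have kb: "x j + k \<in> ball (x j) \<delta>" "x j \<in> ball (x j) \<delta>" using k \<delta>(1) by (auto simp: dist_norm)
    \<comment> \<open>The second difference is an increment of \<open>\<phi>\<close>, whose derivative is in turn an increment of
      the function \<open>\<psi>\<close> below; the mean value inequality is applied to both.\<close>
    define \<phi> where "\<phi> s = f (x(i := s, j := x j + k)) - f (x(i := s)) - c * k * s" for s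
    define \<phi>' where "\<phi>' s = pderiv_at i f (x(i := s, j := x j + k)) - pderiv_at i f (x(i := s)) - c * k" for s
    have der: "(\<phi> has_field_derivative \<phi>' s) (at s within ball (x i) \<delta>)"
      and bd: "norm (\<phi>' s) \<le> e * norm k" if s: "s \<in> ball (x i) \<delta>" for s
    proof -
      have "x(i := s, j := x j + k) \<in> V" using inV[OF s kb(1)] by auto
      from d1[OF this] have *: "((\<lambda>s. f (x(i := s, j := x j + k))) has_field_derivative
           pderiv_at i f (x(i := s, j := x j + k))) (at s)"
        using ij by (simp add: fun_upd_twist)
      have "x(i := s) \<in> V" using inV'[OF s] by auto
      from d1[OF this] have **: "((\<lambda>s. f (x(i := s))) has_field_derivative pderiv_at i f (x(i := s))) (at s)"
        by simp
      have "(\<phi> has_field_derivative \<phi>' s) (at s)"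
        unfolding \<phi>_def \<phi>'_def by (rule derivative_eq_intros * ** refl | simp)+
      then show "(\<phi> has_field_derivative \<phi>' s) (at s within ball (x i) \<delta>)"
        by (rule has_field_derivative_at_within)
      define \<psi> where "\<psi> t = pderiv_at i f (x(i := s, j := t)) - c * t" for t
      define \<psi>' where "\<psi>' t = pderiv_at j (pderiv_at i f) (x(i := s, j := t)) - c" for t
      have der2: "(\<psi> has_field_derivative \<psi>' t) (at t within ball (x j) \<delta>)"
        and bd2: "norm (\<psi>' t) \<le> e" if t: "t \<in> ball (x j) \<delta>" for t
      proof -
        have w: "x(i := s, j := t) \<in> ?V" using inV[OF s t] .
        then show "norm (\<psi>' t) \<le> e" by (simp add: \<psi>'_def dist_norm)
        have "((\<lambda>t. pderiv_at i f (x(i := s, j := t))) has_field_derivative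
           pderiv_at j (pderiv_at i f) (x(i := s, j := t))) (at t)"
          using d2[of "x(i := s, j := t)"] w by simp
        then have "(\<psi> has_field_derivative \<psi>' t) (at t)"
          unfolding \<psi>_def \<psi>'_def by (auto intro!: derivative_eq_intros)
        then show "(\<psi> has_field_derivative \<psi>' t) (at t within ball (x j) \<delta>)"
          by (rule has_field_derivative_at_within)
      qed
      have "norm (\<psi> (x j + k) - \<psi> (x j)) \<le> e * norm (x j + k - x j)"
        by (rule field_differentiable_bound[OF convex_ball der2 bd2 kb])
      moreover have "\<psi> (x j + k) - \<psi> (x j) = \<phi>' s"
        using ij by (simp add: \<psi>_def \<phi>'_def algebra_simps fun_upd_idem)
      ultimately show "norm (\<phi>' s) \<le> e * norm k" by simp
    qed
    have "norm (\<phi> (x i + h) - \<phi> (x i)) \<le> e * norm k * norm (x i + h - x i)"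
      by (rule field_differentiable_bound[OF convex_ball der bd]) (use h \<delta>(1) in \<open>auto simp: dist_norm\<close>)
    moreover have "\<phi> (x i + h) - \<phi> (x i) =
       f (x(i := x i + h, j := x j + k)) - f (x(i := x i + h)) - f (x(j := x j + k)) + f x - c * h * k"
      by (simp add: \<phi>_def algebra_simps)
    ultimately show ?thesis by (simp add: mult_ac)
  qed
  with \<delta>(1) show ?thesis using that by (simp add: c_def)
qed

lemma pderiv_at_commute:
  fixes f :: "(nat \<Rightarrow> 'k::real_normed_field) \<Rightarrow> 'k"
  assumes V: "copen d V" and f: "Ck_on 2 d V f" and x: "x \<in> V" and ij: "i < d" "j < d"
  shows "pderiv_at i (pderiv_at j f) x = pderiv_at j (pderiv_at i f) x"
proof (cases "i = j")
  case False
  let ?a = "pderiv_at i (pderiv_at j f) x" and ?b = "pderiv_at j (pderiv_at i f) x"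
  have *: "norm (?a - ?b) \<le> 2 * e" if e: "e > 0" for e
  proof -
    obtain \<delta> where \<delta>: "\<delta> > 0" "\<And>h k. norm h < \<delta> \<Longrightarrow> norm k < \<delta> \<Longrightarrow>
      norm (f (x(i := x i + h, j := x j + k)) - f (x(i := x i + h)) - f (x(j := x j + k)) + f x
            - ?b * h * k) \<le> e * norm h * norm k"
      using second_difference_bound[OF V f x ij False e] by metis
    obtain \<delta>' where \<delta>': "\<delta>' > 0" "\<And>h k. norm h < \<delta>' \<Longrightarrow> norm k < \<delta>' \<Longrightarrow>
      norm (f (x(j := x j + h, i := x i + k)) - f (x(j := x j + h)) - f (x(i := x i + k)) + f x
            - ?a * h * k) \<le> e * norm h * norm k"
      using second_difference_bound[OF V f x ij(2,1) _ e] False by metis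
    \<comment> \<open>Any nonzero element that is small enough for both estimates.\<close>
    define h :: 'k where "h = of_real (min \<delta> \<delta>' / 2)"
    have h: "norm h < \<delta>" "norm h < \<delta>'" "h \<noteq> 0" using \<delta>(1) \<delta>'(1) by (auto simp: h_def min_def)
    define D where "D = f (x(i := x i + h, j := x j + h)) - f (x(i := x i + h)) - f (x(j := x j + h)) + f x"
    have 1: "norm (D - ?b * h * h) \<le> e * norm h * norm h"
      using \<delta>(2)[OF h(1) h(1)] by (simp add: D_def)
    have "x(j := x j + h, i := x i + h) = x(i := x i + h, j := x j + h)"
      using False by (rule fun_upd_twist[OF not_sym])
    then have 2: "norm (D - ?a * h * h) \<le> e * norm h * norm h"
      using \<delta>'(2)[OF h(2) h(2)] by (simp add: D_def algebra_simps)
    have "norm ((?a - ?b) * h * h) = norm ((D - ?b * h * h) - (D - ?a * h * h))"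
      by (simp add: algebra_simps)
    also have "\<dots> \<le> 2 * (e * norm h * norm h)"
      using norm_triangle_ineq4[of "D - ?b * h * h" "D - ?a * h * h"] 1 2 by linarith
    finally have "norm (?a - ?b) * (norm h * norm h) \<le> 2 * e * (norm h * norm h)"
      by (simp add: norm_mult mult_ac)
    then show ?thesis using h(3) by simp
  qed
  have "norm (?a - ?b) \<le> 0"
  proof (rule field_le_epsilon)
    fix e :: real assume "e > 0"
    then show "norm (?a - ?b) \<le> 0 + e" using *[of "e / 2"] by simp
  qed
  then show ?thesis by simp
qed simp

lemma smooth_coord_subset: "smooth_coord d V f \<Longrightarrow> W \<subseteq> V \<Longrightarrow> smooth_coord d W f"
  by (auto simp: smooth_coord_def intro: Ck_on_subset)

lemma smooth_coord_cong:
  "copen d V \<Longrightarrow> smooth_coord d V f \<Longrightarrow> (\<And>z. z \<in> V \<Longrightarrow> f z = g z) \<Longrightarrow> smooth_coord d V g"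
  by (meson Ck_on_cong smooth_coord_def)

lemma smooth_coord_const: "smooth_coord d V (\<lambda>z. c)"
  by (simp add: smooth_coord_def Ck_on_const)

lemma smooth_coord_coord: "smooth_coord d V (\<lambda>z. z i)"
  by (simp add: smooth_coord_def Ck_on_coord)

lemma smooth_coord_add:
  "copen d V \<Longrightarrow> smooth_coord d V f \<Longrightarrow> smooth_coord d V g \<Longrightarrow> smooth_coord d V (\<lambda>z. f z + g z)"
  by (simp add: smooth_coord_def Ck_on_add)

lemma smooth_coord_mult:
  "copen d V \<Longrightarrow> smooth_coord d V f \<Longrightarrow> smooth_coord d V g \<Longrightarrow> smooth_coord d V (\<lambda>z. f z * g z)"
  by (simp add: smooth_coord_def Ck_on_mult)

lemma smooth_coord_pderiv: "smooth_coord d V f \<Longrightarrow> i < d \<Longrightarrow> smooth_coord d V (pderiv_at i f)"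
  unfolding smooth_coord_def by (metis Ck_on.simps(2))

lemma smooth_coord_differentiable:
  "smooth_coord d V f \<Longrightarrow> i < d \<Longrightarrow> x \<in> V \<Longrightarrow> (\<lambda>t. f (x(i := t))) field_differentiable at (x i)"
  unfolding smooth_coord_def by (metis Ck_on.simps(2))

lemma smooth_coord_compose:
  assumes "copen n V" "copen m V'" "\<And>k. k < m \<Longrightarrow> smooth_coord n V (\<lambda>x. G x k)"
    "G ` V \<subseteq> V'" "smooth_coord m V' F"
  shows "smooth_coord n V (\<lambda>x. F (G x))"
  unfolding smooth_coord_def
proof
  show "Ck_on r n V (\<lambda>x. F (G x))" for r
    by (rule Ck_on_compose[OF assms(1,2) _ assms(4)]) (use assms(3,5) in \<open>auto simp: smooth_coord_def\<close>)
qed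

section \<open>Smooth functions on manifolds\<close>

lemma chart_openin:
  "manifold M \<Longrightarrow> (U, \<phi>) \<in> matlas M \<Longrightarrow> openin (mtop M) U"
  by (auto simp: manifold_def is_chart_def)

lemma chart_inj:
  assumes "manifold M" "(U, \<phi>) \<in> matlas M" shows "inj_on \<phi> U"
proof -
  have "openin (mtop M) U" "homeomorphic_map (subtopology (mtop M) U) (top_of_set (\<phi> ` U)) \<phi>"
    using assms by (auto simp: manifold_def is_chart_def)
  then show ?thesis
    using openin_subset by (fastforce simp: homeomorphic_map_def inf_absorb2 dest: homeomorphic_imp_injective_map)
qed

lemma chart_copen:
  assumes "manifold M" "(U, \<phi>) \<in> matlas M" "openin (mtop M) W" "W \<subseteq> U"
  shows "copen (mdim M) (\<phi> ` W)"
proof -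
  have h: "homeomorphic_map (subtopology (mtop M) U) (top_of_set (\<phi> ` U)) \<phi>"
    and U: "copen (mdim M) (\<phi> ` U)"
    using assms by (auto simp: manifold_def is_chart_def)
  have "openin (subtopology (mtop M) U) W"
    using assms(3,4) by (auto simp: openin_subtopology)
  then have "openin (top_of_set (\<phi> ` U)) (\<phi> ` W)"
    using homeomorphic_imp_open_map[OF h] by (simp add: open_map_def)
  then show ?thesis using U openin_trans by blast
qed

lemma chart_coord:
  assumes "manifold M" "(U, \<phi>) \<in> matlas M" "p \<in> U"
  shows "\<phi> p \<in> coord_space (mdim M)"
  using chart_copen[OF assms(1,2) chart_openin[OF assms(1,2)]] assms(3) copen_subset by blast

lemma chart_inv:
  assumes "manifold M" "(U, \<phi>) \<in> matlas M"
  shows "p \<in> U \<Longrightarrow> inv_into U \<phi> (\<phi> p) = p"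
    and "x \<in> \<phi> ` W \<Longrightarrow> W \<subseteq> U \<Longrightarrow> inv_into U \<phi> x \<in> W"
    and "x \<in> \<phi> ` U \<Longrightarrow> \<phi> (inv_into U \<phi> x) = x"
  using chart_inj[OF assms] by (auto simp: subset_iff f_inv_into_f)

lemma manifold_cover: "manifold M \<Longrightarrow> \<Union>(fst ` matlas M) = topspace (mtop M)"
  unfolding manifold_def by (elim conjE)

lemma chart_at:
  assumes "manifold M" "p \<in> topspace (mtop M)"
  obtains U \<phi> where "(U, \<phi>) \<in> matlas M" "p \<in> U"
proof -
  have "p \<in> \<Union>(fst ` matlas M)" using assms manifold_cover by blast
  then obtain c where "c \<in> matlas M" "p \<in> fst c" by blast
  then show ?thesis using that[of "fst c" "snd c"] by simp
qed

lemma smooth_on_open: "smooth_on M W f \<Longrightarrow> openin (mtop M) W"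
  by (simp add: smooth_on_def)

lemma smooth_onD:
  "smooth_on M W f \<Longrightarrow> (U, \<phi>) \<in> matlas M \<Longrightarrow>
    smooth_coord (mdim M) (\<phi> ` (U \<inter> W)) (f \<circ> inv_into U \<phi>)"
  by (auto simp: smooth_on_def)

lemma smooth_onI:
  assumes "openin (mtop M) W"
    "\<And>U \<phi>. (U, \<phi>) \<in> matlas M \<Longrightarrow> smooth_coord (mdim M) (\<phi> ` (U \<inter> W)) (f \<circ> inv_into U \<phi>)"
  shows "smooth_on M W f"
  using assms by (auto simp: smooth_on_def)

lemma manifold_transition:
  assumes "manifold M" "(U, \<phi>) \<in> matlas M" "(V, \<psi>) \<in> matlas M" "i < mdim M"
  shows "smooth_coord (mdim M) (\<phi> ` (U \<inter> V)) (\<lambda>x. \<psi> (inv_into U \<phi> x) i)"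
proof -
  from assms(1) have "\<forall>(U, \<phi>)\<in>matlas M. \<forall>(V, \<psi>)\<in>matlas M. \<forall>i<mdim M.
      smooth_coord (mdim M) (\<phi> ` (U \<inter> V)) (\<lambda>x. \<psi> (inv_into U \<phi> x) i)"
    unfolding manifold_def by (elim conjE)
  from bspec[OF this assms(2), simplified] have "\<forall>(V, \<psi>)\<in>matlas M. \<forall>i<mdim M.
      smooth_coord (mdim M) (\<phi> ` (U \<inter> V)) (\<lambda>x. \<psi> (inv_into U \<phi> x) i)" .
  from bspec[OF this assms(3), simplified] assms(4) show ?thesis by simp
qed

text \<open>Smoothness may be tested in a single chart, because transition maps are smooth.\<close>

lemma smooth_on_chart_iff:
  assumes M: "manifold M" and c: "(V, \<psi>) \<in> matlas M" and W: "openin (mtop M) W" "W \<subseteq> V"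
  shows "smooth_on M W f \<longleftrightarrow> smooth_coord (mdim M) (\<psi> ` W) (f \<circ> inv_into V \<psi>)"
proof
  assume "smooth_on M W f"
  from smooth_onD[OF this c] W(2) show "smooth_coord (mdim M) (\<psi> ` W) (f \<circ> inv_into V \<psi>)"
    by (simp add: inf_absorb2)
next
  assume F: "smooth_coord (mdim M) (\<psi> ` W) (f \<circ> inv_into V \<psi>)"
  show "smooth_on M W f"
  proof (rule smooth_onI[OF W(1)])
    fix U \<phi> assume c': "(U, \<phi>) \<in> matlas M"
    have oU: "openin (mtop M) (U \<inter> W)"
      using chart_openin[OF M c'] W(1) by (rule openin_Int)
    let ?A = "\<phi> ` (U \<inter> W)"
    have A: "copen (mdim M) ?A" by (rule chart_copen[OF M c' oU]) simp
    have inv: "inv_into U \<phi> x \<in> U \<inter> W" if "x \<in> ?A" for x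
      using chart_inv(2)[OF M c' that] by simp
    have trans: "smooth_coord (mdim M) (\<phi> ` (U \<inter> V)) (\<lambda>x. \<psi> (inv_into U \<phi> x) i)"
      if "i < mdim M" for i
      by (rule manifold_transition[OF M c' c that])
    have "smooth_coord (mdim M) ?A (\<lambda>x. (f \<circ> inv_into V \<psi>) (\<psi> (inv_into U \<phi> x)))"
    proof (rule smooth_coord_compose[OF A chart_copen[OF M c W] _ _ F])
      show "smooth_coord (mdim M) ?A (\<lambda>x. \<psi> (inv_into U \<phi> x) k)" if "k < mdim M" for k
        by (rule smooth_coord_subset[OF trans[OF that]]) (use W(2) in auto)
      show "(\<lambda>x. \<psi> (inv_into U \<phi> x)) ` ?A \<subseteq> \<psi> ` W"
        using inv by auto
    qed
    then show "smooth_coord (mdim M) ?A (f \<circ> inv_into U \<phi>)"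
    proof (rule smooth_coord_cong[OF A])
      fix x assume "x \<in> ?A"
      from inv[OF this] W(2) show "(f \<circ> inv_into V \<psi>) (\<psi> (inv_into U \<phi> x)) = (f \<circ> inv_into U \<phi>) x"
        using chart_inv(1)[OF M c, of "inv_into U \<phi> x"] by auto
    qed
  qed
qed

lemma smooth_on_subset:
  assumes "manifold M" "smooth_on M W f" "openin (mtop M) W'" "W' \<subseteq> W"
  shows "smooth_on M W' f"
  using assms(2-) by (auto intro!: smooth_onI smooth_coord_subset[OF smooth_onD[OF assms(2)]])

lemma smooth_on_map2:
  assumes M: "manifold M" and f: "smooth_on M W f" and g: "smooth_on M W g"
    and op: "\<And>V F G. copen (mdim M) V \<Longrightarrow> smooth_coord (mdim M) V F \<Longrightarrow> smooth_coord (mdim M) V G \<Longrightarrow>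
        smooth_coord (mdim M) V (\<lambda>z. h (F z) (G z))"
  shows "smooth_on M W (\<lambda>q. h (f q) (g q))"
proof (rule smooth_onI[OF smooth_on_open[OF f]])
  fix U \<phi> assume c: "(U, \<phi>) \<in> matlas M"
  have "openin (mtop M) (U \<inter> W)"
    using chart_openin[OF M c] smooth_on_open[OF f] by (rule openin_Int)
  then have "copen (mdim M) (\<phi> ` (U \<inter> W))" by (rule chart_copen[OF M c]) simp
  from op[OF this smooth_onD[OF f c] smooth_onD[OF g c]]
  show "smooth_coord (mdim M) (\<phi> ` (U \<inter> W)) ((\<lambda>q. h (f q) (g q)) \<circ> inv_into U \<phi>)"
    by (simp add: o_def)
qed

lemma smooth_on_cong:
  assumes M: "manifold M" and f: "smooth_on M W f" and eq: "\<And>q. q \<in> W \<Longrightarrow> f q = g q"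
  shows "smooth_on M W g"
proof (rule smooth_onI[OF smooth_on_open[OF f]])
  fix U \<phi> assume c: "(U, \<phi>) \<in> matlas M"
  have "openin (mtop M) (U \<inter> W)"
    using chart_openin[OF M c] smooth_on_open[OF f] by (rule openin_Int)
  then have "copen (mdim M) (\<phi> ` (U \<inter> W))" by (rule chart_copen[OF M c]) simp
  from this smooth_onD[OF f c]
  show "smooth_coord (mdim M) (\<phi> ` (U \<inter> W)) (g \<circ> inv_into U \<phi>)"
    by (rule smooth_coord_cong) (use eq chart_inv(2)[OF M c, of _ "U \<inter> W"] in auto)
qed

lemma smooth_on_const: "manifold M \<Longrightarrow> openin (mtop M) W \<Longrightarrow> smooth_on M W (\<lambda>q. c)"
  by (auto intro!: smooth_onI simp: o_def smooth_coord_const)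

lemma smooth_on_add:
  "manifold M \<Longrightarrow> smooth_on M W f \<Longrightarrow> smooth_on M W g \<Longrightarrow> smooth_on M W (\<lambda>q. f q + g q)"
  by (rule smooth_on_map2) (auto intro: smooth_coord_add)

lemma smooth_on_mult:
  "manifold M \<Longrightarrow> smooth_on M W f \<Longrightarrow> smooth_on M W g \<Longrightarrow> smooth_on M W (\<lambda>q. f q * g q)"
  by (rule smooth_on_map2) (auto intro: smooth_coord_mult)

lemma smooth_on_sum:
  assumes "manifold M" "openin (mtop M) W" "\<And>s. s \<in> S \<Longrightarrow> smooth_on M W (f s)"
  shows "smooth_on M W (\<lambda>q. \<Sum>s\<in>S. f s q)"
  using assms(3)
  by (induction S rule: infinite_finite_induct)
     (auto intro: smooth_on_const[OF assms(1,2)] smooth_on_add[OF assms(1)])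

definition eq_near :: "('a, 'k::real_normed_field) mfd \<Rightarrow> 'a \<Rightarrow> ('a \<Rightarrow> 'b) \<Rightarrow> ('a \<Rightarrow> 'b) \<Rightarrow> bool" where
  "eq_near M p f g \<longleftrightarrow> (\<exists>W. openin (mtop M) W \<and> p \<in> W \<and> (\<forall>q\<in>W. f q = g q))"

lemma eq_nearI: "openin (mtop M) W \<Longrightarrow> p \<in> W \<Longrightarrow> (\<And>q. q \<in> W \<Longrightarrow> f q = g q) \<Longrightarrow> eq_near M p f g"
  by (auto simp: eq_near_def)

lemma smooth_at_topspace: "smooth_at M p f \<Longrightarrow> p \<in> topspace (mtop M)"
  by (auto simp: smooth_at_def smooth_on_def dest: openin_subset)

lemma smooth_on_at: "smooth_on M W f \<Longrightarrow> q \<in> W \<Longrightarrow> smooth_at M q f"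
  by (auto simp: smooth_at_def)

lemma smooth_at_open:
  assumes "smooth_at M p f"
  obtains W where "openin (mtop M) W" "p \<in> W" "\<And>q. q \<in> W \<Longrightarrow> smooth_at M q f"
  using assms by (auto simp: smooth_at_def smooth_on_def)

lemma smooth_at_chart:
  assumes "manifold M" "(U, \<phi>) \<in> matlas M" "p \<in> U" "smooth_at M p f"
  obtains W where "p \<in> W" "W \<subseteq> U" "openin (mtop M) W" "smooth_on M W f"
proof -
  obtain W where W: "p \<in> W" "smooth_on M W f" using assms(4) by (auto simp: smooth_at_def)
  have "openin (mtop M) (U \<inter> W)"
    using chart_openin[OF assms(1,2)] smooth_on_open[OF W(2)] by (rule openin_Int)
  then show ?thesis
    using that[of "U \<inter> W"] W assms(3) smooth_on_subset[OF assms(1) W(2), of "U \<inter> W"] by auto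
qed

lemma smooth_at_common:
  assumes "manifold M" "smooth_at M p f" "smooth_at M p g"
  obtains W where "p \<in> W" "smooth_on M W f" "smooth_on M W g"
proof -
  obtain W W' where W: "p \<in> W" "smooth_on M W f" "p \<in> W'" "smooth_on M W' g"
    using assms by (auto simp: smooth_at_def)
  have o: "openin (mtop M) (W \<inter> W')"
    using smooth_on_open[OF W(2)] smooth_on_open[OF W(4)] by (rule openin_Int)
  show ?thesis
    by (rule that[of "W \<inter> W'"])
       (use W o in \<open>auto intro: smooth_on_subset[OF assms(1) W(2)] smooth_on_subset[OF assms(1) W(4)]\<close>)
qed

lemma smooth_at_const: "manifold M \<Longrightarrow> p \<in> topspace (mtop M) \<Longrightarrow> smooth_at M p (\<lambda>q. c)"
  by (auto simp: smooth_at_def intro: smooth_on_const)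

lemma smooth_at_add:
  assumes "manifold M" "smooth_at M p f" "smooth_at M p g"
  shows "smooth_at M p (\<lambda>q. f q + g q)"
proof -
  obtain W where "p \<in> W" "smooth_on M W f" "smooth_on M W g"
    using smooth_at_common[OF assms] .
  then show ?thesis using smooth_on_add[OF assms(1)] by (auto simp: smooth_at_def)
qed

lemma smooth_at_mult:
  assumes "manifold M" "smooth_at M p f" "smooth_at M p g"
  shows "smooth_at M p (\<lambda>q. f q * g q)"
proof -
  obtain W where "p \<in> W" "smooth_on M W f" "smooth_on M W g"
    using smooth_at_common[OF assms] .
  then show ?thesis using smooth_on_mult[OF assms(1)] by (auto simp: smooth_at_def)
qed

lemma smooth_at_sum:
  assumes "manifold M" "p \<in> topspace (mtop M)" "\<And>s. s \<in> S \<Longrightarrow> smooth_at M p (f s)"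
  shows "smooth_at M p (\<lambda>q. \<Sum>s\<in>S. f s q)"
  using assms(3)
  by (induction S rule: infinite_finite_induct)
     (auto intro: smooth_at_const[OF assms(1,2)] smooth_at_add[OF assms(1)])

lemma smooth_at_cong:
  assumes "manifold M" "smooth_at M p f" "eq_near M p f g"
  shows "smooth_at M p g"
proof -
  obtain W W' where W: "p \<in> W" "smooth_on M W f" "p \<in> W'" "openin (mtop M) W'" "\<forall>q\<in>W'. f q = g q"
    using assms by (auto simp: smooth_at_def eq_near_def)
  have o: "openin (mtop M) (W \<inter> W')"
    using smooth_on_open[OF W(2)] W(4) by (rule openin_Int)
  have "smooth_on M (W \<inter> W') g"
    by (rule smooth_on_cong[OF assms(1) smooth_on_subset[OF assms(1) W(2) o]]) (use W in auto)
  then show ?thesis using W by (auto simp: smooth_at_def)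
qed

section \<open>Derivations at a point\<close>

lemma chart_deriv_local:
  assumes M: "manifold M" and c: "c \<in> matlas M" and p: "p \<in> fst c" and i: "i < mdim M"
    and eq: "eq_near M p f g"
  shows "chart_deriv c i f p = chart_deriv c i g p"
proof -
  obtain U \<phi> where [simp]: "c = (U, \<phi>)" by (cases c)
  obtain W where W: "openin (mtop M) W" "p \<in> W" "\<And>q. q \<in> W \<Longrightarrow> f q = g q"
    using eq by (auto simp: eq_near_def)
  have c': "(U, \<phi>) \<in> matlas M" using c by simp
  have o: "openin (mtop M) (U \<inter> W)"
    using chart_openin[OF M c'] W(1) by (rule openin_Int)
  show ?thesis unfolding chart_deriv_def
    by (rule pderiv_at_cong[OF chart_copen[OF M c' o]])
       (use p W i chart_inv(2)[OF M c', of _ "U \<inter> W"] in auto)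
qed

lemma chart_deriv_coords:
  assumes M: "manifold M" and c: "(U, \<phi>) \<in> matlas M" and x: "x \<in> \<phi> ` U"
  shows "(chart_deriv (U, \<phi>) i f \<circ> inv_into U \<phi>) x = pderiv_at i (f \<circ> inv_into U \<phi>) x"
  using chart_inv(3)[OF M c x] by (simp add: chart_deriv_def)

lemma chart_deriv_smooth_on:
  assumes M: "manifold M" and c: "c \<in> matlas M" and W: "W \<subseteq> fst c" and i: "i < mdim M"
    and f: "smooth_on M W f"
  shows "smooth_on M W (chart_deriv c i f)"
proof -
  obtain U \<phi> where [simp]: "c = (U, \<phi>)" by (cases c)
  have c': "(U, \<phi>) \<in> matlas M" and W': "W \<subseteq> U" using c W by auto
  note o = smooth_on_open[OF f]
  have "smooth_coord (mdim M) (\<phi> ` W) (f \<circ> inv_into U \<phi>)"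
    using f smooth_on_chart_iff[OF M c' o W'] by simp
  then have "smooth_coord (mdim M) (\<phi> ` W) (pderiv_at i (f \<circ> inv_into U \<phi>))"
    using i by (rule smooth_coord_pderiv)
  then have "smooth_coord (mdim M) (\<phi> ` W) (chart_deriv c i f \<circ> inv_into U \<phi>)"
    by (rule smooth_coord_cong[OF chart_copen[OF M c' o W']])
       (use W' chart_deriv_coords[OF M c'] in auto)
  then show ?thesis using smooth_on_chart_iff[OF M c' o W'] by simp
qed

lemma chart_deriv_smooth_at:
  assumes M: "manifold M" and c: "c \<in> matlas M" and p: "p \<in> fst c" and i: "i < mdim M"
    and f: "smooth_at M p f"
  shows "smooth_at M p (chart_deriv c i f)"
proof -
  have "(fst c, snd c) \<in> matlas M" using c by simp
  from smooth_at_chart[OF M this p f] obtain W where W: "p \<in> W" "W \<subseteq> fst c" "smooth_on M W f" .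
  from W(1) chart_deriv_smooth_on[OF M c W(2) i W(3)] show ?thesis by (auto simp: smooth_at_def)
qed

lemma smooth_at_differentiable:
  assumes M: "manifold M" and c: "(U, \<phi>) \<in> matlas M" and p: "p \<in> U" and i: "i < mdim M"
    and f: "smooth_at M p f"
  shows "(\<lambda>t. (f \<circ> inv_into U \<phi>) ((\<phi> p)(i := t))) field_differentiable at (\<phi> p i)"
proof -
  obtain W where W: "p \<in> W" "W \<subseteq> U" "openin (mtop M) W" "smooth_on M W f"
    using smooth_at_chart[OF M c p f] .
  then have "smooth_coord (mdim M) (\<phi> ` W) (f \<circ> inv_into U \<phi>)"
    using smooth_on_chart_iff[OF M c W(3,2)] by simp
  from smooth_coord_differentiable[OF this i, of "\<phi> p"] W(1) show ?thesis by auto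
qed

lemma chart_deriv_const: "chart_deriv c i (\<lambda>q. a) p = 0"
  by (simp add: chart_deriv_def o_def)

lemma chart_deriv_add:
  assumes M: "manifold M" and c: "c \<in> matlas M" and p: "p \<in> fst c" and i: "i < mdim M"
    and f: "smooth_at M p f" and g: "smooth_at M p g"
  shows "chart_deriv c i (\<lambda>q. f q + g q) p = chart_deriv c i f p + chart_deriv c i g p"
  using smooth_at_differentiable[OF M _ p i f, of "snd c"] smooth_at_differentiable[OF M _ p i g, of "snd c"] c
  by (simp add: chart_deriv_def pderiv_at_def)

lemma chart_deriv_mult:
  assumes M: "manifold M" and c: "c \<in> matlas M" and p: "p \<in> fst c" and i: "i < mdim M"
    and f: "smooth_at M p f" and g: "smooth_at M p g"
  shows "chart_deriv c i (\<lambda>q. f q * g q) p = f p * chart_deriv c i g p + chart_deriv c i f p * g p"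
  using smooth_at_differentiable[OF M _ p i f, of "snd c"] smooth_at_differentiable[OF M _ p i g, of "snd c"] c
    chart_inv(1)[OF M, of "fst c" "snd c" p] p
  by (simp add: chart_deriv_def pderiv_at_def)

lemma chart_deriv_commute:
  assumes M: "manifold M" and c: "c \<in> matlas M" and p: "p \<in> fst c" and i: "i < mdim M" and k: "k < mdim M"
    and f: "smooth_at M p f"
  shows "chart_deriv c i (chart_deriv c k f) p = chart_deriv c k (chart_deriv c i f) p"
proof -
  obtain U \<phi> where c_eq: "c = (U, \<phi>)" by (cases c)
  have c': "(U, \<phi>) \<in> matlas M" and p': "p \<in> U" using c p c_eq by auto
  obtain W where W: "p \<in> W" "W \<subseteq> U" "openin (mtop M) W" "smooth_on M W f"
    using smooth_at_chart[OF M c' p' f] .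
  let ?F = "f \<circ> inv_into U \<phi>"
  have F: "smooth_coord (mdim M) (\<phi> ` W) ?F"
    using smooth_on_chart_iff[OF M c' W(3,2)] W(4) by simp
  note o = chart_copen[OF M c' W(3,2)]
  have x: "\<phi> p \<in> \<phi> ` W" using W(1) by simp
  have "chart_deriv c i (chart_deriv c k f) p = pderiv_at i (pderiv_at k ?F) (\<phi> p)"
    if "i < mdim M" for i k
    unfolding c_eq chart_deriv_def[of _ i] fst_conv snd_conv
    by (rule pderiv_at_cong[OF o x that], rule chart_deriv_coords[OF M c'])
       (use W(2) in auto)
  then show ?thesis
    using pderiv_at_commute[OF o _ x i k, of ?F] F i k by (simp add: smooth_coord_def)
qed

text \<open>A tangent vector, as a functional on functions that are smooth near the point.\<close>

definition derivation_at :: "('a, 'k::real_normed_field) mfd \<Rightarrow> 'a \<Rightarrow> (('a \<Rightarrow> 'k) \<Rightarrow> 'k) \<Rightarrow> bool" where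
  "derivation_at M p D \<longleftrightarrow> (\<exists>c\<in>matlas M. p \<in> fst c \<and>
     (\<exists>a. \<forall>f. smooth_at M p f \<longrightarrow> D f = (\<Sum>i<mdim M. a i * chart_deriv c i f p)))"

lemma derivation_at_local:
  assumes M: "manifold M" and D: "derivation_at M p D" and f: "smooth_at M p f"
    and eq: "eq_near M p f g"
  shows "D f = D g"
proof -
  obtain c a where c: "c \<in> matlas M" "p \<in> fst c"
    and a: "\<And>f. smooth_at M p f \<Longrightarrow> D f = (\<Sum>i<mdim M. a i * chart_deriv c i f p)"
    using D by (auto simp: derivation_at_def)
  show ?thesis using a[OF f] a[OF smooth_at_cong[OF M f eq]] chart_deriv_local[OF M c _ eq] by simp
qed

lemma derivation_at_add:
  assumes M: "manifold M" and D: "derivation_at M p D" and f: "smooth_at M p f" and g: "smooth_at M p g"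
  shows "D (\<lambda>q. f q + g q) = D f + D g"
proof -
  obtain c a where c: "c \<in> matlas M" "p \<in> fst c"
    and a: "\<And>f. smooth_at M p f \<Longrightarrow> D f = (\<Sum>i<mdim M. a i * chart_deriv c i f p)"
    using D by (auto simp: derivation_at_def)
  show ?thesis using a[OF f] a[OF g] a[OF smooth_at_add[OF M f g]] chart_deriv_add[OF M c _ f g]
    by (simp add: ring_distribs sum.distrib)
qed

lemma derivation_at_mult:
  assumes M: "manifold M" and D: "derivation_at M p D" and f: "smooth_at M p f" and g: "smooth_at M p g"
  shows "D (\<lambda>q. f q * g q) = f p * D g + D f * g p"
proof -
  obtain c a where c: "c \<in> matlas M" "p \<in> fst c"
    and a: "\<And>f. smooth_at M p f \<Longrightarrow> D f = (\<Sum>i<mdim M. a i * chart_deriv c i f p)"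
    using D by (auto simp: derivation_at_def)
  show ?thesis using a[OF f] a[OF g] a[OF smooth_at_mult[OF M f g]] chart_deriv_mult[OF M c _ f g]
    by (simp add: ring_distribs sum.distrib sum_distrib_left sum_distrib_right mult_ac)
qed

lemma derivation_at_const:
  assumes M: "manifold M" and D: "derivation_at M p D"
  shows "D (\<lambda>q. b) = 0"
proof -
  obtain c a where c: "c \<in> matlas M" "p \<in> fst c"
    and a: "\<And>f. smooth_at M p f \<Longrightarrow> D f = (\<Sum>i<mdim M. a i * chart_deriv c i f p)"
    using D by (auto simp: derivation_at_def)
  have "p \<in> topspace (mtop M)" using manifold_cover[OF M] c by blast
  from a[OF smooth_at_const[OF M this]] show ?thesis by (simp add: chart_deriv_const)
qed

lemma derivation_at_topspace: "manifold M \<Longrightarrow> derivation_at M p D \<Longrightarrow> p \<in> topspace (mtop M)"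
  using manifold_cover by (fastforce simp: derivation_at_def)

lemma derivation_at_scale:
  assumes M: "manifold M" and D: "derivation_at M p D" and f: "smooth_at M p f"
  shows "D (\<lambda>q. b * f q) = b * D f"
  using derivation_at_mult[OF M D smooth_at_const[OF M] f, of b] derivation_at_const[OF M D]
    smooth_at_topspace[OF f] by simp

lemma derivation_at_sum:
  assumes M: "manifold M" and D: "derivation_at M p D" and f: "\<And>s. s \<in> S \<Longrightarrow> smooth_at M p (f s)"
  shows "D (\<lambda>q. \<Sum>s\<in>S. f s q) = (\<Sum>s\<in>S. D (f s))"
  using f
proof (induction S rule: infinite_finite_induct)
  case (insert s S)
  have "smooth_at M p (\<lambda>q. \<Sum>s\<in>S. f s q)"
    using insert.prems by (intro smooth_at_sum[OF M derivation_at_topspace[OF M D]]) auto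
  then show ?case using derivation_at_add[OF M D, of "f s" "\<lambda>q. \<Sum>s\<in>S. f s q"] insert by simp
qed (simp_all add: derivation_at_const[OF M D])

lemma vector_field_chart:
  assumes "vector_field M X" "(U, \<phi>) \<in> matlas M"
  obtains a where "\<forall>i<mdim M. smooth_on M U (a i)"
    "\<And>p f. p \<in> U \<Longrightarrow> smooth_at M p f \<Longrightarrow> X p f = (\<Sum>i<mdim M. a i p * chart_deriv (U, \<phi>) i f p)"
proof -
  from assms(1) have "\<forall>c\<in>matlas M. \<exists>a. (\<forall>i<mdim M. smooth_on M (fst c) (a i)) \<and>
        (\<forall>p\<in>fst c. \<forall>f. smooth_at M p f \<longrightarrow>
           X p f = (\<Sum>i<mdim M. a i p * chart_deriv c i f p))"
    unfolding vector_field_def by (elim conjE)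
  from bspec[OF this assms(2)] show ?thesis using that unfolding fst_conv by (elim exE conjE) blast
qed

lemma bivector_field_chart:
  assumes "bivector_field M P" "(U, \<phi>) \<in> matlas M"
  obtains a where "\<forall>i<mdim M. \<forall>k<mdim M. smooth_on M U (a i k)"
    "\<And>p f g. p \<in> U \<Longrightarrow> smooth_at M p f \<Longrightarrow> smooth_at M p g \<Longrightarrow> P p f g =
       (\<Sum>i<mdim M. \<Sum>k<mdim M. a i k p * chart_deriv (U, \<phi>) i f p * chart_deriv (U, \<phi>) k g p)"
proof -
  from assms(1) have "\<forall>c\<in>matlas M. \<exists>a. (\<forall>i<mdim M. \<forall>k<mdim M. smooth_on M (fst c) (a i k)) \<and>
        (\<forall>p\<in>fst c. \<forall>f g. smooth_at M p f \<and> smooth_at M p g \<longrightarrow>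
           P p f g = (\<Sum>i<mdim M. \<Sum>k<mdim M. a i k p * chart_deriv c i f p * chart_deriv c k g p))"
    unfolding bivector_field_def by (elim conjE)
  from bspec[OF this assms(2)] show ?thesis using that unfolding fst_conv by (elim exE conjE) blast
qed

lemma vector_field_derivation:
  assumes "manifold M" "vector_field M X" "p \<in> topspace (mtop M)"
  shows "derivation_at M p (X p)"
proof -
  obtain U \<phi> where c: "(U, \<phi>) \<in> matlas M" "p \<in> U" using chart_at[OF assms(1,3)] .
  obtain a where "\<forall>i<mdim M. smooth_on M U (a i)" and "\<And>p f. p \<in> U \<Longrightarrow> smooth_at M p f \<Longrightarrow>
      X p f = (\<Sum>i<mdim M. a i p * chart_deriv (U, \<phi>) i f p)"
    by (rule vector_field_chart[OF assms(2) c(1)], rule that)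
  then show ?thesis using c unfolding derivation_at_def by (intro bexI[OF _ c(1)]) auto
qed

text \<open>The Hamiltonian vector of \<open>f\<close> at a point.\<close>

lemma bivector_field_derivation:
  assumes "manifold M" "bivector_field M P" "smooth_at M p f"
  shows "derivation_at M p (P p f)"
proof -
  obtain U \<phi> where c: "(U, \<phi>) \<in> matlas M" "p \<in> U"
    using chart_at[OF assms(1) smooth_at_topspace[OF assms(3)]] .
  obtain a where "\<forall>i<mdim M. \<forall>k<mdim M. smooth_on M U (a i k)" and a: "\<And>p f g. p \<in> U \<Longrightarrow> smooth_at M p f \<Longrightarrow> smooth_at M p g \<Longrightarrow>
      P p f g = (\<Sum>i<mdim M. \<Sum>k<mdim M. a i k p * chart_deriv (U, \<phi>) i f p * chart_deriv (U, \<phi>) k g p)"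
    by (rule bivector_field_chart[OF assms(2) c(1)], rule that)
  have "P p f g = (\<Sum>k<mdim M. (\<Sum>i<mdim M. a i k p * chart_deriv (U, \<phi>) i f p) * chart_deriv (U, \<phi>) k g p)"
    if "smooth_at M p g" for g
    unfolding a[OF c(2) assms(3) that] by (subst sum.swap) (simp add: sum_distrib_right)
  then show ?thesis unfolding derivation_at_def
    by (intro bexI[OF _ c(1)]) (use c in \<open>auto intro!: exI[of _ "\<lambda>k. \<Sum>i<mdim M. a i k p * chart_deriv (U, \<phi>) i f p"]\<close>)
qed

lemma bivector_field_skew: "bivector_field M P \<Longrightarrow> P p f g = - P p g f"
  unfolding bivector_field_def by blast

lemma vector_field_smooth:
  assumes M: "manifold M" and X: "vector_field M X" and f: "smooth_at M p f"
  shows "smooth_at M p (\<lambda>q. X q f)"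
proof -
  obtain U \<phi> where c: "(U, \<phi>) \<in> matlas M" "p \<in> U"
    using chart_at[OF M smooth_at_topspace[OF f]] .
  obtain a where a: "\<forall>i<mdim M. smooth_on M U (a i)"
    "\<And>p f. p \<in> U \<Longrightarrow> smooth_at M p f \<Longrightarrow> X p f = (\<Sum>i<mdim M. a i p * chart_deriv (U, \<phi>) i f p)"
    by (rule vector_field_chart[OF X c(1)], rule that)
  obtain W where W: "p \<in> W" "W \<subseteq> U" "openin (mtop M) W" "smooth_on M W f"
    using smooth_at_chart[OF M c f] .
  have "smooth_on M W (\<lambda>q. \<Sum>i<mdim M. a i q * chart_deriv (U, \<phi>) i f q)"
  proof (intro smooth_on_sum[OF M W(3)] smooth_on_mult[OF M])
    fix i assume "i \<in> {..<mdim M}"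
    then have i: "i < mdim M" by simp
    show "smooth_on M W (a i)" using a(1) i smooth_on_subset[OF M _ W(3,2)] by blast
    show "smooth_on M W (chart_deriv (U, \<phi>) i f)"
      using chart_deriv_smooth_on[OF M c(1) _ i W(4)] W(2) by simp
  qed
  then have "smooth_on M W (\<lambda>q. X q f)"
    by (rule smooth_on_cong[OF M]) (use a(2) W(2) smooth_on_at[OF W(4)] in \<open>auto simp: subset_iff\<close>)
  then show ?thesis using W(1) by (auto simp: smooth_at_def)
qed

lemma bivector_field_smooth:
  assumes M: "manifold M" and P: "bivector_field M P" and f: "smooth_at M p f" and g: "smooth_at M p g"
  shows "smooth_at M p (\<lambda>q. P q f g)"
proof -
  obtain U \<phi> where c: "(U, \<phi>) \<in> matlas M" "p \<in> U"
    using chart_at[OF M smooth_at_topspace[OF f]] .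
  obtain a where a: "\<forall>i<mdim M. \<forall>k<mdim M. smooth_on M U (a i k)"
    "\<And>p f g. p \<in> U \<Longrightarrow> smooth_at M p f \<Longrightarrow> smooth_at M p g \<Longrightarrow>
      P p f g = (\<Sum>i<mdim M. \<Sum>k<mdim M. a i k p * chart_deriv (U, \<phi>) i f p * chart_deriv (U, \<phi>) k g p)"
    by (rule bivector_field_chart[OF P c(1)], rule that)
  obtain W1 where W1: "p \<in> W1" "W1 \<subseteq> U" "openin (mtop M) W1" "smooth_on M W1 f"
    using smooth_at_chart[OF M c f] .
  obtain W2 where W2: "p \<in> W2" "W2 \<subseteq> U" "openin (mtop M) W2" "smooth_on M W2 g"
    using smooth_at_chart[OF M c g] .
  define W where "W = W1 \<inter> W2"
  have W: "p \<in> W" "W \<subseteq> U" "openin (mtop M) W"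
    using W1 W2 by (auto simp: W_def)
  have fg: "smooth_on M W f" "smooth_on M W g"
    using smooth_on_subset[OF M W1(4) W(3)] smooth_on_subset[OF M W2(4) W(3)] by (auto simp: W_def)
  have "smooth_on M W (\<lambda>q. \<Sum>i<mdim M. \<Sum>k<mdim M. a i k q * chart_deriv (U, \<phi>) i f q * chart_deriv (U, \<phi>) k g q)"
  proof (intro smooth_on_sum[OF M W(3)] smooth_on_mult[OF M])
    fix i k assume "i \<in> {..<mdim M}" "k \<in> {..<mdim M}"
    then have i: "i < mdim M" "k < mdim M" by auto
    show "smooth_on M W (a i k)" using a(1) i smooth_on_subset[OF M _ W(3,2)] by blast
    show "smooth_on M W (chart_deriv (U, \<phi>) i f)" "smooth_on M W (chart_deriv (U, \<phi>) k g)"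
      using chart_deriv_smooth_on[OF M c(1) _ i(1) fg(1)] chart_deriv_smooth_on[OF M c(1) _ i(2) fg(2)] W(2) by auto
  qed
  then have "smooth_on M W (\<lambda>q. P q f g)"
    by (rule smooth_on_cong[OF M]) (use a(2) W(2) smooth_on_at[OF fg(1)] smooth_on_at[OF fg(2)] in \<open>auto simp: subset_iff\<close>)
  then show ?thesis using W(1) by (auto simp: smooth_at_def)
qed

section \<open>Coordinate blocks\<close>

definition block_start :: "(nat \<Rightarrow> nat) \<Rightarrow> nat \<Rightarrow> nat" where
  "block_start d j = sum d {1..<j}"

definition block_set :: "(nat \<Rightarrow> nat) \<Rightarrow> nat \<Rightarrow> nat set" where
  "block_set d j = {block_start d j..<block_start d j + d j}"

text \<open>Reads the coordinates of the \<open>j\<close>-th factor off concatenated coordinates.\<close>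

definition block :: "(nat \<Rightarrow> nat) \<Rightarrow> nat \<Rightarrow> (nat \<Rightarrow> 'k::zero) \<Rightarrow> nat \<Rightarrow> 'k" where
  "block d j z = (\<lambda>i. if i < d j then z (block_start d j + i) else 0)"

lemma block_start_Suc: "1 \<le> j \<Longrightarrow> block_start d (Suc j) = block_start d j + d j"
  by (simp add: block_start_def)

lemma block_start_less:
  assumes "1 \<le> j" "j < k" shows "block_start d j + d j \<le> block_start d k"
proof -
  have "block_start d (Suc j) \<le> block_start d k"
    unfolding block_start_def using assms by (intro sum_mono2) auto
  then show ?thesis using block_start_Suc[OF assms(1)] by simp
qed

lemma sum_blocks_eq: "sum d {1..n} = block_start d (Suc n)"
  by (simp add: block_start_def atLeastLessThanSuc_atLeastAtMost)

lemma block_end_le: "j \<in> {1..n} \<Longrightarrow> block_start d j + d j \<le> sum d {1..n}"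
  unfolding sum_blocks_eq by (rule block_start_less) auto

lemma block_index_less: "j \<in> {1..n} \<Longrightarrow> i < d j \<Longrightarrow> block_start d j + i < sum d {1..n}"
  using block_end_le[of j n d] by simp

lemma block_set_subset: "j \<in> {1..n} \<Longrightarrow> block_set d j \<subseteq> {..<sum d {1..n}}"
  using block_end_le[of j n d] by (auto simp: block_set_def)

lemma block_set_disjoint:
  assumes "j \<in> {1..n}" "k \<in> {1..n}" "j \<noteq> k" shows "block_set d j \<inter> block_set d k = {}"
proof -
  have "block_start d j + d j \<le> block_start d k \<or> block_start d k + d k \<le> block_start d j"
    using assms block_start_less[of j k d] block_start_less[of k j d] by (cases j k rule: linorder_cases) auto
  then show ?thesis by (auto simp: block_set_def)
qed

lemma block_ex:
  assumes "i < sum d {1..n}"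
  obtains j i' where "j \<in> {1..n}" "i' < d j" "i = block_start d j + i'"
proof -
  have "\<exists>j\<in>{1..n}. i \<in> block_set d j"
    using assms
  proof (induction n)
    case (Suc n)
    show ?case
    proof (cases "i < sum d {1..n}")
      case True
      with Suc.IH show ?thesis by fastforce
    next
      case False
      then have "i \<in> block_set d (Suc n)" using Suc.prems by (simp add: block_set_def sum_blocks_eq[symmetric])
      then show ?thesis by fastforce
    qed
  qed simp
  then obtain j where j: "j \<in> {1..n}" "i \<in> block_set d j" by blast
  show ?thesis by (rule that[of j "i - block_start d j"]) (use j in \<open>auto simp: block_set_def\<close>)
qed

lemma sum_block_set: "(\<Sum>i\<in>block_set d j. g i) = (\<Sum>i<d j. g (block_start d j + i))"
  by (rule sum.reindex_bij_witness[of _ "\<lambda>i. block_start d j + i" "\<lambda>i. i - block_start d j"])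
     (auto simp: block_set_def)

lemma concat_coords_at:
  assumes j: "j \<in> {1..n}" and i: "i < d j"
  shows "concat_coords n d \<phi> p (block_start d j + i) = \<phi> j (p j) i"
proof -
  have eq: "(if sum d {1..<k} \<le> block_start d j + i \<and> block_start d j + i < sum d {1..<k} + d k
         then \<phi> k (p k) (block_start d j + i - sum d {1..<k}) else 0) =
        (if k = j then \<phi> j (p j) i else 0)" if k: "k \<in> {1..n}" for k
  proof (cases "k = j")
    case False
    have "block_start d j + i \<in> block_set d j" using i by (simp add: block_set_def)
    then have "block_start d j + i \<notin> block_set d k"
      using block_set_disjoint[OF j k] False by blast
    then show ?thesis using False by (auto simp: block_set_def block_start_def)
  qed (use i in \<open>simp add: block_start_def\<close>)
  have "concat_coords n d \<phi> p (block_start d j + i) = (\<Sum>k\<in>{1..n}. if k = j then \<phi> j (p j) i else 0)"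
    unfolding concat_coords_def by (rule sum.cong[OF refl eq])
  then show ?thesis using j by simp
qed

lemma concat_coords_coord_space: "concat_coords n d \<phi> p \<in> coord_space (sum d {1..n})"
  unfolding coord_space_def concat_coords_def
proof (intro CollectI allI impI sum.neutral ballI)
  fix i k assume "sum d {1..n} \<le> i" "k \<in> {1..n}"
  then have "\<not> i < sum d {1..<k} + d k" using block_end_le[of k n d] by (simp add: block_start_def)
  then show "(if sum d {1..<k} \<le> i \<and> i < sum d {1..<k} + d k
         then \<phi> k (p k) (i - sum d {1..<k}) else 0) = 0" by simp
qed

lemma block_coord_space: "block d j z \<in> coord_space (d j)"
  by (simp add: block_def coord_space_def)

lemma block_concat:
  "j \<in> {1..n} \<Longrightarrow> \<phi> j (p j) \<in> coord_space (d j) \<Longrightarrow> block d j (concat_coords n d \<phi> p) = \<phi> j (p j)"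
  by (auto simp: block_def concat_coords_at coord_space_def fun_eq_iff)

lemma coord_space_block_ext:
  assumes "z \<in> coord_space (sum d {1..n})" "z' \<in> coord_space (sum d {1..n})"
    and "\<And>j. j \<in> {1..n} \<Longrightarrow> block d j z = block d j z'"
  shows "z = z'"
proof
  fix i show "z i = z' i"
  proof (cases "i < sum d {1..n}")
    case True
    then obtain j i' where j: "j \<in> {1..n}" "i' < d j" "i = block_start d j + i'" by (rule block_ex)
    from fun_cong[OF assms(3)[OF j(1)], of i'] j show ?thesis by (simp add: block_def)
  qed (use assms(1,2) in \<open>auto simp: coord_space_def\<close>)
qed

lemma concat_block:
  assumes "z \<in> coord_space (sum d {1..n})" "\<And>j. j \<in> {1..n} \<Longrightarrow> \<phi> j (p j) = block d j z"
  shows "concat_coords n d \<phi> p = z"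
  by (rule coord_space_block_ext[OF concat_coords_coord_space assms(1)])
     (simp add: block_concat assms(2) block_coord_space)

lemma continuous_on_block: "continuous_on S (block d j :: (nat \<Rightarrow> 'k::real_normed_field) \<Rightarrow> _)"
proof (rule continuous_on_coordinatewise_then_product)
  fix i show "continuous_on S (\<lambda>z::nat \<Rightarrow> 'k. block d j z i)"
    by (cases "i < d j")
       (simp_all add: block_def continuous_on_subset[OF continuous_on_product_coordinates])
qed

section \<open>The product manifold\<close>

text \<open>Boxes of members of countable bases form a countable base, the index set being finite.\<close>

lemma second_countable_top_product:
  assumes "finite I" "\<And>j. j \<in> I \<Longrightarrow> second_countable_top (T j)"
  shows "second_countable_top (product_topology T I)"
proof -
  have "\<forall>j\<in>I. \<exists>B. countable B \<and> (\<forall>V\<in>B. openin (T j) V) \<and>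
          (\<forall>U p. openin (T j) U \<and> p \<in> U \<longrightarrow> (\<exists>V\<in>B. p \<in> V \<and> V \<subseteq> U))"
    using assms(2) by (simp add: second_countable_top_def)
  then obtain B where B: "\<And>j. j \<in> I \<Longrightarrow> countable (B j)" "\<And>j V. j \<in> I \<Longrightarrow> V \<in> B j \<Longrightarrow> openin (T j) V"
    "\<And>j U p. j \<in> I \<Longrightarrow> openin (T j) U \<Longrightarrow> p \<in> U \<Longrightarrow> \<exists>V\<in>B j. p \<in> V \<and> V \<subseteq> U"
    by metis
  define C where "C = PiE I ` PiE I B"
  have "countable C" unfolding C_def using countable_PiE[OF assms(1) B(1)] by auto
  moreover have "openin (product_topology T I) V" if "V \<in> C" for V
    using that B(2) assms(1) unfolding C_def by (auto simp: openin_PiE PiE_iff)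
  moreover have "\<exists>V\<in>C. p \<in> V \<and> V \<subseteq> U" if U: "openin (product_topology T I) U" "p \<in> U" for U p
  proof -
    obtain X where X: "p \<in> PiE I X" "\<And>i. openin (T i) (X i)" "PiE I X \<subseteq> U"
      using product_topology_open_contains_basis[OF U] by blast
    have "\<exists>V. V \<in> B j \<and> p j \<in> V \<and> V \<subseteq> X j" if "j \<in> I" for j
      using B(3)[OF that X(2)[of j], of "p j"] X(1) that by (auto simp: PiE_iff)
    then obtain b where b: "\<And>j. j \<in> I \<Longrightarrow> b j \<in> B j \<and> p j \<in> b j \<and> b j \<subseteq> X j" by metis
    have "PiE I (restrict b I) \<in> C" unfolding C_def using b by (intro imageI) auto
    moreover have "PiE I (restrict b I) = PiE I b" by (rule PiE_cong) simp
    moreover have "p \<in> PiE I b" using b X(1) by (auto simp: PiE_iff)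
    moreover have "PiE I b \<subseteq> U" using b X(3) PiE_mono[of I b X] by blast
    ultimately show ?thesis by metis
  qed
  ultimately show ?thesis unfolding second_countable_top_def by (intro exI[of _ C]) blast
qed

lemma chart_continuous_inv:
  assumes N: "manifold N" and c: "(U, \<phi>) \<in> matlas N"
  shows "continuous_map (top_of_set (\<phi> ` U)) (subtopology (mtop N) U) (inv_into U \<phi>)"
proof -
  have h: "homeomorphic_map (subtopology (mtop N) U) (top_of_set (\<phi> ` U)) \<phi>"
    using assms by (auto simp: manifold_def is_chart_def)
  then obtain g where g: "homeomorphic_maps (subtopology (mtop N) U) (top_of_set (\<phi> ` U)) \<phi> g"
    using homeomorphic_map_maps by blast
  have "U \<subseteq> topspace (mtop N)" using chart_openin[OF N c] openin_subset by blast
  then have "g (\<phi> p) = p" if "p \<in> U" for p using g that by (auto simp: homeomorphic_maps_def)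
  then have "g x = inv_into U \<phi> x" if "x \<in> \<phi> ` U" for x
    using that chart_inv(1)[OF N c] by auto
  then have eq: "g x = inv_into U \<phi> x" if "x \<in> topspace (top_of_set (\<phi> ` U))" for x using that by simp
  have "continuous_map (top_of_set (\<phi> ` U)) (subtopology (mtop N) U) g"
    using g unfolding homeomorphic_maps_def by (elim conjE)
  then show ?thesis by (rule continuous_map_eq) (rule eq)
qed

lemma chart_continuous:
  assumes N: "manifold N" and c: "(U, \<phi>) \<in> matlas N"
  shows "continuous_map (subtopology (mtop N) U) euclidean (\<lambda>p. \<phi> p i)"
proof -
  have h: "homeomorphic_map (subtopology (mtop N) U) (top_of_set (\<phi> ` U)) \<phi>"
    using assms by (auto simp: manifold_def is_chart_def)
  then have "continuous_map (subtopology (mtop N) U) euclidean \<phi>"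
    using homeomorphic_imp_continuous_map[OF h] by (simp add: continuous_map_in_subtopology)
  then show ?thesis
    unfolding euclidean_product_topology[symmetric] continuous_map_componentwise_UNIV by blast
qed

locale mfd_product =
  fixes n :: nat and Y :: "nat \<Rightarrow> ('a, 'k::real_normed_field) mfd"
  assumes mfd: "\<And>j. j \<in> {1..n} \<Longrightarrow> manifold (Y j)"
begin

abbreviation "M \<equiv> prod_mfd n Y"
abbreviation "d \<equiv> \<lambda>j. mdim (Y j)"

text \<open>A chart of the product is given by a choice of one chart in each factor; \<open>pdom\<close> and \<open>pmap\<close> are
  its domain and its coordinate map, and \<open>pinv\<close> is an explicit inverse of \<open>pmap\<close>, computed block by block.\<close>

definition charts :: "(nat \<Rightarrow> ('a, 'k) chart) \<Rightarrow> bool" where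
  "charts c \<longleftrightarrow> (\<forall>j\<in>{1..n}. c j \<in> matlas (Y j))"

definition pdom :: "(nat \<Rightarrow> ('a, 'k) chart) \<Rightarrow> (nat \<Rightarrow> 'a) set" where
  "pdom c = (\<Pi>\<^sub>E j\<in>{1..n}. fst (c j))"

definition pmap :: "(nat \<Rightarrow> ('a, 'k) chart) \<Rightarrow> (nat \<Rightarrow> 'a) \<Rightarrow> nat \<Rightarrow> 'k" where
  "pmap c = concat_coords n d (\<lambda>j. snd (c j))"

lemma mtop_M: "mtop M = product_topology (\<lambda>j. mtop (Y j)) {1..n}"
  and mdim_M: "mdim M = sum d {1..n}"
  by (simp_all add: prod_mfd_def)

lemma matlas_M: "matlas M = {(pdom c, pmap c) | c. charts c}"
  by (simp add: prod_mfd_def pdom_def pmap_def charts_def)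

lemma chart_in_M: "charts c \<Longrightarrow> (pdom c, pmap c) \<in> matlas M"
  unfolding matlas_M by blast

lemma matlas_M_E:
  assumes "C \<in> matlas M" obtains c where "charts c" "C = (pdom c, pmap c)"
  using assms unfolding matlas_M by blast

lemma chartD: "charts c \<Longrightarrow> j \<in> {1..n} \<Longrightarrow> (fst (c j), snd (c j)) \<in> matlas (Y j)"
  by (simp add: charts_def)

lemma topspace_M: "topspace (mtop M) = (\<Pi>\<^sub>E j\<in>{1..n}. topspace (mtop (Y j)))"
  by (simp add: mtop_M)

lemma pdomD: "q \<in> pdom c \<Longrightarrow> j \<in> {1..n} \<Longrightarrow> q j \<in> fst (c j)"
  by (auto simp: pdom_def PiE_iff)

lemma pdom_upd: "q \<in> pdom c \<Longrightarrow> j \<in> {1..n} \<Longrightarrow> t \<in> fst (c j) \<Longrightarrow> q(j := t) \<in> pdom c"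
  by (auto simp: pdom_def PiE_iff extensional_def)

lemma pmap_at: "j \<in> {1..n} \<Longrightarrow> i < d j \<Longrightarrow> pmap c q (block_start d j + i) = snd (c j) (q j) i"
  unfolding pmap_def by (rule concat_coords_at)

lemma pmap_coord_space: "pmap c q \<in> coord_space (sum d {1..n})"
  unfolding pmap_def by (rule concat_coords_coord_space)

lemma block_pmap:
  assumes "charts c" "q \<in> pdom c" "j \<in> {1..n}"
  shows "block d j (pmap c q) = snd (c j) (q j)"
  unfolding pmap_def
  by (rule block_concat[OF assms(3)])
     (rule chart_coord[OF mfd[OF assms(3)] chartD[OF assms(1,3)] pdomD[OF assms(2,3)]])

definition pinv :: "(nat \<Rightarrow> ('a, 'k) chart) \<Rightarrow> (nat \<Rightarrow> 'k) \<Rightarrow> nat \<Rightarrow> 'a" where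
  "pinv c z = (\<lambda>j\<in>{1..n}. inv_into (fst (c j)) (snd (c j)) (block d j z))"

lemma pinv_pmap: 
  assumes "charts c" "q \<in> pdom c" shows "pinv c (pmap c q) = q"
proof
  fix j show "pinv c (pmap c q) j = q j"
  proof (cases "j \<in> {1..n}")
    case True
    then show ?thesis using chart_inv(1)[OF mfd[OF True] chartD[OF assms(1) True] pdomD[OF assms(2) True]]
      by (simp add: pinv_def block_pmap[OF assms True])
  next
    case False
    then show ?thesis using assms(2) by (auto simp: pinv_def pdom_def PiE_def extensional_def)
  qed
qed

lemma inj_pmap: "charts c \<Longrightarrow> inj_on (pmap c) (pdom c)"
  by (rule inj_on_inverseI[of _ "pinv c"]) (rule pinv_pmap)

lemma inv_pmap:
  assumes c: "charts c" and z: "z \<in> pmap c ` pdom c"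
  shows "inv_into (pdom c) (pmap c) z = pinv c z"
  using z inj_pmap[OF c] pinv_pmap[OF c] by auto

text \<open>The image of a box under a product chart is cut out by conditions on the blocks, which
  makes it open.\<close>

lemma pmap_box:
  assumes c: "charts c" and W: "\<And>j. j \<in> {1..n} \<Longrightarrow> W j \<subseteq> fst (c j)"
  shows "pmap c ` PiE {1..n} W =
    {z \<in> coord_space (sum d {1..n}). \<forall>j\<in>{1..n}. block d j z \<in> snd (c j) ` W j}" (is "?L = ?R")
proof
  have sub: "PiE {1..n} W \<subseteq> pdom c" unfolding pdom_def by (rule PiE_mono) (rule W)
  show "?L \<subseteq> ?R"
  proof
    fix z assume "z \<in> ?L"
    then obtain q where q: "q \<in> PiE {1..n} W" "z = pmap c q" by blast
    then have qd: "q \<in> pdom c" using sub by blast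
    have "block d j z \<in> snd (c j) ` W j" if "j \<in> {1..n}" for j
      using block_pmap[OF c qd that] q that by (auto simp: PiE_iff)
    then show "z \<in> ?R" using q(2) pmap_coord_space by blast
  qed
  show "?R \<subseteq> ?L"
  proof
    fix z assume z: "z \<in> ?R"
    have inv: "inv_into (fst (c j)) (snd (c j)) (block d j z) \<in> W j"
      "snd (c j) (inv_into (fst (c j)) (snd (c j)) (block d j z)) = block d j z"
      if "j \<in> {1..n}" for j
    proof -
      have b: "block d j z \<in> snd (c j) ` W j" using z that by blast
      show "inv_into (fst (c j)) (snd (c j)) (block d j z) \<in> W j"
        by (rule chart_inv(2)[OF mfd[OF that] chartD[OF c that] b W[OF that]])
      show "snd (c j) (inv_into (fst (c j)) (snd (c j)) (block d j z)) = block d j z"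
        using b W[OF that] by (intro f_inv_into_f) blast
    qed
    have "pinv c z \<in> PiE {1..n} W" unfolding pinv_def using inv(1) by simp
    moreover have "pmap c (pinv c z) = z" unfolding pmap_def
      by (rule concat_block) (use z inv(2) in \<open>auto simp: pinv_def\<close>)
    ultimately show "z \<in> ?L" by (metis imageI)
  qed
qed

lemma block_image:
  "charts c \<Longrightarrow> z \<in> pmap c ` pdom c \<Longrightarrow> j \<in> {1..n} \<Longrightarrow> block d j z \<in> snd (c j) ` fst (c j)"
  using pmap_box[of c "\<lambda>j. fst (c j)"] unfolding pdom_def by blast

lemma pmap_box_copen:
  assumes c: "charts c" and W: "\<And>j. j \<in> {1..n} \<Longrightarrow> W j \<subseteq> fst (c j)"
    and oW: "\<And>j. j \<in> {1..n} \<Longrightarrow> openin (mtop (Y j)) (W j)"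
  shows "copen (sum d {1..n}) (pmap c ` PiE {1..n} W)"
proof -
  let ?S = "coord_space (sum d {1..n}) :: (nat \<Rightarrow> 'k) set"
  have *: "openin (top_of_set ?S) (?S \<inter> block d j -` (snd (c j) ` W j))" if j: "j \<in> {1..n}" for j
    by (rule continuous_openin_preimage[OF continuous_on_block _
          chart_copen[OF mfd[OF j] chartD[OF c j] oW[OF j] W[OF j]]])
       (rule Pi_I, rule block_coord_space)
  have "openin (top_of_set ?S) (?S \<inter> (\<Inter>j\<in>{1..n}. ?S \<inter> block d j -` (snd (c j) ` W j)))"
    using * by (intro openin_Int_Inter) auto
  also have "?S \<inter> (\<Inter>j\<in>{1..n}. ?S \<inter> block d j -` (snd (c j) ` W j)) = pmap c ` PiE {1..n} W"
  proof -
    have "pmap c ` PiE {1..n} W = {z \<in> ?S. \<forall>j\<in>{1..n}. block d j z \<in> snd (c j) ` W j}"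
      using c W by (rule pmap_box)
    then show ?thesis by blast
  qed
  finally show ?thesis .
qed

lemma pdom_open: "charts c \<Longrightarrow> openin (mtop M) (pdom c)"
  unfolding mtop_M pdom_def using chart_openin[OF mfd chartD] by (auto simp: openin_PiE)

lemma is_chart_M:
  assumes c: "charts c" shows "is_chart M (pdom c, pmap c)"
proof -
  let ?X = "subtopology (mtop M) (pdom c)" and ?V = "pmap c ` pdom c"
  have X: "?X = product_topology (\<lambda>j. subtopology (mtop (Y j)) (fst (c j))) {1..n}"
    unfolding mtop_M pdom_def by (rule subtopology_product_topology)
  have sub: "pdom c \<subseteq> topspace (mtop M)" using pdom_open[OF c] openin_subset by blast
  have tX: "topspace ?X = pdom c" using sub by auto
  have cV: "copen (mdim M) ?V"
    using pmap_box_copen[OF c, of "\<lambda>j. fst (c j)"] chart_openin[OF mfd chartD[OF c]]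
    unfolding mdim_M pdom_def by simp
  have "continuous_map ?X euclidean (\<lambda>q. pmap c q i)" for i
    unfolding pmap_def concat_coords_def
  proof (rule continuous_map_sum)
    fix j assume j: "j \<in> {1..n}"
    have "continuous_map ?X (subtopology (mtop (Y j)) (fst (c j))) (\<lambda>q. q j)"
      unfolding X by (rule continuous_map_product_projection[OF j])
    from continuous_map_compose[OF this chart_continuous[OF mfd[OF j] chartD[OF c j]]]
    show "continuous_map ?X euclidean
        (\<lambda>q. if sum d {1..<j} \<le> i \<and> i < sum d {1..<j} + d j then snd (c j) (q j) (i - sum d {1..<j}) else 0)"
      by (simp add: o_def)
  qed simp
  then have "continuous_map ?X euclidean (pmap c)"
    unfolding euclidean_product_topology[symmetric] continuous_map_componentwise_UNIV by blast
  then have 1: "continuous_map ?X (top_of_set ?V) (pmap c)"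
    using tX by (simp add: continuous_map_in_subtopology)
  have "continuous_map (top_of_set ?V) ?X (pinv c)"
    unfolding X continuous_map_componentwise
  proof (intro conjI ballI)
    show "pinv c ` topspace (top_of_set ?V) \<subseteq> extensional {1..n}" by (auto simp: pinv_def)
    fix j assume j: "j \<in> {1..n}"
    have "continuous_map (top_of_set ?V) (top_of_set (snd (c j) ` fst (c j))) (block d j)"
      using block_image[OF c _ j] continuous_on_block by (simp add: continuous_map_in_subtopology)
    from continuous_map_compose[OF this chart_continuous_inv[OF mfd[OF j] chartD[OF c j]]]
    show "continuous_map (top_of_set ?V) (subtopology (mtop (Y j)) (fst (c j))) (\<lambda>z. pinv c z j)"
      using j by (simp add: o_def pinv_def)
  qed
  then have "homeomorphic_maps ?X (top_of_set ?V) (pmap c) (pinv c)"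
    unfolding homeomorphic_maps_def using 1 tX pinv_pmap[OF c] by simp
  then have "homeomorphic_map ?X (top_of_set ?V) (pmap c)"
    unfolding homeomorphic_maps_map by (elim conjE)
  then show ?thesis unfolding is_chart_def prod.case using pdom_open[OF c] cV by (intro conjI)
qed

text \<open>Every coordinate of the transition map between two product charts is a coordinate of the
  transition map in one factor, composed with the linear map that selects a block.\<close>

lemma transition_M:
  assumes c: "charts c" and c': "charts c'" and i: "i < mdim M"
  shows "smooth_coord (mdim M) (pmap c ` (pdom c \<inter> pdom c'))
           (\<lambda>x. pmap c' (inv_into (pdom c) (pmap c) x) i)"
proof -
  obtain j i' where j: "j \<in> {1..n}" "i' < d j" "i = block_start d j + i'"
    using i unfolding mdim_M by (rule block_ex)
  let ?W = "\<lambda>j. fst (c j) \<inter> fst (c' j)"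
  have dom: "pdom c \<inter> pdom c' = PiE {1..n} ?W" unfolding pdom_def by (rule PiE_Int)
  have oW: "openin (mtop (Y j)) (?W j)" if "j \<in> {1..n}" for j
    using chart_openin[OF mfd[OF that] chartD[OF c that]] chart_openin[OF mfd[OF that] chartD[OF c' that]]
    by (rule openin_Int)
  have V: "copen (mdim M) (pmap c ` (pdom c \<inter> pdom c'))"
    unfolding dom mdim_M by (rule pmap_box_copen[OF c _ oW]) auto
  have Vj: "copen (d j) (snd (c j) ` ?W j)"
    by (rule chart_copen[OF mfd[OF j(1)] chartD[OF c j(1)] oW[OF j(1)]]) auto
  have sm: "smooth_coord (d j) (snd (c j) ` ?W j) (\<lambda>x. snd (c' j) (inv_into (fst (c j)) (snd (c j)) x) i')"
    by (rule manifold_transition[OF mfd[OF j(1)] chartD[OF c j(1)] chartD[OF c' j(1)] j(2)])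
  have "smooth_coord (mdim M) (pmap c ` (pdom c \<inter> pdom c'))
      (\<lambda>z. snd (c' j) (inv_into (fst (c j)) (snd (c j)) (block d j z)) i')"
  proof (rule smooth_coord_compose[OF V Vj _ _ sm])
    show "smooth_coord (mdim M) (pmap c ` (pdom c \<inter> pdom c')) (\<lambda>z. block d j z k)" if "k < d j" for k
      using that by (simp add: block_def smooth_coord_coord)
    show "block d j ` pmap c ` (pdom c \<inter> pdom c') \<subseteq> snd (c j) ` ?W j"
      unfolding dom using pmap_box[OF c, of ?W] j(1) by auto
  qed
  then show ?thesis
  proof (rule smooth_coord_cong[OF V])
    fix z assume "z \<in> pmap c ` (pdom c \<inter> pdom c')"
    then have "z \<in> pmap c ` pdom c" by blast
    then show "snd (c' j) (inv_into (fst (c j)) (snd (c j)) (block d j z)) i' =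
        pmap c' (inv_into (pdom c) (pmap c) z) i"
      using j by (simp add: inv_pmap[OF c] pmap_at pinv_def)
  qed
qed

lemma charts_at:
  assumes "p \<in> topspace (mtop M)"
  obtains c where "charts c" "p \<in> pdom c"
proof -
  have "\<exists>c. c \<in> matlas (Y j) \<and> p j \<in> fst c" if j: "j \<in> {1..n}" for j
  proof -
    have "p j \<in> topspace (mtop (Y j))" using assms j unfolding topspace_M by (auto simp: PiE_iff)
    then show ?thesis using manifold_cover[OF mfd[OF j]] by blast
  qed
  then obtain c where c: "\<And>j. j \<in> {1..n} \<Longrightarrow> c j \<in> matlas (Y j) \<and> p j \<in> fst (c j)" by metis
  show ?thesis
  proof (rule that[of c])
    show "charts c" using c by (simp add: charts_def)
    show "p \<in> pdom c" using c assms unfolding topspace_M pdom_def by (auto simp: PiE_iff)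
  qed
qed

lemma manifold_M: "manifold M"
  unfolding manifold_def
proof (intro conjI)
  have *: "Hausdorff_space (mtop (Y j)) \<and> second_countable_top (mtop (Y j))" if "j \<in> {1..n}" for j
    using mfd[OF that] unfolding manifold_def by (elim conjE) (intro conjI)
  show "Hausdorff_space (mtop M)" unfolding mtop_M Hausdorff_space_product_topology using * by blast
  show "second_countable_top (mtop M)" unfolding mtop_M
    by (rule second_countable_top_product) (use * in auto)
  show "\<forall>c\<in>matlas M. is_chart M c" using is_chart_M unfolding matlas_M by blast
  show "\<Union> (fst ` matlas M) = topspace (mtop M)"
  proof
    show "\<Union> (fst ` matlas M) \<subseteq> topspace (mtop M)"
    proof
      fix p assume "p \<in> \<Union> (fst ` matlas M)"
      then obtain c where "charts c" "p \<in> pdom c" unfolding matlas_M by auto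
      then show "p \<in> topspace (mtop M)" using openin_subset[OF pdom_open] by blast
    qed
    show "topspace (mtop M) \<subseteq> \<Union> (fst ` matlas M)"
    proof
      fix p assume "p \<in> topspace (mtop M)"
      then obtain c where "charts c" "p \<in> pdom c" by (rule charts_at)
      then show "p \<in> \<Union> (fst ` matlas M)" using chart_in_M by (metis UN_I fst_conv)
    qed
  qed
  show "\<forall>(U, \<phi>)\<in>matlas M. \<forall>(V, \<psi>)\<in>matlas M. \<forall>i<mdim M.
      smooth_coord (mdim M) (\<phi> ` (U \<inter> V)) (\<lambda>x. \<psi> (inv_into U \<phi> x) i)"
    unfolding matlas_M using transition_M by auto
qed

section \<open>Slices of functions on the product\<close>

lemma slice_continuous:
  assumes p: "p \<in> topspace (mtop M)" and j: "j \<in> {1..n}"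
  shows "continuous_map (mtop (Y j)) (mtop M) (\<lambda>t. p(j := t))"
  unfolding mtop_M continuous_map_componentwise
proof (intro conjI ballI)
  show "(\<lambda>t. p(j := t)) ` topspace (mtop (Y j)) \<subseteq> extensional {1..n}"
    using p j unfolding topspace_M by (auto simp: PiE_iff extensional_def)
  fix k assume k: "k \<in> {1..n}"
  show "continuous_map (mtop (Y j)) (mtop (Y k)) (\<lambda>t. (p(j := t)) k)"
    using p k unfolding topspace_M by (cases "k = j") (auto simp: PiE_iff)
qed

lemma slice_open:
  assumes p: "p \<in> topspace (mtop M)" and j: "j \<in> {1..n}" and W: "openin (mtop M) W"
  shows "openin (mtop (Y j)) {t \<in> topspace (mtop (Y j)). p(j := t) \<in> W}"
  by (rule openin_continuous_map_preimage[OF slice_continuous[OF p j] W])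

lemma topspace_comp: "p \<in> topspace (mtop M) \<Longrightarrow> j \<in> {1..n} \<Longrightarrow> p j \<in> topspace (mtop (Y j))"
  unfolding topspace_M by (auto simp: PiE_iff)

text \<open>In coordinates, passing to a slice is composition with a map whose components are constants and
  coordinate functions.\<close>

lemma smooth_at_slice:
  assumes f: "smooth_at M p f" and j: "j \<in> {1..n}"
  shows "smooth_at (Y j) (p j) (\<lambda>t. f (p(j := t)))"
proof -
  have p: "p \<in> topspace (mtop M)" using f by (rule smooth_at_topspace)
  obtain c where c: "charts c" and pc: "p \<in> pdom c" using p by (rule charts_at)
  obtain W where W: "p \<in> W" "W \<subseteq> pdom c" "openin (mtop M) W" "smooth_on M W f"
    using smooth_at_chart[OF manifold_M chart_in_M[OF c] pc f] .
  note cj = chartD[OF c j] and Nj = mfd[OF j]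
  let ?U = "fst (c j)" and ?\<phi> = "snd (c j)"
  let ?W = "{t \<in> topspace (mtop (Y j)). p(j := t) \<in> W}"
  have oW: "openin (mtop (Y j)) ?W" by (rule slice_open[OF p j W(3)])
  have WU: "?W \<subseteq> ?U"
  proof
    fix t assume "t \<in> ?W"
    then have "p(j := t) \<in> pdom c" using W(2) by blast
    from pdomD[OF this j] show "t \<in> ?U" by simp
  qed
  have F: "smooth_coord (mdim M) (pmap c ` W) (f \<circ> inv_into (pdom c) (pmap c))"
    using smooth_on_chart_iff[OF manifold_M chart_in_M[OF c] W(3,2)] W(4) by simp
  let ?G = "\<lambda>x. pmap c (p(j := inv_into ?U ?\<phi> x))"
  have V: "copen (d j) (?\<phi> ` ?W)" by (rule chart_copen[OF Nj cj oW WU])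
  have inv: "inv_into ?U ?\<phi> x \<in> ?W" if "x \<in> ?\<phi> ` ?W" for x
    by (rule chart_inv(2)[OF Nj cj that WU])
  have "smooth_coord (d j) (?\<phi> ` ?W) (\<lambda>x. (f \<circ> inv_into (pdom c) (pmap c)) (?G x))"
  proof (rule smooth_coord_compose[OF V chart_copen[OF manifold_M chart_in_M[OF c] W(3,2)] _ _ F])
    fix i assume "i < mdim M"
    then obtain k i' where k: "k \<in> {1..n}" "i' < d k" "i = block_start d k + i'"
      unfolding mdim_M by (rule block_ex)
    have G: "?G x i = snd (c k) ((p(j := inv_into ?U ?\<phi> x)) k) i'" for x
      unfolding k(3) by (rule pmap_at[OF k(1,2)])
    show "smooth_coord (d j) (?\<phi> ` ?W) (\<lambda>x. ?G x i)"
    proof (cases "k = j")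
      case True
      have "x i' = ?G x i" if "x \<in> ?\<phi> ` ?W" for x
      proof -
        have "x \<in> ?\<phi> ` ?U" using that WU by blast
        from chart_inv(3)[OF Nj cj this] show ?thesis unfolding G using True by simp
      qed
      then show ?thesis by (rule smooth_coord_cong[OF V smooth_coord_coord])
    next
      case False
      then show ?thesis unfolding G by (simp add: smooth_coord_const)
    qed
  next
    show "?G ` ?\<phi> ` ?W \<subseteq> pmap c ` W" using inv by blast
  qed
  then have "smooth_coord (d j) (?\<phi> ` ?W) ((\<lambda>t. f (p(j := t))) \<circ> inv_into ?U ?\<phi>)"
  proof (rule smooth_coord_cong[OF V])
    fix x assume "x \<in> ?\<phi> ` ?W"
    then have "p(j := inv_into ?U ?\<phi> x) \<in> pdom c" using inv W(2) by blast
    then show "(f \<circ> inv_into (pdom c) (pmap c)) (?G x) = ((\<lambda>t. f (p(j := t))) \<circ> inv_into ?U ?\<phi>) x"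
      using inj_pmap[OF c] by simp
  qed
  then have "smooth_on (Y j) ?W (\<lambda>t. f (p(j := t)))"
    using smooth_on_chart_iff[OF Nj cj oW WU] by simp
  then show ?thesis by (rule smooth_on_at) (use W(1) topspace_comp[OF p j] in auto)
qed

text \<open>In coordinates, pulling back along a projection is composition with the selection of a block.\<close>

lemma smooth_on_pullback:
  assumes c: "charts c" and j: "j \<in> {1..n}" and a: "smooth_on (Y j) (fst (c j)) a"
  shows "smooth_on M (pdom c) (\<lambda>q. a (q j))"
proof -
  note cj = chartD[OF c j] and Nj = mfd[OF j]
  let ?U = "fst (c j)" and ?\<phi> = "snd (c j)"
  note oU = chart_openin[OF Nj cj]
  have A: "smooth_coord (d j) (?\<phi> ` ?U) (a \<circ> inv_into ?U ?\<phi>)"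
    using smooth_on_chart_iff[OF Nj cj oU] a by simp
  note V = chart_copen[OF manifold_M chart_in_M[OF c] pdom_open[OF c] order_refl]
  have "smooth_coord (mdim M) (pmap c ` pdom c) (\<lambda>z. (a \<circ> inv_into ?U ?\<phi>) (block d j z))"
  proof (rule smooth_coord_compose[OF V chart_copen[OF Nj cj oU order_refl] _ _ A])
    show "smooth_coord (mdim M) (pmap c ` pdom c) (\<lambda>z. block d j z k)" if "k < d j" for k
      using that by (simp add: block_def smooth_coord_coord)
    show "block d j ` pmap c ` pdom c \<subseteq> ?\<phi> ` ?U" using block_image[OF c _ j] by blast
  qed
  then have "smooth_coord (mdim M) (pmap c ` pdom c) ((\<lambda>q. a (q j)) \<circ> inv_into (pdom c) (pmap c))"
    by (rule smooth_coord_cong[OF V]) (use j in \<open>simp add: inv_pmap[OF c] pinv_def\<close>)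
  then show ?thesis using smooth_on_chart_iff[OF manifold_M chart_in_M[OF c] pdom_open[OF c] order_refl] by simp
qed

text \<open>Near the point, both sides differentiate \<open>f\<close> along the same curve.\<close>

lemma chart_deriv_slice:
  assumes c: "charts c" and q: "q \<in> pdom c" and j: "j \<in> {1..n}" and i: "i < d j"
  shows "chart_deriv (pdom c, pmap c) (block_start d j + i) f q = chart_deriv (c j) i (\<lambda>t. f (q(j := t))) (q j)"
proof -
  note cj = chartD[OF c j] and Nj = mfd[OF j]
  let ?U = "fst (c j)" and ?\<phi> = "snd (c j)"
  have V: "copen (d j) (?\<phi> ` ?U)" by (rule chart_copen[OF Nj cj chart_openin[OF Nj cj] order_refl])
  have x: "?\<phi> (q j) \<in> ?\<phi> ` ?U" using pdomD[OF q j] by blast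
  have eq: "f (inv_into (pdom c) (pmap c) ((pmap c q)(block_start d j + i := t))) =
      f (q(j := inv_into ?U ?\<phi> ((?\<phi> (q j))(i := t))))" if t: "(?\<phi> (q j))(i := t) \<in> ?\<phi> ` ?U" for t
  proof -
    let ?u = "inv_into ?U ?\<phi> ((?\<phi> (q j))(i := t))"
    have u: "?u \<in> ?U" "?\<phi> ?u = (?\<phi> (q j))(i := t)"
      using chart_inv(2)[OF Nj cj t order_refl] chart_inv(3)[OF Nj cj t] by auto
    have qu: "q(j := ?u) \<in> pdom c" by (rule pdom_upd[OF q j u(1)])
    have "pmap c (q(j := ?u)) = (pmap c q)(block_start d j + i := t)"
    proof (rule coord_space_block_ext[OF pmap_coord_space coord_space_upd[OF pmap_coord_space block_index_less[where d = d, OF j i]]])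
      fix k assume k: "k \<in> {1..n}"
      show "block d k (pmap c (q(j := ?u))) = block d k ((pmap c q)(block_start d j + i := t))"
      proof (cases "k = j")
        case True
        have "block d j ((pmap c q)(block_start d j + i := t)) = (block d j (pmap c q))(i := t)"
          using i by (auto simp: block_def)
        then show ?thesis using True block_pmap[OF c qu j] block_pmap[OF c q j] u(2) by simp
      next
        case False
        have "block_start d j + i \<in> block_set d j" using i by (simp add: block_set_def)
        then have "block_start d j + i \<notin> block_set d k"
          using block_set_disjoint[OF j k] False by blast
        then have "block d k ((pmap c q)(block_start d j + i := t)) = block d k (pmap c q)"
          by (auto simp: block_def block_set_def fun_eq_iff)
        then show ?thesis using False block_pmap[OF c qu k] block_pmap[OF c q k] by simp
      qed
    qed
    then show ?thesis using inv_into_f_f[OF inj_pmap[OF c] qu] by simp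
  qed
  have pt: "pmap c q (block_start d j + i) = ?\<phi> (q j) i" by (rule pmap_at[OF j i])
  have "\<forall>\<^sub>F t in nhds (?\<phi> (q j) i).
     f (inv_into (pdom c) (pmap c) ((pmap c q)(block_start d j + i := t))) =
      f (q(j := inv_into ?U ?\<phi> ((?\<phi> (q j))(i := t))))"
    using copen_line[OF V x i] by eventually_elim (rule eq)
  then show ?thesis
    unfolding chart_deriv_def pderiv_at_def fst_conv snd_conv o_def pt
    by (rule deriv_cong_ev) simp
qed

end

section \<open>Fields along a block of coordinates\<close>

text \<open>What a field that comes from one factor of a product looks like in a product chart, \<open>S\<close> being the
  coordinates of that factor: it differentiates along \<open>S\<close> only, and its coefficients are annihilated by
  the derivatives outside \<open>S\<close>.  The arguments about fields on different factors need no more than this.\<close>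

definition vf_along :: "('a, 'k::real_normed_field) mfd \<Rightarrow> ('a, 'k) chart \<Rightarrow> nat set \<Rightarrow> ('a, 'k) tfield1 \<Rightarrow> bool" where
  "vf_along M C S X \<longleftrightarrow> (\<exists>a. (\<forall>i\<in>S. smooth_on M (fst C) (a i)) \<and>
     (\<forall>i\<in>S. \<forall>k<mdim M. k \<notin> S \<longrightarrow> (\<forall>q\<in>fst C. chart_deriv C k (a i) q = 0)) \<and>
     (\<forall>q\<in>fst C. \<forall>f. smooth_at M q f \<longrightarrow> X q f = (\<Sum>i\<in>S. a i q * chart_deriv C i f q)))"

definition bv_along :: "('a, 'k::real_normed_field) mfd \<Rightarrow> ('a, 'k) chart \<Rightarrow> nat set \<Rightarrow> ('a, 'k) tfield2 \<Rightarrow> bool" where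
  "bv_along M C S P \<longleftrightarrow> (\<exists>A. (\<forall>i\<in>S. \<forall>j\<in>S. smooth_on M (fst C) (A i j)) \<and>
     (\<forall>i\<in>S. \<forall>j\<in>S. \<forall>q\<in>fst C. A i j q = - A j i q) \<and>
     (\<forall>i\<in>S. \<forall>j\<in>S. \<forall>k<mdim M. k \<notin> S \<longrightarrow> (\<forall>q\<in>fst C. chart_deriv C k (A i j) q = 0)) \<and>
     (\<forall>q\<in>fst C. \<forall>f g. smooth_at M q f \<longrightarrow> smooth_at M q g \<longrightarrow>
        P q f g = (\<Sum>i\<in>S. \<Sum>j\<in>S. A i j q * chart_deriv C i f q * chart_deriv C j g q)))"

lemma vf_alongE:
  assumes "vf_along M C S X"
  obtains a where "\<And>i. i \<in> S \<Longrightarrow> smooth_on M (fst C) (a i)"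
    "\<And>i k q. i \<in> S \<Longrightarrow> k < mdim M \<Longrightarrow> k \<notin> S \<Longrightarrow> q \<in> fst C \<Longrightarrow> chart_deriv C k (a i) q = 0"
    "\<And>q f. q \<in> fst C \<Longrightarrow> smooth_at M q f \<Longrightarrow> X q f = (\<Sum>i\<in>S. a i q * chart_deriv C i f q)"
proof -
  obtain a where a: "\<forall>i\<in>S. smooth_on M (fst C) (a i)"
    "\<forall>i\<in>S. \<forall>k<mdim M. k \<notin> S \<longrightarrow> (\<forall>q\<in>fst C. chart_deriv C k (a i) q = 0)"
    "\<forall>q\<in>fst C. \<forall>f. smooth_at M q f \<longrightarrow> X q f = (\<Sum>i\<in>S. a i q * chart_deriv C i f q)"
    using assms unfolding vf_along_def by (elim exE conjE) (rule that)
  show ?thesis by (rule that[of a]) (fact a[rule_format])+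
qed

lemma bv_alongE:
  assumes "bv_along M C S P"
  obtains A where "\<And>i j. i \<in> S \<Longrightarrow> j \<in> S \<Longrightarrow> smooth_on M (fst C) (A i j)"
    "\<And>i j q. i \<in> S \<Longrightarrow> j \<in> S \<Longrightarrow> q \<in> fst C \<Longrightarrow> A i j q = - A j i q"
    "\<And>i j k q. i \<in> S \<Longrightarrow> j \<in> S \<Longrightarrow> k < mdim M \<Longrightarrow> k \<notin> S \<Longrightarrow> q \<in> fst C \<Longrightarrow> chart_deriv C k (A i j) q = 0"
    "\<And>q f g. q \<in> fst C \<Longrightarrow> smooth_at M q f \<Longrightarrow> smooth_at M q g \<Longrightarrow>
        P q f g = (\<Sum>i\<in>S. \<Sum>j\<in>S. A i j q * chart_deriv C i f q * chart_deriv C j g q)"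
proof -
  obtain A where a: "\<forall>i\<in>S. \<forall>j\<in>S. smooth_on M (fst C) (A i j)"
    "\<forall>i\<in>S. \<forall>j\<in>S. \<forall>q\<in>fst C. A i j q = - A j i q"
    "\<forall>i\<in>S. \<forall>j\<in>S. \<forall>k<mdim M. k \<notin> S \<longrightarrow> (\<forall>q\<in>fst C. chart_deriv C k (A i j) q = 0)"
    "\<forall>q\<in>fst C. \<forall>f g. smooth_at M q f \<longrightarrow> smooth_at M q g \<longrightarrow>
        P q f g = (\<Sum>i\<in>S. \<Sum>j\<in>S. A i j q * chart_deriv C i f q * chart_deriv C j g q)"
    using assms unfolding bv_along_def by (elim exE conjE) (rule that)
  show ?thesis by (rule that[of A]) (fact a[rule_format])+
qed

lemma chart_in_topspace: "manifold M \<Longrightarrow> C \<in> matlas M \<Longrightarrow> p \<in> fst C \<Longrightarrow> p \<in> topspace (mtop M)"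
  using manifold_cover by blast

lemma chart_deriv_derivation:
  assumes "C \<in> matlas M" "p \<in> fst C" "k < mdim M"
  shows "derivation_at M p (\<lambda>f. chart_deriv C k f p)"
  unfolding derivation_at_def
proof (intro bexI[OF _ assms(1)] conjI assms(2) exI allI impI)
  fix f
  show "chart_deriv C k f p = (\<Sum>i<mdim M. (if i = k then 1 else 0) * chart_deriv C i f p)"
    using assms(3) by (simp add: if_distrib[of "\<lambda>x. x * _"] cong: if_cong)
qed

lemma smooth_at_open2:
  assumes "smooth_at M p f" "smooth_at M p g"
  obtains W where "openin (mtop M) W" "p \<in> W" "\<And>q. q \<in> W \<Longrightarrow> smooth_at M q f" "\<And>q. q \<in> W \<Longrightarrow> smooth_at M q g"
proof -
  obtain W where W: "openin (mtop M) W" "p \<in> W" "\<And>q. q \<in> W \<Longrightarrow> smooth_at M q f"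
    by (rule smooth_at_open[OF assms(1)], rule that)
  obtain W' where W': "openin (mtop M) W'" "p \<in> W'" "\<And>q. q \<in> W' \<Longrightarrow> smooth_at M q g"
    by (rule smooth_at_open[OF assms(2)], rule that)
  show ?thesis
    by (rule that[OF openin_Int[OF W(1) W'(1)]]) (use W(2) W'(2) in \<open>auto intro: W(3) W'(3)\<close>)
qed

lemma eq_near_chart:
  assumes M: "manifold M" and C: "C \<in> matlas M" and p: "p \<in> fst C" and f: "smooth_at M p f" and g: "smooth_at M p g"
    and eq: "\<And>q. q \<in> fst C \<Longrightarrow> smooth_at M q f \<Longrightarrow> smooth_at M q g \<Longrightarrow> F q = G q"
  shows "eq_near M p F G"
proof -
  have C': "(fst C, snd C) \<in> matlas M" using C by simp
  obtain W where W: "openin (mtop M) W" "p \<in> W" "\<And>q. q \<in> W \<Longrightarrow> smooth_at M q f" "\<And>q. q \<in> W \<Longrightarrow> smooth_at M q g"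
    by (rule smooth_at_open2[OF f g], rule that)
  show ?thesis
    by (rule eq_nearI[OF openin_Int[OF chart_openin[OF M C'] W(1)]]) (use p W eq in auto)
qed

text \<open>A derivation that annihilates the coefficients passes to the derivatives of the argument.\<close>

lemma derivation_of_vf_along:
  assumes M: "manifold M" and C: "C \<in> matlas M" and p: "p \<in> fst C" and S: "S \<subseteq> {..<mdim M}"
    and a: "\<And>i. i \<in> S \<Longrightarrow> smooth_on M (fst C) (a i)"
    and X: "\<And>q f. q \<in> fst C \<Longrightarrow> smooth_at M q f \<Longrightarrow> X q f = (\<Sum>i\<in>S. a i q * chart_deriv C i f q)"
    and D: "derivation_at M p D" and D0: "\<And>i. i \<in> S \<Longrightarrow> D (a i) = 0" and f: "smooth_at M p f"
  shows "D (\<lambda>q. X q f) = (\<Sum>i\<in>S. a i p * D (chart_deriv C i f))"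
proof -
  have sm: "smooth_at M p (a i)" "smooth_at M p (chart_deriv C i f)" if "i \<in> S" for i
    using smooth_on_at[OF a[OF that] p] chart_deriv_smooth_at[OF M C p _ f, of i] S that by auto
  have ssum: "smooth_at M p (\<lambda>q. \<Sum>i\<in>S. a i q * chart_deriv C i f q)"
    using sm by (intro smooth_at_sum[OF M chart_in_topspace[OF M C p]] smooth_at_mult[OF M])
  have "eq_near M p (\<lambda>q. \<Sum>i\<in>S. a i q * chart_deriv C i f q) (\<lambda>q. X q f)"
    by (rule eq_near_chart[OF M C p f f]) (simp add: X)
  then have "D (\<lambda>q. X q f) = D (\<lambda>q. \<Sum>i\<in>S. a i q * chart_deriv C i f q)"
    by (rule derivation_at_local[OF M D ssum, symmetric])
  also have "\<dots> = (\<Sum>i\<in>S. D (\<lambda>q. a i q * chart_deriv C i f q))"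
    by (rule derivation_at_sum[OF M D]) (rule smooth_at_mult[OF M sm])
  also have "\<dots> = (\<Sum>i\<in>S. a i p * D (chart_deriv C i f))"
    by (rule sum.cong[OF refl]) (simp add: derivation_at_mult[OF M D sm] D0)
  finally show ?thesis .
qed

lemma derivation_of_bv_along:
  assumes M: "manifold M" and C: "C \<in> matlas M" and p: "p \<in> fst C" and S: "S \<subseteq> {..<mdim M}"
    and A: "\<And>i j. i \<in> S \<Longrightarrow> j \<in> S \<Longrightarrow> smooth_on M (fst C) (A i j)"
    and P: "\<And>q f g. q \<in> fst C \<Longrightarrow> smooth_at M q f \<Longrightarrow> smooth_at M q g \<Longrightarrow>
        P q f g = (\<Sum>i\<in>S. \<Sum>j\<in>S. A i j q * chart_deriv C i f q * chart_deriv C j g q)"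
    and D: "derivation_at M p D" and D0: "\<And>i j. i \<in> S \<Longrightarrow> j \<in> S \<Longrightarrow> D (A i j) = 0"
    and f: "smooth_at M p f" and g: "smooth_at M p g"
  shows "D (\<lambda>q. P q f g) = (\<Sum>i\<in>S. \<Sum>j\<in>S. A i j p * D (chart_deriv C i f) * chart_deriv C j g p
      + A i j p * chart_deriv C i f p * D (chart_deriv C j g))"
proof -
  let ?t = "\<lambda>i j q. A i j q * chart_deriv C i f q * chart_deriv C j g q"
  have smA: "smooth_at M p (A i j)" if "i \<in> S" "j \<in> S" for i j
    using smooth_on_at[OF A[OF that] p] .
  have sm: "smooth_at M p (chart_deriv C i f)" "smooth_at M p (chart_deriv C i g)" if "i \<in> S" for i
    using chart_deriv_smooth_at[OF M C p _ f, of i] chart_deriv_smooth_at[OF M C p _ g, of i] S that by auto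
  have smt: "smooth_at M p (?t i j)" if "i \<in> S" "j \<in> S" for i j
    by (intro smooth_at_mult[OF M] smA sm that)
  note top = chart_in_topspace[OF M C p]
  have ssum': "smooth_at M p (\<lambda>q. \<Sum>j\<in>S. ?t i j q)" if "i \<in> S" for i
    using smt that by (intro smooth_at_sum[OF M top])
  then have ssum: "smooth_at M p (\<lambda>q. \<Sum>i\<in>S. \<Sum>j\<in>S. ?t i j q)"
    by (rule smooth_at_sum[OF M top])
  have "eq_near M p (\<lambda>q. \<Sum>i\<in>S. \<Sum>j\<in>S. ?t i j q) (\<lambda>q. P q f g)"
    by (rule eq_near_chart[OF M C p f g]) (simp add: P)
  then have "D (\<lambda>q. P q f g) = D (\<lambda>q. \<Sum>i\<in>S. \<Sum>j\<in>S. ?t i j q)"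
    by (rule derivation_at_local[OF M D ssum, symmetric])
  also have "\<dots> = (\<Sum>i\<in>S. D (\<lambda>q. \<Sum>j\<in>S. ?t i j q))"
    by (rule derivation_at_sum[OF M D ssum'])
  also have "\<dots> = (\<Sum>i\<in>S. \<Sum>j\<in>S. D (?t i j))"
    by (rule sum.cong[OF refl]) (rule derivation_at_sum[OF M D smt])
  also have "\<dots> = (\<Sum>i\<in>S. \<Sum>j\<in>S. A i j p * D (chart_deriv C i f) * chart_deriv C j g p
      + A i j p * chart_deriv C i f p * D (chart_deriv C j g))"
  proof (intro sum.cong[OF refl])
    fix i j assume ij: "i \<in> S" "j \<in> S"
    show "D (?t i j) = A i j p * D (chart_deriv C i f) * chart_deriv C j g p
      + A i j p * chart_deriv C i f p * D (chart_deriv C j g)"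
      using derivation_at_mult[OF M D smooth_at_mult[OF M smA[OF ij] sm(1)[OF ij(1)]] sm(2)[OF ij(2)]]
        derivation_at_mult[OF M D smA[OF ij] sm(1)[OF ij(1)]] D0[OF ij]
      by (simp add: algebra_simps)
  qed
  finally show ?thesis .
qed

text \<open>The derivatives outside the block annihilate the coefficients, and mixed partial derivatives are
  symmetric.\<close>

lemma vf_along_chart_deriv:
  assumes M: "manifold M" and C: "C \<in> matlas M" and p: "p \<in> fst C" and S: "S \<subseteq> {..<mdim M}"
    and X: "vf_along M C S X" and k: "k < mdim M" "k \<notin> S" and f: "smooth_at M p f"
  shows "chart_deriv C k (\<lambda>q. X q f) p = X p (chart_deriv C k f)"
proof -
  obtain a where a: "\<And>i. i \<in> S \<Longrightarrow> smooth_on M (fst C) (a i)"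
    "\<And>i k q. i \<in> S \<Longrightarrow> k < mdim M \<Longrightarrow> k \<notin> S \<Longrightarrow> q \<in> fst C \<Longrightarrow> chart_deriv C k (a i) q = 0"
    "\<And>q f. q \<in> fst C \<Longrightarrow> smooth_at M q f \<Longrightarrow> X q f = (\<Sum>i\<in>S. a i q * chart_deriv C i f q)"
    by (rule vf_alongE[OF X], rule that)
  have "chart_deriv C k (\<lambda>q. X q f) p = (\<Sum>i\<in>S. a i p * chart_deriv C k (chart_deriv C i f) p)"
    by (rule derivation_of_vf_along[OF M C p S _ _ chart_deriv_derivation[OF C p k(1)] _ f],
        erule a(1), erule (1) a(3), erule a(2)[OF _ k p])
  also have "\<dots> = (\<Sum>i\<in>S. a i p * chart_deriv C i (chart_deriv C k f) p)"
  proof (rule sum.cong[OF refl])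
    fix i assume "i \<in> S"
    then have "i < mdim M" using S by auto
    from chart_deriv_commute[OF M C p k(1) this f]
    show "a i p * chart_deriv C k (chart_deriv C i f) p = a i p * chart_deriv C i (chart_deriv C k f) p" by simp
  qed
  also have "\<dots> = X p (chart_deriv C k f)"
    by (rule a(3)[OF p chart_deriv_smooth_at[OF M C p k(1) f], symmetric])
  finally show ?thesis .
qed

lemma bv_along_chart_deriv:
  assumes M: "manifold M" and C: "C \<in> matlas M" and p: "p \<in> fst C" and S: "S \<subseteq> {..<mdim M}"
    and P: "bv_along M C S P" and k: "k < mdim M" "k \<notin> S" and f: "smooth_at M p f" and g: "smooth_at M p g"
  shows "chart_deriv C k (\<lambda>q. P q f g) p = P p (chart_deriv C k f) g + P p f (chart_deriv C k g)"
proof -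
  obtain A where A: "\<And>i j. i \<in> S \<Longrightarrow> j \<in> S \<Longrightarrow> smooth_on M (fst C) (A i j)"
    "\<And>i j q. i \<in> S \<Longrightarrow> j \<in> S \<Longrightarrow> q \<in> fst C \<Longrightarrow> A i j q = - A j i q"
    "\<And>i j k q. i \<in> S \<Longrightarrow> j \<in> S \<Longrightarrow> k < mdim M \<Longrightarrow> k \<notin> S \<Longrightarrow> q \<in> fst C \<Longrightarrow> chart_deriv C k (A i j) q = 0"
    "\<And>q f g. q \<in> fst C \<Longrightarrow> smooth_at M q f \<Longrightarrow> smooth_at M q g \<Longrightarrow>
        P q f g = (\<Sum>i\<in>S. \<Sum>j\<in>S. A i j q * chart_deriv C i f q * chart_deriv C j g q)"
    by (rule bv_alongE[OF P], rule that)
  have comm: "chart_deriv C k (chart_deriv C i u) p = chart_deriv C i (chart_deriv C k u) p"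
    if "i \<in> S" "smooth_at M p u" for i u
    using chart_deriv_commute[OF M C p k(1) _ that(2)] S that(1) by auto
  have "chart_deriv C k (\<lambda>q. P q f g) p = (\<Sum>i\<in>S. \<Sum>j\<in>S.
      A i j p * chart_deriv C k (chart_deriv C i f) p * chart_deriv C j g p
      + A i j p * chart_deriv C i f p * chart_deriv C k (chart_deriv C j g) p)"
    by (rule derivation_of_bv_along[OF M C p S _ _ chart_deriv_derivation[OF C p k(1)] _ f g],
        erule (1) A(1), erule (2) A(4), erule (1) A(3)[OF _ _ k p])
  also have "\<dots> = (\<Sum>i\<in>S. \<Sum>j\<in>S. A i j p * chart_deriv C i (chart_deriv C k f) p * chart_deriv C j g p
      + A i j p * chart_deriv C i f p * chart_deriv C j (chart_deriv C k g) p)"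
    by (intro sum.cong[OF refl]) (simp only: comm f g)
  also have "\<dots> = P p (chart_deriv C k f) g + P p f (chart_deriv C k g)"
    unfolding A(4)[OF p chart_deriv_smooth_at[OF M C p k(1) f] g] A(4)[OF p f chart_deriv_smooth_at[OF M C p k(1) g]]
    by (simp only: sum.distrib)
  finally show ?thesis .
qed

lemma bivector_field_derivation_left:
  assumes "manifold M" "bivector_field M P" "smooth_at M p g"
  shows "derivation_at M p (\<lambda>f. P p f g)"
proof -
  obtain c a where c: "c \<in> matlas M" "p \<in> fst c"
    and a: "\<forall>f. smooth_at M p f \<longrightarrow> P p g f = (\<Sum>i<mdim M. a i * chart_deriv c i f p)"
    using bivector_field_derivation[OF assms] unfolding derivation_at_def by (elim bexE conjE exE) (rule that)
  show ?thesis unfolding derivation_at_def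
  proof (intro bexI[OF _ c(1)] conjI c(2) exI allI impI)
    fix f assume "smooth_at M p f"
    then show "P p f g = (\<Sum>i<mdim M. - a i * chart_deriv c i f p)"
      using a[rule_format, of f] bivector_field_skew[OF assms(2), of p f g] by (simp add: sum_negf)
  qed
qed

lemma vf_along_kills:
  assumes "vf_along M C S X" "p \<in> fst C" "smooth_at M p f" "\<And>k. k \<in> S \<Longrightarrow> chart_deriv C k f p = 0"
  shows "X p f = 0"
proof -
  obtain a where a: "\<And>i. i \<in> S \<Longrightarrow> smooth_on M (fst C) (a i)"
    "\<And>i k q. i \<in> S \<Longrightarrow> k < mdim M \<Longrightarrow> k \<notin> S \<Longrightarrow> q \<in> fst C \<Longrightarrow> chart_deriv C k (a i) q = 0"
    "\<And>q f. q \<in> fst C \<Longrightarrow> smooth_at M q f \<Longrightarrow> X q f = (\<Sum>i\<in>S. a i q * chart_deriv C i f q)"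
    by (rule vf_alongE[OF assms(1)], rule that)
  from a(3)[OF assms(2,3)] assms(4) show ?thesis by simp
qed

lemma bv_along_kills:
  assumes "bv_along M C S P" "p \<in> fst C" "smooth_at M p f" "smooth_at M p g" "\<And>k. k \<in> S \<Longrightarrow> chart_deriv C k f p = 0"
  shows "P p f g = 0" "P p g f = 0"
proof -
  obtain A where A: "\<And>i j. i \<in> S \<Longrightarrow> j \<in> S \<Longrightarrow> smooth_on M (fst C) (A i j)"
    "\<And>i j q. i \<in> S \<Longrightarrow> j \<in> S \<Longrightarrow> q \<in> fst C \<Longrightarrow> A i j q = - A j i q"
    "\<And>i j k q. i \<in> S \<Longrightarrow> j \<in> S \<Longrightarrow> k < mdim M \<Longrightarrow> k \<notin> S \<Longrightarrow> q \<in> fst C \<Longrightarrow> chart_deriv C k (A i j) q = 0"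
    "\<And>q f g. q \<in> fst C \<Longrightarrow> smooth_at M q f \<Longrightarrow> smooth_at M q g \<Longrightarrow>
        P q f g = (\<Sum>i\<in>S. \<Sum>j\<in>S. A i j q * chart_deriv C i f q * chart_deriv C j g q)"
    by (rule bv_alongE[OF assms(1)], rule that)
  show "P p f g = 0" "P p g f = 0"
    using A(4)[OF assms(2,3,4)] A(4)[OF assms(2,4,3)] assms(5) by simp_all
qed

text \<open>Both sides equal \<open>\<Sum>\<^sub>i a\<^sub>i \<cdot> X'(\<partial>\<^sub>i f)\<close>, where the \<open>a\<^sub>i\<close> are the coefficients of \<open>X\<close>.\<close>

lemma vf_along_commute:
  assumes M: "manifold M" and C: "C \<in> matlas M" and p: "p \<in> fst C"
    and S: "S \<subseteq> {..<mdim M}" "S' \<subseteq> {..<mdim M}" "S \<inter> S' = {}"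
    and X: "vf_along M C S X" "vector_field M X" and X': "vf_along M C S' X'" "vector_field M X'"
    and f: "smooth_at M p f"
  shows "X p (\<lambda>q. X' q f) = X' p (\<lambda>q. X q f)"
proof -
  note top = chart_in_topspace[OF M C p]
  obtain a where a: "\<And>i. i \<in> S \<Longrightarrow> smooth_on M (fst C) (a i)"
    "\<And>i k q. i \<in> S \<Longrightarrow> k < mdim M \<Longrightarrow> k \<notin> S \<Longrightarrow> q \<in> fst C \<Longrightarrow> chart_deriv C k (a i) q = 0"
    "\<And>q f. q \<in> fst C \<Longrightarrow> smooth_at M q f \<Longrightarrow> X q f = (\<Sum>i\<in>S. a i q * chart_deriv C i f q)"
    by (rule vf_alongE[OF X(1)], rule that)
  have sma: "smooth_at M p (a i)" if "i \<in> S" for i using smooth_on_at[OF a(1)[OF that] p] .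
  have a0: "chart_deriv C k (a i) p = 0" if "i \<in> S" "k \<in> S'" for i k
    using a(2)[OF that(1) _ _ p, of k] S that by auto
  have 1: "X' p (\<lambda>q. X q f) = (\<Sum>i\<in>S. a i p * X' p (chart_deriv C i f))"
    by (rule derivation_of_vf_along[OF M C p S(1) _ _ vector_field_derivation[OF M X'(2) top] _ f],
        erule a(1), erule (1) a(3), rule vf_along_kills[OF X'(1) p sma a0])
  have "X p (\<lambda>q. X' q f) = (\<Sum>i\<in>S. a i p * chart_deriv C i (\<lambda>q. X' q f) p)"
    by (rule a(3)[OF p vector_field_smooth[OF M X'(2) f]])
  also have "\<dots> = (\<Sum>i\<in>S. a i p * X' p (chart_deriv C i f))"
  proof (rule sum.cong[OF refl])
    fix i assume "i \<in> S"
    then have "i < mdim M" "i \<notin> S'" using S by auto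
    from vf_along_chart_deriv[OF M C p S(2) X'(1) this f]
    show "a i p * chart_deriv C i (\<lambda>q. X' q f) p = a i p * X' p (chart_deriv C i f)" by simp
  qed
  finally show ?thesis using 1 by simp
qed

lemma vf_bv_along_commute:
  assumes M: "manifold M" and C: "C \<in> matlas M" and p: "p \<in> fst C"
    and S: "S \<subseteq> {..<mdim M}" "S' \<subseteq> {..<mdim M}" "S \<inter> S' = {}"
    and X: "vf_along M C S X" "vector_field M X" and P: "bv_along M C S' P" "bivector_field M P"
    and f: "smooth_at M p f" and g: "smooth_at M p g"
  shows "X p (\<lambda>q. P q f g) = P p (\<lambda>q. X q f) g + P p f (\<lambda>q. X q g)"
proof -
  note top = chart_in_topspace[OF M C p]
  obtain a where a: "\<And>i. i \<in> S \<Longrightarrow> smooth_on M (fst C) (a i)"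
    "\<And>i k q. i \<in> S \<Longrightarrow> k < mdim M \<Longrightarrow> k \<notin> S \<Longrightarrow> q \<in> fst C \<Longrightarrow> chart_deriv C k (a i) q = 0"
    "\<And>q f. q \<in> fst C \<Longrightarrow> smooth_at M q f \<Longrightarrow> X q f = (\<Sum>i\<in>S. a i q * chart_deriv C i f q)"
    by (rule vf_alongE[OF X(1)], rule that)
  have sma: "smooth_at M p (a i)" if "i \<in> S" for i using smooth_on_at[OF a(1)[OF that] p] .
  have a0: "chart_deriv C k (a i) p = 0" if "i \<in> S" "k \<in> S'" for i k
    using a(2)[OF that(1) _ _ p, of k] S that by auto
  have 1: "P p (\<lambda>q. X q f) g = (\<Sum>i\<in>S. a i p * P p (chart_deriv C i f) g)"
    by (rule derivation_of_vf_along[OF M C p S(1) _ _ bivector_field_derivation_left[OF M P(2) g] _ f],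
        erule a(1), erule (1) a(3), rule bv_along_kills(1)[OF P(1) p sma g a0])
  have 2: "P p f (\<lambda>q. X q g) = (\<Sum>i\<in>S. a i p * P p f (chart_deriv C i g))"
    by (rule derivation_of_vf_along[OF M C p S(1) _ _ bivector_field_derivation[OF M P(2) f] _ g],
        erule a(1), erule (1) a(3), rule bv_along_kills(2)[OF P(1) p sma f a0])
  have "X p (\<lambda>q. P q f g) = (\<Sum>i\<in>S. a i p * chart_deriv C i (\<lambda>q. P q f g) p)"
    by (rule a(3)[OF p bivector_field_smooth[OF M P(2) f g]])
  also have "\<dots> = (\<Sum>i\<in>S. a i p * (P p (chart_deriv C i f) g + P p f (chart_deriv C i g)))"
  proof (rule sum.cong[OF refl])
    fix i assume "i \<in> S"
    then have "i < mdim M" "i \<notin> S'" using S by auto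
    from bv_along_chart_deriv[OF M C p S(2) P(1) this f g]
    show "a i p * chart_deriv C i (\<lambda>q. P q f g) p =
      a i p * (P p (chart_deriv C i f) g + P p f (chart_deriv C i g))" by simp
  qed
  finally show ?thesis unfolding 1 2 by (simp add: ring_distribs sum.distrib)
qed

text \<open>The mixed terms of the Jacobi identity of a sum of two bivector fields along disjoint
  blocks: every term is, up to sign, a value of the same expression
  \<open>\<Sum>\<^sub>i\<^sub>k A\<^sub>i\<^sub>k \<partial>\<^sub>i u \<cdot> P'(v, \<partial>\<^sub>k w)\<close> on a permutation of the three functions.\<close>

lemma bv_along_jacobi_mixed:
  assumes M: "manifold M" and C: "C \<in> matlas M" and p: "p \<in> fst C"
    and S: "S \<subseteq> {..<mdim M}" "S' \<subseteq> {..<mdim M}" "S \<inter> S' = {}"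
    and P: "bv_along M C S P" "bivector_field M P" and P': "bv_along M C S' P'" "bivector_field M P'"
    and f: "smooth_at M p f" and g: "smooth_at M p g" and h: "smooth_at M p h"
  shows "P p f (\<lambda>q. P' q g h) + P p g (\<lambda>q. P' q h f) + P p h (\<lambda>q. P' q f g) +
    (P' p f (\<lambda>q. P q g h) + P' p g (\<lambda>q. P q h f) + P' p h (\<lambda>q. P q f g)) = 0"
proof -
  note top = chart_in_topspace[OF M C p]
  obtain A where A: "\<And>i j. i \<in> S \<Longrightarrow> j \<in> S \<Longrightarrow> smooth_on M (fst C) (A i j)"
    "\<And>i j q. i \<in> S \<Longrightarrow> j \<in> S \<Longrightarrow> q \<in> fst C \<Longrightarrow> A i j q = - A j i q"
    "\<And>i j k q. i \<in> S \<Longrightarrow> j \<in> S \<Longrightarrow> k < mdim M \<Longrightarrow> k \<notin> S \<Longrightarrow> q \<in> fst C \<Longrightarrow> chart_deriv C k (A i j) q = 0"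
    "\<And>q f g. q \<in> fst C \<Longrightarrow> smooth_at M q f \<Longrightarrow> smooth_at M q g \<Longrightarrow>
        P q f g = (\<Sum>i\<in>S. \<Sum>j\<in>S. A i j q * chart_deriv C i f q * chart_deriv C j g q)"
    by (rule bv_alongE[OF P(1)], rule that)
  define N where "N f g h = (\<Sum>i\<in>S. \<Sum>j\<in>S. A i j p * chart_deriv C i f p * P' p g (chart_deriv C j h))" for f g h
  have smA: "smooth_at M p (A i j)" if "i \<in> S" "j \<in> S" for i j
    using smooth_on_at[OF A(1)[OF that] p] .
  have A0: "chart_deriv C k (A i j) p = 0" if "i \<in> S" "j \<in> S" "k \<in> S'" for i j k
    using A(3)[OF that(1,2) _ _ p, of k] S that by auto
  have 1: "P p f (\<lambda>q. P' q g h) = N f g h - N f h g"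
    if f: "smooth_at M p f" and g: "smooth_at M p g" and h: "smooth_at M p h" for f g h
  proof -
    have "P p f (\<lambda>q. P' q g h) = (\<Sum>i\<in>S. \<Sum>j\<in>S. A i j p * chart_deriv C i f p * chart_deriv C j (\<lambda>q. P' q g h) p)"
      by (rule A(4)[OF p f bivector_field_smooth[OF M P'(2) g h]])
    also have "\<dots> = (\<Sum>i\<in>S. \<Sum>j\<in>S. A i j p * chart_deriv C i f p * P' p g (chart_deriv C j h)
        - A i j p * chart_deriv C i f p * P' p h (chart_deriv C j g))"
    proof (intro sum.cong[OF refl])
      fix i j assume "i \<in> S" "j \<in> S"
      then have "j < mdim M" "j \<notin> S'" using S by auto
      from bv_along_chart_deriv[OF M C p S(2) P'(1) this g h]
        bivector_field_skew[OF P'(2), of p "chart_deriv C j g" h]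
      have "chart_deriv C j (\<lambda>q. P' q g h) p = P' p g (chart_deriv C j h) - P' p h (chart_deriv C j g)"
        by simp
      then show "A i j p * chart_deriv C i f p * chart_deriv C j (\<lambda>q. P' q g h) p =
        A i j p * chart_deriv C i f p * P' p g (chart_deriv C j h)
        - A i j p * chart_deriv C i f p * P' p h (chart_deriv C j g)"
        by (simp only: right_diff_distrib)
    qed
    finally show ?thesis by (simp add: N_def sum_subtractf)
  qed
  have 2: "P' p f (\<lambda>q. P q g h) = N g f h - N h f g"
    if f: "smooth_at M p f" and g: "smooth_at M p g" and h: "smooth_at M p h" for f g h
  proof -
    have "P' p f (\<lambda>q. P q g h) = (\<Sum>i\<in>S. \<Sum>j\<in>S. A i j p * P' p f (chart_deriv C i g) * chart_deriv C j h p
        + A i j p * chart_deriv C i g p * P' p f (chart_deriv C j h))"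
      by (rule derivation_of_bv_along[OF M C p S(1) _ _ bivector_field_derivation[OF M P'(2) f] _ g h],
          erule (1) A(1), erule (2) A(4), rule bv_along_kills(2)[OF P'(1) p smA f A0])
    also have "\<dots> = (\<Sum>i\<in>S. \<Sum>j\<in>S. A i j p * chart_deriv C i g p * P' p f (chart_deriv C j h)
        - A j i p * chart_deriv C j h p * P' p f (chart_deriv C i g))"
    proof (intro sum.cong[OF refl])
      fix i j assume ij: "i \<in> S" "j \<in> S"
      show "A i j p * P' p f (chart_deriv C i g) * chart_deriv C j h p
          + A i j p * chart_deriv C i g p * P' p f (chart_deriv C j h) =
         A i j p * chart_deriv C i g p * P' p f (chart_deriv C j h)
         - A j i p * chart_deriv C j h p * P' p f (chart_deriv C i g)"
        unfolding A(2)[OF ij p] by (simp add: algebra_simps)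
    qed
    also have "\<dots> = N g f h - N h f g"
      unfolding N_def sum_subtractf by (subst (4) sum.swap) (rule refl)
    finally show ?thesis .
  qed
  show ?thesis
    by (simp add: 1[OF f g h] 1[OF g h f] 1[OF h f g] 2[OF f g h] 2[OF g h f] 2[OF h f g])
qed

lemma vector_field_along:
  assumes M: "manifold M" and "\<And>p f. \<not> smooth_at M p f \<Longrightarrow> X p f = 0"
    and *: "\<And>C. C \<in> matlas M \<Longrightarrow> \<exists>S\<subseteq>{..<mdim M}. vf_along M C S X"
  shows "vector_field M X"
  unfolding vector_field_def
proof (intro conjI allI impI ballI)
  fix C assume C: "C \<in> matlas M"
  then obtain S where S: "S \<subseteq> {..<mdim M}" "vf_along M C S X" using * by blast
  obtain a where a: "\<And>i. i \<in> S \<Longrightarrow> smooth_on M (fst C) (a i)"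
    "\<And>i k q. i \<in> S \<Longrightarrow> k < mdim M \<Longrightarrow> k \<notin> S \<Longrightarrow> q \<in> fst C \<Longrightarrow> chart_deriv C k (a i) q = 0"
    "\<And>q f. q \<in> fst C \<Longrightarrow> smooth_at M q f \<Longrightarrow> X q f = (\<Sum>i\<in>S. a i q * chart_deriv C i f q)"
    by (rule vf_alongE[OF S(2)], rule that)
  have o: "openin (mtop M) (fst C)" using chart_openin[OF M, of "fst C" "snd C"] C by simp
  show "\<exists>a. (\<forall>i<mdim M. smooth_on M (fst C) (a i)) \<and>
     (\<forall>p\<in>fst C. \<forall>f. smooth_at M p f \<longrightarrow> X p f = (\<Sum>i<mdim M. a i p * chart_deriv C i f p))"
  proof (intro exI[of _ "\<lambda>i. if i \<in> S then a i else (\<lambda>_. 0)"] conjI allI impI ballI)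
    show "smooth_on M (fst C) (if i \<in> S then a i else (\<lambda>_. 0))" for i
      using a(1) smooth_on_const[OF M o] by simp
    show "X p f = (\<Sum>i<mdim M. (if i \<in> S then a i else (\<lambda>_. 0)) p * chart_deriv C i f p)"
      if "p \<in> fst C" "smooth_at M p f" for p f
      unfolding a(3)[OF that] by (rule sum.mono_neutral_cong_left) (use S in auto)
  qed
qed (rule assms(2))

lemma bivector_field_along:
  assumes M: "manifold M" and "\<And>p f g. \<not> (smooth_at M p f \<and> smooth_at M p g) \<Longrightarrow> P p f g = 0"
    and "\<And>p f g. P p f g = - P p g f"
    and *: "\<And>C. C \<in> matlas M \<Longrightarrow> \<exists>S\<subseteq>{..<mdim M}. bv_along M C S P"
  shows "bivector_field M P"
  unfolding bivector_field_def
proof (intro conjI allI impI ballI)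
  fix C assume C: "C \<in> matlas M"
  then obtain S where S: "S \<subseteq> {..<mdim M}" "bv_along M C S P" using * by blast
  obtain A where A: "\<And>i j. i \<in> S \<Longrightarrow> j \<in> S \<Longrightarrow> smooth_on M (fst C) (A i j)"
    "\<And>i j q. i \<in> S \<Longrightarrow> j \<in> S \<Longrightarrow> q \<in> fst C \<Longrightarrow> A i j q = - A j i q"
    "\<And>i j k q. i \<in> S \<Longrightarrow> j \<in> S \<Longrightarrow> k < mdim M \<Longrightarrow> k \<notin> S \<Longrightarrow> q \<in> fst C \<Longrightarrow> chart_deriv C k (A i j) q = 0"
    "\<And>q f g. q \<in> fst C \<Longrightarrow> smooth_at M q f \<Longrightarrow> smooth_at M q g \<Longrightarrow>
        P q f g = (\<Sum>i\<in>S. \<Sum>j\<in>S. A i j q * chart_deriv C i f q * chart_deriv C j g q)"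
    by (rule bv_alongE[OF S(2)], rule that)
  have o: "openin (mtop M) (fst C)" using chart_openin[OF M, of "fst C" "snd C"] C by simp
  show "\<exists>a. (\<forall>i<mdim M. \<forall>k<mdim M. smooth_on M (fst C) (a i k)) \<and>
     (\<forall>p\<in>fst C. \<forall>f g. smooth_at M p f \<and> smooth_at M p g \<longrightarrow>
        P p f g = (\<Sum>i<mdim M. \<Sum>k<mdim M. a i k p * chart_deriv C i f p * chart_deriv C k g p))"
  proof (intro exI[of _ "\<lambda>i k. if i \<in> S \<and> k \<in> S then A i k else (\<lambda>_. 0)"] conjI allI impI ballI)
    show "smooth_on M (fst C) (if i \<in> S \<and> k \<in> S then A i k else (\<lambda>_. 0))" for i k
      using A(1) smooth_on_const[OF M o] by simp
    show "P p f g = (\<Sum>i<mdim M. \<Sum>k<mdim M. (if i \<in> S \<and> k \<in> S then A i k else (\<lambda>_. 0)) p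
          * chart_deriv C i f p * chart_deriv C k g p)"
      if p: "p \<in> fst C" and fg: "smooth_at M p f \<and> smooth_at M p g" for p f g
      unfolding A(4)[OF p conjunct1[OF fg] conjunct2[OF fg]]
      by (intro sum.mono_neutral_cong_left) (use S in \<open>auto intro!: sum.neutral\<close>)
  qed
qed (rule assms(2,3), assumption?)+

section \<open>Fields on the product\<close>

text \<open>A bivector field is skew as a functional; averaging its coefficients makes the coefficient matrix
  skew as well.\<close>

lemma bivector_field_chart_skew:
  assumes P: "bivector_field N P" and N: "manifold N" and c: "(U, \<phi>) \<in> matlas N"
  obtains A where "\<And>i k. i < mdim N \<Longrightarrow> k < mdim N \<Longrightarrow> smooth_on N U (A i k)"
    "\<And>i k q. A i k q = - A k i q"
    "\<And>p f g. p \<in> U \<Longrightarrow> smooth_at N p f \<Longrightarrow> smooth_at N p g \<Longrightarrow> P p f g =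
       (\<Sum>i<mdim N. \<Sum>k<mdim N. A i k p * chart_deriv (U, \<phi>) i f p * chart_deriv (U, \<phi>) k g p)"
proof -
  obtain a where a: "\<forall>i<mdim N. \<forall>k<mdim N. smooth_on N U (a i k)"
    "\<And>p f g. p \<in> U \<Longrightarrow> smooth_at N p f \<Longrightarrow> smooth_at N p g \<Longrightarrow> P p f g =
       (\<Sum>i<mdim N. \<Sum>k<mdim N. a i k p * chart_deriv (U, \<phi>) i f p * chart_deriv (U, \<phi>) k g p)"
    by (rule bivector_field_chart[OF P c], rule that)
  define A where "A i k q = 1 / 2 * (a i k q + - 1 * a k i q)" for i k q
  note cs = smooth_on_const[OF N chart_openin[OF N c]]
  show ?thesis
  proof (rule that[of A])
    show "smooth_on N U (A i k)" if "i < mdim N" "k < mdim N" for i k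
      unfolding A_def using a(1) that by (intro smooth_on_mult[OF N cs] smooth_on_add[OF N]) auto
    show "A i k q = - A k i q" for i k q by (simp add: A_def field_simps)
    fix p f g assume p: "p \<in> U" and f: "smooth_at N p f" and g: "smooth_at N p g"
    let ?D = "\<lambda>i f. chart_deriv (U, \<phi>) i f p"
    have "P p f g = 1 / 2 * (P p f g - P p g f)"
      using bivector_field_skew[OF P, of p g f] by simp
    also have "\<dots> = 1 / 2 * ((\<Sum>i<mdim N. \<Sum>k<mdim N. a i k p * ?D i f * ?D k g)
        - (\<Sum>i<mdim N. \<Sum>k<mdim N. a k i p * ?D k g * ?D i f))"
      unfolding a(2)[OF p f g] a(2)[OF p g f] by (subst (3) sum.swap) (rule refl)
    also have "\<dots> = (\<Sum>i<mdim N. \<Sum>k<mdim N. A i k p * ?D i f * ?D k g)"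
      by (simp add: A_def sum_subtractf[symmetric] sum_distrib_left algebra_simps)
    finally show "P p f g = (\<Sum>i<mdim N. \<Sum>k<mdim N. A i k p * ?D i f * ?D k g)" .
  qed
qed

lemma sum_apply3: "(\<Sum>j\<in>J. F j) p f = (\<Sum>j\<in>J. F j p f)" for F :: "'i \<Rightarrow> 'a \<Rightarrow> 'b \<Rightarrow> 'c::comm_monoid_add"
  by (induction J rule: infinite_finite_induct) auto

lemma sum_apply4: "(\<Sum>j\<in>J. F j) p f g = (\<Sum>j\<in>J. F j p f g)" for F :: "'i \<Rightarrow> 'a \<Rightarrow> 'b \<Rightarrow> 'd \<Rightarrow> 'c::comm_monoid_add"
  by (induction J rule: infinite_finite_induct) auto

lemma sum_diagonal:
  assumes "finite J" "\<And>j k. j \<in> J \<Longrightarrow> k \<in> J \<Longrightarrow> j \<noteq> k \<Longrightarrow> c j k = (0::'b::comm_monoid_add)"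
  shows "(\<Sum>j\<in>J. \<Sum>k\<in>J. c j k) = (\<Sum>j\<in>J. c j j)"
proof (rule sum.cong[OF refl])
  fix j assume j: "j \<in> J"
  have "(\<Sum>k\<in>J. c j k) = (\<Sum>k\<in>J. if k = j then c j j else 0)"
    by (rule sum.cong[OF refl]) (use assms(2)[OF j] in auto)
  then show "(\<Sum>k\<in>J. c j k) = c j j" using assms(1) j by simp
qed

lemma vector_field_family:
  assumes "\<forall>j\<in>J. vector_field M (X j)" and C: "C \<in> matlas M"
  obtains \<alpha> where "\<forall>j\<in>J. \<forall>i<mdim M. smooth_on M (fst C) (\<alpha> j i)"
    "\<forall>j\<in>J. \<forall>p\<in>fst C. \<forall>f. smooth_at M p f \<longrightarrow> X j p f = (\<Sum>i<mdim M. \<alpha> j i p * chart_deriv C i f p)"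
proof -
  have "\<forall>j\<in>J. \<exists>a. (\<forall>i<mdim M. smooth_on M (fst C) (a i)) \<and>
     (\<forall>p\<in>fst C. \<forall>f. smooth_at M p f \<longrightarrow> X j p f = (\<Sum>i<mdim M. a i p * chart_deriv C i f p))"
    using assms unfolding vector_field_def by blast
  from bchoice[OF this] obtain \<alpha> where \<alpha>: "\<forall>j\<in>J. (\<forall>i<mdim M. smooth_on M (fst C) (\<alpha> j i)) \<and>
     (\<forall>p\<in>fst C. \<forall>f. smooth_at M p f \<longrightarrow> X j p f = (\<Sum>i<mdim M. \<alpha> j i p * chart_deriv C i f p))"
    by (elim exE) (rule that)
  show ?thesis by (rule that[of \<alpha>]) (use \<alpha> in simp_all)
qed

lemma vector_field_sum:
  assumes M: "manifold M" and "finite J" and "\<And>j. j \<in> J \<Longrightarrow> vector_field M (X j)"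
  shows "vector_field M (\<Sum>j\<in>J. X j)"
  unfolding vector_field_def sum_apply3
proof (intro conjI allI impI ballI)
  show "(\<Sum>j\<in>J. X j p f) = 0" if "\<not> smooth_at M p f" for p f
    using assms(3) that unfolding vector_field_def by (intro sum.neutral) blast
  fix C assume C: "C \<in> matlas M"
  have C': "(fst C, snd C) \<in> matlas M" using C by simp
  obtain a where a: "\<forall>j\<in>J. \<forall>i<mdim M. smooth_on M (fst C) (a j i)"
    "\<forall>j\<in>J. \<forall>p\<in>fst C. \<forall>f. smooth_at M p f \<longrightarrow> X j p f = (\<Sum>i<mdim M. a j i p * chart_deriv C i f p)"
    by (rule vector_field_family[OF _ C, of J X], use assms(3) in blast, rule that)
  show "\<exists>a. (\<forall>i<mdim M. smooth_on M (fst C) (a i)) \<and>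
     (\<forall>p\<in>fst C. \<forall>f. smooth_at M p f \<longrightarrow> (\<Sum>j\<in>J. X j p f) = (\<Sum>i<mdim M. a i p * chart_deriv C i f p))"
  proof (intro exI[of _ "\<lambda>i p. \<Sum>j\<in>J. a j i p"] conjI allI impI ballI)
    show "smooth_on M (fst C) (\<lambda>p. \<Sum>j\<in>J. a j i p)" if "i < mdim M" for i
      using a that by (intro smooth_on_sum[OF M chart_openin[OF M C']]) auto
    show "(\<Sum>j\<in>J. X j p f) = (\<Sum>i<mdim M. (\<Sum>j\<in>J. a j i p) * chart_deriv C i f p)"
      if "p \<in> fst C" "smooth_at M p f" for p f
    proof -
      have "(\<Sum>j\<in>J. X j p f) = (\<Sum>j\<in>J. \<Sum>i<mdim M. a j i p * chart_deriv C i f p)"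
        by (rule sum.cong[OF refl]) (use a that in auto)
      then show ?thesis by (subst (asm) sum.swap) (simp add: sum_distrib_right)
    qed
  qed
qed

lemma bivector_field_sum:
  assumes M: "manifold M" and "finite J" and "\<And>j. j \<in> J \<Longrightarrow> bivector_field M (P j)"
  shows "bivector_field M (\<Sum>j\<in>J. P j)"
  unfolding bivector_field_def sum_apply4
proof (intro conjI allI impI ballI)
  show "(\<Sum>j\<in>J. P j p f g) = 0" if "\<not> (smooth_at M p f \<and> smooth_at M p g)" for p f g
    using assms(3) that unfolding bivector_field_def by (intro sum.neutral) blast
  show "(\<Sum>j\<in>J. P j p f g) = - (\<Sum>j\<in>J. P j p g f)" for p f g
    unfolding sum_negf[symmetric] by (rule sum.cong[OF refl bivector_field_skew[OF assms(3)]])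
  fix C assume C: "C \<in> matlas M"
  have C': "(fst C, snd C) \<in> matlas M" using C by simp
  have "\<forall>j\<in>J. \<exists>a. (\<forall>i<mdim M. \<forall>k<mdim M. smooth_on M (fst C) (a i k)) \<and>
     (\<forall>p\<in>fst C. \<forall>f g. smooth_at M p f \<and> smooth_at M p g \<longrightarrow>
        P j p f g = (\<Sum>i<mdim M. \<Sum>k<mdim M. a i k p * chart_deriv C i f p * chart_deriv C k g p))"
    using assms(3) C unfolding bivector_field_def by blast
  from bchoice[OF this] obtain a where a: "\<forall>j\<in>J. (\<forall>i<mdim M. \<forall>k<mdim M. smooth_on M (fst C) (a j i k)) \<and>
     (\<forall>p\<in>fst C. \<forall>f g. smooth_at M p f \<and> smooth_at M p g \<longrightarrow>
        P j p f g = (\<Sum>i<mdim M. \<Sum>k<mdim M. a j i k p * chart_deriv C i f p * chart_deriv C k g p))"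
    by (elim exE) (rule that)
  show "\<exists>a. (\<forall>i<mdim M. \<forall>k<mdim M. smooth_on M (fst C) (a i k)) \<and>
     (\<forall>p\<in>fst C. \<forall>f g. smooth_at M p f \<and> smooth_at M p g \<longrightarrow> (\<Sum>j\<in>J. P j p f g) =
        (\<Sum>i<mdim M. \<Sum>k<mdim M. a i k p * chart_deriv C i f p * chart_deriv C k g p))"
  proof (intro exI[of _ "\<lambda>i k p. \<Sum>j\<in>J. a j i k p"] conjI allI impI ballI)
    show "smooth_on M (fst C) (\<lambda>p. \<Sum>j\<in>J. a j i k p)" if "i < mdim M" "k < mdim M" for i k
      using a that by (intro smooth_on_sum[OF M chart_openin[OF M C']]) auto
    show "(\<Sum>j\<in>J. P j p f g) = (\<Sum>i<mdim M. \<Sum>k<mdim M. (\<Sum>j\<in>J. a j i k p) * chart_deriv C i f p * chart_deriv C k g p)"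
      if "p \<in> fst C" "smooth_at M p f \<and> smooth_at M p g" for p f g
    proof -
      have "(\<Sum>j\<in>J. P j p f g) = (\<Sum>j\<in>J. \<Sum>i<mdim M. \<Sum>k<mdim M. a j i k p * chart_deriv C i f p * chart_deriv C k g p)"
        by (rule sum.cong[OF refl]) (use a that in auto)
      also have "\<dots> = (\<Sum>i<mdim M. \<Sum>k<mdim M. \<Sum>j\<in>J. a j i k p * chart_deriv C i f p * chart_deriv C k g p)"
        by (subst sum.swap, rule sum.cong[OF refl], rule sum.swap)
      finally show ?thesis by (simp add: sum_distrib_right)
    qed
  qed
qed

context mfd_product
begin

lemma lift1_along:
  assumes X: "vector_field (Y j) X" and j: "j \<in> {1..n}" and c: "charts c"
  shows "vf_along M (pdom c, pmap c) (block_set d j) (lift1 M j X)"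
proof -
  obtain a where a: "\<forall>i<d j. smooth_on (Y j) (fst (c j)) (a i)"
    "\<And>p f. p \<in> fst (c j) \<Longrightarrow> smooth_at (Y j) p f \<Longrightarrow>
       X p f = (\<Sum>i<d j. a i p * chart_deriv (fst (c j), snd (c j)) i f p)"
    by (rule vector_field_chart[OF X chartD[OF c j]], rule that)
  define A where "A i q = a (i - block_start d j) (q j)" for i and q :: "nat \<Rightarrow> 'a"
  show ?thesis unfolding vf_along_def fst_conv
  proof (intro exI[of _ A] conjI ballI allI impI)
    fix i assume i: "i \<in> block_set d j"
    then have i': "i - block_start d j < d j" by (auto simp: block_set_def)
    show "smooth_on M (pdom c) (A i)" unfolding A_def
      by (rule smooth_on_pullback[OF c j]) (use a(1) i' in blast)
    fix k q assume k: "k < mdim M" "k \<notin> block_set d j" and q: "q \<in> pdom c"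
    obtain l k' where l: "l \<in> {1..n}" "k' < d l" "k = block_start d l + k'"
      using k(1) unfolding mdim_M by (rule block_ex)
    have "l \<noteq> j" using k(2) l by (auto simp: block_set_def)
    then have "(\<lambda>t. A i (q(l := t))) = (\<lambda>t. a (i - block_start d j) (q j))" by (simp add: A_def)
    then show "chart_deriv (pdom c, pmap c) k (A i) q = 0"
      unfolding l(3) chart_deriv_slice[OF c q l(1,2)] by (simp add: chart_deriv_const)
  next
    fix q f assume q: "q \<in> pdom c" and f: "smooth_at M q f"
    have "lift1 M j X q f = (\<Sum>i<d j. a i (q j) * chart_deriv (c j) i (\<lambda>t. f (q(j := t))) (q j))"
      using a(2)[OF pdomD[OF q j] smooth_at_slice[OF f j]] f by (simp add: lift1_def)
    also have "\<dots> = (\<Sum>i<d j. A (block_start d j + i) q * chart_deriv (pdom c, pmap c) (block_start d j + i) f q)"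
      by (rule sum.cong[OF refl]) (simp add: A_def chart_deriv_slice[OF c q j])
    finally show "lift1 M j X q f = (\<Sum>i\<in>block_set d j. A i q * chart_deriv (pdom c, pmap c) i f q)"
      by (simp add: sum_block_set)
  qed
qed

lemma lift2_along:
  assumes P: "bivector_field (Y j) P" and j: "j \<in> {1..n}" and c: "charts c"
  shows "bv_along M (pdom c, pmap c) (block_set d j) (lift2 M j P)"
proof -
  obtain a where a: "\<And>i k. i < d j \<Longrightarrow> k < d j \<Longrightarrow> smooth_on (Y j) (fst (c j)) (a i k)"
    "\<And>i k q. a i k q = - a k i q"
    "\<And>p f g. p \<in> fst (c j) \<Longrightarrow> smooth_at (Y j) p f \<Longrightarrow> smooth_at (Y j) p g \<Longrightarrow> P p f g =
       (\<Sum>i<d j. \<Sum>k<d j. a i k p * chart_deriv (fst (c j), snd (c j)) i f p * chart_deriv (fst (c j), snd (c j)) k g p)"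
    by (rule bivector_field_chart_skew[OF P mfd[OF j] chartD[OF c j]], rule that)
  define A where "A i k q = a (i - block_start d j) (k - block_start d j) (q j)" for i k and q :: "nat \<Rightarrow> 'a"
  show ?thesis unfolding bv_along_def fst_conv
  proof (intro exI[of _ A] conjI ballI allI impI)
    fix i i2 assume i: "i \<in> block_set d j" "i2 \<in> block_set d j"
    then have i': "i - block_start d j < d j" "i2 - block_start d j < d j" by (auto simp: block_set_def)
    show "smooth_on M (pdom c) (A i i2)" unfolding A_def
      by (rule smooth_on_pullback[OF c j a(1)[OF i']])
    show "A i i2 q = - A i2 i q" for q unfolding A_def by (rule a(2))
    fix k q assume k: "k < mdim M" "k \<notin> block_set d j" and q: "q \<in> pdom c"
    obtain l k' where l: "l \<in> {1..n}" "k' < d l" "k = block_start d l + k'"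
      using k(1) unfolding mdim_M by (rule block_ex)
    have "l \<noteq> j" using k(2) l by (auto simp: block_set_def)
    then have "(\<lambda>t. A i i2 (q(l := t))) = (\<lambda>t. a (i - block_start d j) (i2 - block_start d j) (q j))"
      by (simp add: A_def)
    then show "chart_deriv (pdom c, pmap c) k (A i i2) q = 0"
      unfolding l(3) chart_deriv_slice[OF c q l(1,2)] by (simp add: chart_deriv_const)
  next
    fix q f g assume q: "q \<in> pdom c" and f: "smooth_at M q f" and g: "smooth_at M q g"
    have "lift2 M j P q f g = (\<Sum>i<d j. \<Sum>k<d j. a i k (q j) *
        chart_deriv (c j) i (\<lambda>t. f (q(j := t))) (q j) * chart_deriv (c j) k (\<lambda>t. g (q(j := t))) (q j))"
      using a(3)[OF pdomD[OF q j] smooth_at_slice[OF f j] smooth_at_slice[OF g j]] f g by (simp add: lift2_def)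
    also have "\<dots> = (\<Sum>i<d j. \<Sum>k<d j. A (block_start d j + i) (block_start d j + k) q *
        chart_deriv (pdom c, pmap c) (block_start d j + i) f q * chart_deriv (pdom c, pmap c) (block_start d j + k) g q)"
      by (intro sum.cong[OF refl]) (simp add: A_def chart_deriv_slice[OF c q j])
    finally show "lift2 M j P q f g = (\<Sum>i\<in>block_set d j. \<Sum>k\<in>block_set d j. A i k q *
        chart_deriv (pdom c, pmap c) i f q * chart_deriv (pdom c, pmap c) k g q)"
      by (simp add: sum_block_set)
  qed
qed

lemma block_set_M: "j \<in> {1..n} \<Longrightarrow> block_set d j \<subseteq> {..<mdim M}"
  unfolding mdim_M by (rule block_set_subset)

lemma vector_field_lift1:
  assumes X: "vector_field (Y j) X" and j: "j \<in> {1..n}" shows "vector_field M (lift1 M j X)"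
proof (rule vector_field_along[OF manifold_M])
  fix C assume "C \<in> matlas M"
  then obtain c where c: "charts c" "C = (pdom c, pmap c)" by (rule matlas_M_E)
  show "\<exists>S\<subseteq>{..<mdim M}. vf_along M C S (lift1 M j X)"
    unfolding c(2) by (intro exI conjI) (rule block_set_M[OF j], rule lift1_along[OF X j c(1)])
qed (simp add: lift1_def)

lemma bivector_field_lift2:
  assumes P: "bivector_field (Y j) P" and j: "j \<in> {1..n}" shows "bivector_field M (lift2 M j P)"
proof (rule bivector_field_along[OF manifold_M])
  fix C assume "C \<in> matlas M"
  then obtain c where c: "charts c" "C = (pdom c, pmap c)" by (rule matlas_M_E)
  show "\<exists>S\<subseteq>{..<mdim M}. bv_along M C S (lift2 M j P)"
    unfolding c(2) by (intro exI conjI) (rule block_set_M[OF j], rule lift2_along[OF P j c(1)])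
next
  fix p f g
  show "lift2 M j P p f g = - lift2 M j P p g f"
    using bivector_field_skew[OF P, of "p j" "\<lambda>t. f (p(j := t))" "\<lambda>t. g (p(j := t))"]
    by (simp add: lift2_def)
qed (auto simp: lift2_def)

lemma vector_field_prod:
  "(\<And>j. j \<in> {1..n} \<Longrightarrow> vector_field (Y j) (X j)) \<Longrightarrow> vector_field M (prod_tfield1 n Y X)"
  unfolding prod_tfield1_def by (rule vector_field_sum[OF manifold_M]) (auto intro: vector_field_lift1)

lemma bivector_field_prod:
  "(\<And>j. j \<in> {1..n} \<Longrightarrow> bivector_field (Y j) (P j)) \<Longrightarrow> bivector_field M (prod_tfield2 n Y P)"
  unfolding prod_tfield2_def by (rule bivector_field_sum[OF manifold_M]) (auto intro: bivector_field_lift2)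

lemma prod_tfield1_apply: "prod_tfield1 n Y X p f = (\<Sum>j\<in>{1..n}. lift1 M j (X j) p f)"
  unfolding prod_tfield1_def by (rule sum_apply3)

lemma prod_tfield2_apply: "prod_tfield2 n Y P p f g = (\<Sum>j\<in>{1..n}. lift2 M j (P j) p f g)"
  unfolding prod_tfield2_def by (rule sum_apply4)

text \<open>A lifted field acts on the slice through the point.  When it is applied to the result of another
  lifted field on the same factor, the slice of that result has the expected value only where the
  arguments are still smooth, hence near the point, which is all that a derivation sees.\<close>

lemma derivation_at_slice:
  assumes D: "derivation_at (Y j) (p j) D" and f: "smooth_at M p f" and g: "smooth_at M p g" and j: "j \<in> {1..n}"
    and F: "smooth_at M p F"
    and eq: "\<And>t. smooth_at M (p(j := t)) f \<Longrightarrow> smooth_at M (p(j := t)) g \<Longrightarrow> F (p(j := t)) = G t"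
  shows "D (\<lambda>t. F (p(j := t))) = D G"
proof (rule derivation_at_local[OF mfd[OF j] D smooth_at_slice[OF F j]])
  note p = smooth_at_topspace[OF f]
  obtain W where W: "openin (mtop M) W" "p \<in> W" "\<And>q. q \<in> W \<Longrightarrow> smooth_at M q f" "\<And>q. q \<in> W \<Longrightarrow> smooth_at M q g"
    by (rule smooth_at_open2[OF f g], rule that)
  show "eq_near (Y j) (p j) (\<lambda>t. F (p(j := t))) G"
    by (rule eq_nearI[OF slice_open[OF p j W(1)]]) (use W(2) topspace_comp[OF p j] eq[OF W(3,4)] in auto)
qed

lemma slice_vector_field_derivation:
  "vector_field (Y j) X \<Longrightarrow> j \<in> {1..n} \<Longrightarrow> smooth_at M p f \<Longrightarrow> derivation_at (Y j) (p j) (X (p j))"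
  by (rule vector_field_derivation[OF mfd _ topspace_comp[OF smooth_at_topspace]])

lemma lift1_lift1:
  assumes X: "vector_field (Y j) X" and X': "vector_field (Y j) X'" and j: "j \<in> {1..n}" and f: "smooth_at M p f"
  shows "lift1 M j X p (\<lambda>q. lift1 M j X' q f) = X (p j) (\<lambda>t. X' t (\<lambda>s. f (p(j := s))))"
proof -
  note sm = vector_field_smooth[OF manifold_M vector_field_lift1[OF X' j] f]
  have "X (p j) (\<lambda>t. lift1 M j X' (p(j := t)) f) = X (p j) (\<lambda>t. X' t (\<lambda>s. f (p(j := s))))"
    by (rule derivation_at_slice[OF slice_vector_field_derivation[OF X j f] f f j sm]) (simp add: lift1_def)
  then show ?thesis using sm by (simp add: lift1_def[of M j X])
qed

lemma lift1_lift2: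
  assumes X: "vector_field (Y j) X" and P: "bivector_field (Y j) P" and j: "j \<in> {1..n}"
    and f: "smooth_at M p f" and g: "smooth_at M p g"
  shows "lift1 M j X p (\<lambda>q. lift2 M j P q f g) = X (p j) (\<lambda>t. P t (\<lambda>s. f (p(j := s))) (\<lambda>s. g (p(j := s))))"
proof -
  note sm = bivector_field_smooth[OF manifold_M bivector_field_lift2[OF P j] f g]
  have "X (p j) (\<lambda>t. lift2 M j P (p(j := t)) f g) = X (p j) (\<lambda>t. P t (\<lambda>s. f (p(j := s))) (\<lambda>s. g (p(j := s))))"
    by (rule derivation_at_slice[OF slice_vector_field_derivation[OF X j f] f g j sm]) (simp add: lift2_def)
  then show ?thesis using sm by (simp add: lift1_def)
qed

lemma lift2_lift1:
  assumes X: "vector_field (Y j) X" and P: "bivector_field (Y j) P" and j: "j \<in> {1..n}"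
    and f: "smooth_at M p f" and g: "smooth_at M p g"
  shows "lift2 M j P p f (\<lambda>q. lift1 M j X q g) = P (p j) (\<lambda>s. f (p(j := s))) (\<lambda>t. X t (\<lambda>s. g (p(j := s))))"
proof -
  note sm = vector_field_smooth[OF manifold_M vector_field_lift1[OF X j] g]
  have "P (p j) (\<lambda>s. f (p(j := s))) (\<lambda>t. lift1 M j X (p(j := t)) g) =
      P (p j) (\<lambda>s. f (p(j := s))) (\<lambda>t. X t (\<lambda>s. g (p(j := s))))"
    by (rule derivation_at_slice[OF bivector_field_derivation[OF mfd[OF j] P smooth_at_slice[OF f j]] g g j sm])
       (simp add: lift1_def)
  then show ?thesis using sm f by (simp add: lift2_def)
qed

lemma lift2_lift2:
  assumes P: "bivector_field (Y j) P" and j: "j \<in> {1..n}"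
    and f: "smooth_at M p f" and g: "smooth_at M p g" and h: "smooth_at M p h"
  shows "lift2 M j P p f (\<lambda>q. lift2 M j P q g h) =
    P (p j) (\<lambda>s. f (p(j := s))) (\<lambda>t. P t (\<lambda>s. g (p(j := s))) (\<lambda>s. h (p(j := s))))"
proof -
  note sm = bivector_field_smooth[OF manifold_M bivector_field_lift2[OF P j] g h]
  have "P (p j) (\<lambda>s. f (p(j := s))) (\<lambda>t. lift2 M j P (p(j := t)) g h) =
      P (p j) (\<lambda>s. f (p(j := s))) (\<lambda>t. P t (\<lambda>s. g (p(j := s))) (\<lambda>s. h (p(j := s))))"
    by (rule derivation_at_slice[OF bivector_field_derivation[OF mfd[OF j] P smooth_at_slice[OF f j]] g h j sm])
       (simp add: lift2_def)
  then show ?thesis using sm f by (simp add: lift2_def)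
qed

text \<open>Fields on different factors commute, so the double sum over factors reduces to its diagonal.\<close>

lemma prod_bracket:
  assumes X: "\<And>j. j \<in> {1..n} \<Longrightarrow> vector_field (Y j) (X j)"
    and X': "\<And>j. j \<in> {1..n} \<Longrightarrow> vector_field (Y j) (X' j)"
  shows "vf_bracket M (prod_tfield1 n Y X) (prod_tfield1 n Y X') = prod_tfield1 n Y (\<lambda>j. vf_bracket (Y j) (X j) (X' j))"
proof (intro ext)
  fix p f
  show "vf_bracket M (prod_tfield1 n Y X) (prod_tfield1 n Y X') p f =
      prod_tfield1 n Y (\<lambda>j. vf_bracket (Y j) (X j) (X' j)) p f"
  proof (cases "smooth_at M p f")
    case False
    then show ?thesis by (simp add: vf_bracket_def prod_tfield1_apply lift1_def)
  next
    case f: True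
    note p = smooth_at_topspace[OF f]
    obtain c where c: "charts c" "p \<in> pdom c" using p by (rule charts_at)
    have pc: "p \<in> fst (pdom c, pmap c)" using c(2) by simp
    let ?A = "\<lambda>j k. lift1 M j (X j) p (\<lambda>q. lift1 M k (X' k) q f)"
    let ?B = "\<lambda>j k. lift1 M k (X' k) p (\<lambda>q. lift1 M j (X j) q f)"
    have 1: "prod_tfield1 n Y X p (\<lambda>q. prod_tfield1 n Y X' q f) = (\<Sum>j\<in>{1..n}. \<Sum>k\<in>{1..n}. ?A j k)"
      unfolding prod_tfield1_apply
    proof (rule sum.cong[OF refl])
      fix j assume j: "j \<in> {1..n}"
      show "lift1 M j (X j) p (\<lambda>q. \<Sum>k\<in>{1..n}. lift1 M k (X' k) q f) = (\<Sum>k\<in>{1..n}. ?A j k)"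
        by (rule derivation_at_sum[OF manifold_M vector_field_derivation[OF manifold_M vector_field_lift1[OF X[OF j] j] p]])
           (rule vector_field_smooth[OF manifold_M vector_field_lift1[OF X'] f])
    qed
    have 2: "prod_tfield1 n Y X' p (\<lambda>q. prod_tfield1 n Y X q f) = (\<Sum>k\<in>{1..n}. \<Sum>j\<in>{1..n}. ?B j k)"
      unfolding prod_tfield1_apply
    proof (rule sum.cong[OF refl])
      fix j assume j: "j \<in> {1..n}"
      show "lift1 M j (X' j) p (\<lambda>q. \<Sum>k\<in>{1..n}. lift1 M k (X k) q f) = (\<Sum>k\<in>{1..n}. ?B k j)"
        by (rule derivation_at_sum[OF manifold_M vector_field_derivation[OF manifold_M vector_field_lift1[OF X'[OF j] j] p]])
           (rule vector_field_smooth[OF manifold_M vector_field_lift1[OF X] f])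
    qed
    have sw: "(\<Sum>k\<in>{1..n}. \<Sum>j\<in>{1..n}. ?B j k) = (\<Sum>j\<in>{1..n}. \<Sum>k\<in>{1..n}. ?B j k)"
      by (rule sum.swap)
    have "(\<Sum>j\<in>{1..n}. \<Sum>k\<in>{1..n}. ?A j k) - (\<Sum>k\<in>{1..n}. \<Sum>j\<in>{1..n}. ?B j k) =
        (\<Sum>j\<in>{1..n}. \<Sum>k\<in>{1..n}. ?A j k - ?B j k)"
      unfolding sw by (simp only: sum_subtractf)
    also have "\<dots> = (\<Sum>j\<in>{1..n}. ?A j j - ?B j j)"
    proof (rule sum_diagonal)
      fix j k assume jk: "j \<in> {1..n}" "k \<in> {1..n}" "j \<noteq> k"
      have "?A j k = ?B j k"
        by (rule vf_along_commute[OF manifold_M chart_in_M[OF c(1)] pc block_set_M[OF jk(1)] block_set_M[OF jk(2)]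
              block_set_disjoint[OF jk] lift1_along[OF X[OF jk(1)] jk(1) c(1)] vector_field_lift1[OF X[OF jk(1)] jk(1)]
              lift1_along[OF X'[OF jk(2)] jk(2) c(1)] vector_field_lift1[OF X'[OF jk(2)] jk(2)] f])
      then show "?A j k - ?B j k = 0" by simp
    qed simp
    also have "\<dots> = prod_tfield1 n Y (\<lambda>j. vf_bracket (Y j) (X j) (X' j)) p f"
      unfolding prod_tfield1_apply
    proof (rule sum.cong[OF refl])
      fix j assume j: "j \<in> {1..n}"
      show "?A j j - ?B j j = lift1 M j (vf_bracket (Y j) (X j) (X' j)) p f"
        unfolding lift1_lift1[OF X[OF j] X'[OF j] j f] lift1_lift1[OF X'[OF j] X[OF j] j f]
        using f smooth_at_slice[OF f j] by (simp add: lift1_def vf_bracket_def)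
    qed
    finally show ?thesis using f unfolding vf_bracket_def 1 2 by simp
  qed
qed

lemma prod_schouten:
  assumes X: "\<And>j. j \<in> {1..n} \<Longrightarrow> vector_field (Y j) (X j)"
    and P: "\<And>j. j \<in> {1..n} \<Longrightarrow> bivector_field (Y j) (P j)"
  shows "schouten M (prod_tfield1 n Y X) (prod_tfield2 n Y P) = prod_tfield2 n Y (\<lambda>j. schouten (Y j) (X j) (P j))"
proof (intro ext)
  fix p f g
  show "schouten M (prod_tfield1 n Y X) (prod_tfield2 n Y P) p f g =
      prod_tfield2 n Y (\<lambda>j. schouten (Y j) (X j) (P j)) p f g"
  proof (cases "smooth_at M p f \<and> smooth_at M p g")
    case False
    then have "lift2 M j (schouten (Y j) (X j) (P j)) p f g = 0" for j unfolding lift2_def by (rule if_not_P)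
    then have "prod_tfield2 n Y (\<lambda>j. schouten (Y j) (X j) (P j)) p f g = 0"
      unfolding prod_tfield2_apply by (simp only: sum.neutral_const)
    moreover have "schouten M (prod_tfield1 n Y X) (prod_tfield2 n Y P) p f g = 0"
      unfolding schouten_def by (rule if_not_P[OF False])
    ultimately show ?thesis by simp
  next
    case fg: True
    then have f: "smooth_at M p f" and g: "smooth_at M p g" by auto
    note p = smooth_at_topspace[OF f]
    obtain c where c: "charts c" "p \<in> pdom c" using p by (rule charts_at)
    have pc: "p \<in> fst (pdom c, pmap c)" using c(2) by simp
    let ?A = "\<lambda>j k. lift1 M j (X j) p (\<lambda>q. lift2 M k (P k) q f g)"
    let ?B = "\<lambda>j k. lift2 M k (P k) p (\<lambda>q. lift1 M j (X j) q f) g"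
    let ?C = "\<lambda>j k. lift2 M k (P k) p f (\<lambda>q. lift1 M j (X j) q g)"
    note vX = vector_field_lift1[OF X] and bP = bivector_field_lift2[OF P]
    have 1: "prod_tfield1 n Y X p (\<lambda>q. prod_tfield2 n Y P q f g) = (\<Sum>j\<in>{1..n}. \<Sum>k\<in>{1..n}. ?A j k)"
      unfolding prod_tfield1_apply prod_tfield2_apply
    proof (rule sum.cong[OF refl])
      fix j assume j: "j \<in> {1..n}"
      show "lift1 M j (X j) p (\<lambda>q. \<Sum>k\<in>{1..n}. lift2 M k (P k) q f g) = (\<Sum>k\<in>{1..n}. ?A j k)"
        by (rule derivation_at_sum[OF manifold_M vector_field_derivation[OF manifold_M vX[OF j j] p]])
           (rule bivector_field_smooth[OF manifold_M bP f g])
    qed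
    have 2: "prod_tfield2 n Y P p (\<lambda>q. prod_tfield1 n Y X q f) g = (\<Sum>k\<in>{1..n}. \<Sum>j\<in>{1..n}. ?B j k)"
      unfolding prod_tfield1_apply prod_tfield2_apply
    proof (rule sum.cong[OF refl])
      fix k assume k: "k \<in> {1..n}"
      show "lift2 M k (P k) p (\<lambda>q. \<Sum>j\<in>{1..n}. lift1 M j (X j) q f) g = (\<Sum>j\<in>{1..n}. ?B j k)"
        by (rule derivation_at_sum[OF manifold_M bivector_field_derivation_left[OF manifold_M bP[OF k k] g]])
           (rule vector_field_smooth[OF manifold_M vX f])
    qed
    have 3: "prod_tfield2 n Y P p f (\<lambda>q. prod_tfield1 n Y X q g) = (\<Sum>k\<in>{1..n}. \<Sum>j\<in>{1..n}. ?C j k)"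
      unfolding prod_tfield1_apply prod_tfield2_apply
    proof (rule sum.cong[OF refl])
      fix k assume k: "k \<in> {1..n}"
      show "lift2 M k (P k) p f (\<lambda>q. \<Sum>j\<in>{1..n}. lift1 M j (X j) q g) = (\<Sum>j\<in>{1..n}. ?C j k)"
        by (rule derivation_at_sum[OF manifold_M bivector_field_derivation[OF manifold_M bP[OF k k] f]])
           (rule vector_field_smooth[OF manifold_M vX g])
    qed
    have sw: "(\<Sum>k\<in>{1..n}. \<Sum>j\<in>{1..n}. ?B j k) = (\<Sum>j\<in>{1..n}. \<Sum>k\<in>{1..n}. ?B j k)"
      "(\<Sum>k\<in>{1..n}. \<Sum>j\<in>{1..n}. ?C j k) = (\<Sum>j\<in>{1..n}. \<Sum>k\<in>{1..n}. ?C j k)"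
      by (rule sum.swap)+
    have "(\<Sum>j\<in>{1..n}. \<Sum>k\<in>{1..n}. ?A j k) - (\<Sum>k\<in>{1..n}. \<Sum>j\<in>{1..n}. ?B j k) - (\<Sum>k\<in>{1..n}. \<Sum>j\<in>{1..n}. ?C j k) =
        (\<Sum>j\<in>{1..n}. \<Sum>k\<in>{1..n}. ?A j k - ?B j k - ?C j k)"
      unfolding sw by (simp only: sum_subtractf)
    also have "\<dots> = (\<Sum>j\<in>{1..n}. ?A j j - ?B j j - ?C j j)"
    proof (rule sum_diagonal)
      fix j k assume jk: "j \<in> {1..n}" "k \<in> {1..n}" "j \<noteq> k"
      have "?A j k = ?B j k + ?C j k"
        by (rule vf_bv_along_commute[OF manifold_M chart_in_M[OF c(1)] pc block_set_M[OF jk(1)] block_set_M[OF jk(2)]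
              block_set_disjoint[OF jk] lift1_along[OF X[OF jk(1)] jk(1) c(1)] vX[OF jk(1) jk(1)]
              lift2_along[OF P[OF jk(2)] jk(2) c(1)] bP[OF jk(2) jk(2)] f g])
      then show "?A j k - ?B j k - ?C j k = 0" by simp
    qed simp
    also have "\<dots> = prod_tfield2 n Y (\<lambda>j. schouten (Y j) (X j) (P j)) p f g"
      unfolding prod_tfield2_apply
    proof (rule sum.cong[OF refl])
      fix j assume j: "j \<in> {1..n}"
      have B: "?B j j = P j (p j) (\<lambda>t. X j t (\<lambda>s. f (p(j := s)))) (\<lambda>s. g (p(j := s)))"
        unfolding bivector_field_skew[OF bP[OF j j], of p "\<lambda>q. lift1 M j (X j) q f"]
          lift2_lift1[OF X[OF j] P[OF j] j g f]
        by (rule bivector_field_skew[OF P[OF j], symmetric])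
      show "?A j j - ?B j j - ?C j j = lift2 M j (schouten (Y j) (X j) (P j)) p f g"
        unfolding lift1_lift2[OF X[OF j] P[OF j] j f g] B lift2_lift1[OF X[OF j] P[OF j] j f g]
        using f g smooth_at_slice[OF f j] smooth_at_slice[OF g j] by (simp add: lift2_def schouten_def)
    qed
    finally show ?thesis using fg unfolding schouten_def 1 2 3 by simp
  qed
qed

text \<open>In the double sum over factors, diagonal terms vanish by the Jacobi identity on the factor and
  off-diagonal ones cancel in pairs.\<close>

lemma prod_poisson:
  assumes P: "\<And>j. j \<in> {1..n} \<Longrightarrow> poisson_manifold (Y j) (P j)"
  shows "poisson_manifold M (prod_tfield2 n Y P)"
  unfolding poisson_manifold_def
proof (intro conjI allI impI)
  have bv: "bivector_field (Y j) (P j)" if "j \<in> {1..n}" for j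
    using P[OF that] unfolding poisson_manifold_def by (elim conjE)
  have jac: "P j p f (\<lambda>q. P j q g h) + P j p g (\<lambda>q. P j q h f) + P j p h (\<lambda>q. P j q f g) = 0"
    if "j \<in> {1..n}" "smooth_at (Y j) p f" "smooth_at (Y j) p g" "smooth_at (Y j) p h" for j p f g h
  proof -
    have "\<forall>p f g h. smooth_at (Y j) p f \<and> smooth_at (Y j) p g \<and> smooth_at (Y j) p h \<longrightarrow>
        P j p f (\<lambda>q. P j q g h) + P j p g (\<lambda>q. P j q h f) + P j p h (\<lambda>q. P j q f g) = 0"
      using P[OF that(1)] unfolding poisson_manifold_def by (elim conjE)
    from this[rule_format, OF conjI[OF that(2) conjI[OF that(3,4)]]] show ?thesis .
  qed
  note bP = bivector_field_lift2[OF bv]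
  show "manifold M" by (rule manifold_M)
  show "bivector_field M (prod_tfield2 n Y P)" by (rule bivector_field_prod[OF bv])
  fix p f g h assume "smooth_at M p f \<and> smooth_at M p g \<and> smooth_at M p h"
  then have f: "smooth_at M p f" and g: "smooth_at M p g" and h: "smooth_at M p h" by auto
  obtain c where c: "charts c" "p \<in> pdom c" using smooth_at_topspace[OF f] by (rule charts_at)
  have pc: "p \<in> fst (pdom c, pmap c)" using c(2) by simp
  define T where "T f g h j k = lift2 M j (P j) p f (\<lambda>q. lift2 M k (P k) q g h)" for f g h j k
  define J where "J j k = T f g h j k + T g h f j k + T h f g j k" for j k
  have T: "prod_tfield2 n Y P p f (\<lambda>q. prod_tfield2 n Y P q g h) = (\<Sum>j\<in>{1..n}. \<Sum>k\<in>{1..n}. T f g h j k)"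
    if f: "smooth_at M p f" and g: "smooth_at M p g" and h: "smooth_at M p h" for f g h
    unfolding prod_tfield2_apply T_def
  proof (rule sum.cong[OF refl])
    fix j assume j: "j \<in> {1..n}"
    show "lift2 M j (P j) p f (\<lambda>q. \<Sum>k\<in>{1..n}. lift2 M k (P k) q g h) =
        (\<Sum>k\<in>{1..n}. lift2 M j (P j) p f (\<lambda>q. lift2 M k (P k) q g h))"
      by (rule derivation_at_sum[OF manifold_M bivector_field_derivation[OF manifold_M bP[OF j j] f]])
         (rule bivector_field_smooth[OF manifold_M bP g h])
  qed
  have cross: "J j k + J k j = 0" if jk: "j \<in> {1..n}" "k \<in> {1..n}" "j \<noteq> k" for j k
    unfolding J_def T_def
    by (rule bv_along_jacobi_mixed[OF manifold_M chart_in_M[OF c(1)] pc block_set_M[OF jk(1)] block_set_M[OF jk(2)]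
              block_set_disjoint[OF jk] lift2_along[OF bv[OF jk(1)] jk(1) c(1)] bP[OF jk(1) jk(1)]
              lift2_along[OF bv[OF jk(2)] jk(2) c(1)] bP[OF jk(2) jk(2)] f g h])
  have same: "J j j = 0" if j: "j \<in> {1..n}" for j
    unfolding J_def T_def lift2_lift2[OF bv[OF j] j f g h] lift2_lift2[OF bv[OF j] j g h f] lift2_lift2[OF bv[OF j] j h f g]
    by (rule jac[OF j smooth_at_slice[OF f j] smooth_at_slice[OF g j] smooth_at_slice[OF h j]])
  have "J j k + J k j = 0" if "j \<in> {1..n}" "k \<in> {1..n}" for j k
    using cross[OF that] same[OF that(1)] by (cases "j = k") auto
  then have "(\<Sum>j\<in>{1..n}. \<Sum>k\<in>{1..n}. J j k + J k j) = 0" by simp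
  moreover have "(\<Sum>j\<in>{1..n}. \<Sum>k\<in>{1..n}. J k j) = (\<Sum>j\<in>{1..n}. \<Sum>k\<in>{1..n}. J j k)"
    by (rule sum.swap)
  ultimately have "(\<Sum>j\<in>{1..n}. \<Sum>k\<in>{1..n}. J j k) + (\<Sum>j\<in>{1..n}. \<Sum>k\<in>{1..n}. J j k) = 0"
    by (simp only: sum.distrib)
  then have "(\<Sum>j\<in>{1..n}. \<Sum>k\<in>{1..n}. J j k) = 0"
    by (simp add: mult_2[symmetric])
  then show "prod_tfield2 n Y P p f (\<lambda>q. prod_tfield2 n Y P q g h) + prod_tfield2 n Y P p g (\<lambda>q. prod_tfield2 n Y P q h f)
      + prod_tfield2 n Y P p h (\<lambda>q. prod_tfield2 n Y P q f g) = 0"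
    unfolding T[OF f g h] T[OF g h f] T[OF h f g] J_def sum.distrib .
qed

end

section \<open>The tensor square\<close>

lemma tens_module: "module (\<lambda>(c::'k::field) (T::('k, 'g) tens2) \<xi> \<eta>. c * T \<xi> \<eta>)"
  by standard (auto simp: fun_eq_iff algebra_simps)

lemma tens_square_add: "T \<in> tens_square L \<Longrightarrow> T' \<in> tens_square L \<Longrightarrow> T + T' \<in> tens_square L"
  unfolding tens_square_def by (rule module.span_add[OF tens_module])

lemma tens_square_diff: "T \<in> tens_square L \<Longrightarrow> T' \<in> tens_square L \<Longrightarrow> T - T' \<in> tens_square L"
  unfolding tens_square_def by (rule module.span_diff[OF tens_module])

lemma tens_square_uminus: "T \<in> tens_square L \<Longrightarrow> - T \<in> tens_square L"
  unfolding tens_square_def by (rule module.span_neg[OF tens_module])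

lemma tens_square_zero: "0 \<in> tens_square L"
  unfolding tens_square_def by (rule module.span_zero[OF tens_module])

lemma tens_square_sum: "(\<And>s. s \<in> S \<Longrightarrow> T s \<in> tens_square L) \<Longrightarrow> (\<Sum>s\<in>S. T s) \<in> tens_square L"
  unfolding tens_square_def by (rule module.span_sum[OF tens_module])

text \<open>Every element of the tensor square is a finite combination of pure tensors; this holds for
  its values on arbitrary functions, linear or not.\<close>

lemma tens_square_repr:
  assumes "T \<in> tens_square L"
  obtains N :: nat and c a b where "\<And>i. i < N \<Longrightarrow> a i \<in> lcarrier L" "\<And>i. i < N \<Longrightarrow> b i \<in> lcarrier L"
    "\<And>\<xi> \<eta>. T \<xi> \<eta> = (\<Sum>i<N. c i * (\<xi> (a i) * \<eta> (b i)))"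
proof -
  have "\<exists>(N::nat) c a b. (\<forall>i<N. a i \<in> lcarrier L) \<and> (\<forall>i<N. b i \<in> lcarrier L) \<and>
    (\<forall>\<xi> \<eta>. T \<xi> \<eta> = (\<Sum>i<N. c i * (\<xi> (a i) * \<eta> (b i))))"
    using assms unfolding tens_square_def
  proof (induction rule: module.span_induct_alt[OF tens_module, consumes 1])
    case 1
    show ?case by (intro exI[of _ 0]) simp
  next
    case (2 k S T)
    obtain N :: nat and c a b where T: "\<forall>i<N. a i \<in> lcarrier L" "\<forall>i<N. b i \<in> lcarrier L"
      "\<forall>\<xi> \<eta>. T \<xi> \<eta> = (\<Sum>i<N. c i * (\<xi> (a i) * \<eta> (b i)))"
      using 2(2) by (elim exE conjE) (rule that)
    obtain u v where S: "S = u \<otimes> v" "u \<in> lcarrier L" "v \<in> lcarrier L" using 2(1) by blast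
    have sm: "(\<Sum>i<N. (c(N := k)) i * (\<xi> ((a(N := u)) i) * \<eta> ((b(N := v)) i))) = T \<xi> \<eta>" for \<xi> \<eta>
      using T(3) by (auto intro!: sum.cong)
    show ?case
    proof (intro exI conjI allI impI)
      show "((\<lambda>\<xi> \<eta>. k * S \<xi> \<eta>) + T) \<xi> \<eta> =
          (\<Sum>i<Suc N. (c(N := k)) i * (\<xi> ((a(N := u)) i) * \<eta> ((b(N := v)) i)))" for \<xi> \<eta>
        unfolding sum.lessThan_Suc sm by (simp add: S(1) tens_def)
      show "(a(N := u)) i \<in> lcarrier L" "(b(N := v)) i \<in> lcarrier L" if "i < Suc N" for i
        using that T S by (auto simp: less_Suc_eq)
    qed
  qed
  then obtain N :: nat and c a b where T: "\<forall>i<N. a i \<in> lcarrier L" "\<forall>i<N. b i \<in> lcarrier L"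
      "\<forall>\<xi> \<eta>. T \<xi> \<eta> = (\<Sum>i<N. c i * (\<xi> (a i) * \<eta> (b i)))"
    by (elim exE conjE) (rule that)
  show ?thesis by (rule that[of N a b c]) (fact T[rule_format])+
qed

lemma tens_square_cong:
  assumes "T \<in> tens_square L" "\<And>u. u \<in> lcarrier L \<Longrightarrow> \<xi> u = \<xi>' u" "\<And>u. u \<in> lcarrier L \<Longrightarrow> \<eta> u = \<eta>' u"
  shows "T \<xi> \<eta> = T \<xi>' \<eta>'"
proof -
  obtain N :: nat and c a b where T: "\<And>i. i < N \<Longrightarrow> a i \<in> lcarrier L" "\<And>i. i < N \<Longrightarrow> b i \<in> lcarrier L"
    "\<And>\<xi> \<eta>. T \<xi> \<eta> = (\<Sum>i<N. c i * (\<xi> (a i) * \<eta> (b i)))"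
    by (rule tens_square_repr[OF assms(1)], rule that)
  show ?thesis unfolding T(3) by (rule sum.cong[OF refl]) (simp add: assms(2,3) T(1,2))
qed

lemma tens_square_sum_left:
  assumes "T \<in> tens_square L"
  shows "T (\<lambda>u. \<Sum>s\<in>S. k s * F s u) \<eta> = (\<Sum>s\<in>S. k s * T (F s) \<eta>)"
proof -
  obtain N :: nat and c a b where T: "\<And>i. i < N \<Longrightarrow> a i \<in> lcarrier L" "\<And>i. i < N \<Longrightarrow> b i \<in> lcarrier L"
    "\<And>\<xi> \<eta>. T \<xi> \<eta> = (\<Sum>i<N. c i * (\<xi> (a i) * \<eta> (b i)))"
    by (rule tens_square_repr[OF assms(1)], rule that)
  show ?thesis unfolding T(3) sum_distrib_left sum_distrib_right
    by (subst sum.swap) (simp add: mult_ac)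
qed

lemma tens_square_sum_right:
  assumes "T \<in> tens_square L"
  shows "T \<xi> (\<lambda>u. \<Sum>s\<in>S. k s * F s u) = (\<Sum>s\<in>S. k s * T \<xi> (F s))"
proof -
  obtain N :: nat and c a b where T: "\<And>i. i < N \<Longrightarrow> a i \<in> lcarrier L" "\<And>i. i < N \<Longrightarrow> b i \<in> lcarrier L"
    "\<And>\<xi> \<eta>. T \<xi> \<eta> = (\<Sum>i<N. c i * (\<xi> (a i) * \<eta> (b i)))"
    by (rule tens_square_repr[OF assms(1)], rule that)
  show ?thesis unfolding T(3) sum_distrib_left sum_distrib_right
    by (subst sum.swap) (simp add: mult_ac)
qed

lemma tens_square_linear:
  assumes T: "T \<in> tens_square L"
  shows "T (\<lambda>u. - F u) \<eta> = - T F \<eta>" "T \<xi> (\<lambda>u. - F u) = - T \<xi> F"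
    "T (\<lambda>u. 0) \<eta> = 0" "T \<xi> (\<lambda>u. 0) = 0"
    "T (\<lambda>u. F u + G u) \<eta> = T F \<eta> + T G \<eta>" "T \<xi> (\<lambda>u. F u + G u) = T \<xi> F + T \<xi> G"
    "T (\<lambda>u. k * F u) \<eta> = k * T F \<eta>" "T \<xi> (\<lambda>u. k * F u) = k * T \<xi> F"
proof -
  obtain N :: nat and c a b where R: "\<And>i. i < N \<Longrightarrow> a i \<in> lcarrier L" "\<And>i. i < N \<Longrightarrow> b i \<in> lcarrier L"
    "\<And>\<xi> \<eta>. T \<xi> \<eta> = (\<Sum>i<N. c i * (\<xi> (a i) * \<eta> (b i)))"
    by (rule tens_square_repr[OF T], rule that)
  show "T (\<lambda>u. - F u) \<eta> = - T F \<eta>" "T \<xi> (\<lambda>u. - F u) = - T \<xi> F"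
    "T (\<lambda>u. 0) \<eta> = 0" "T \<xi> (\<lambda>u. 0) = 0"
    "T (\<lambda>u. F u + G u) \<eta> = T F \<eta> + T G \<eta>" "T \<xi> (\<lambda>u. F u + G u) = T \<xi> F + T \<xi> G"
    "T (\<lambda>u. k * F u) \<eta> = k * T F \<eta>" "T \<xi> (\<lambda>u. k * F u) = k * T \<xi> F"
    unfolding R(3)
    by (simp_all add: sum_negf sum.distrib ring_distribs sum_distrib_left mult_ac)
qed

lemma tens_flip_in_square: 
  assumes "T \<in> tens_square L" shows "tens_flip T \<in> tens_square L"
proof -
  obtain N :: nat and c a b where R: "\<And>i. i < N \<Longrightarrow> a i \<in> lcarrier L" "\<And>i. i < N \<Longrightarrow> b i \<in> lcarrier L"
    "\<And>\<xi> \<eta>. T \<xi> \<eta> = (\<Sum>i<N. c i * (\<xi> (a i) * \<eta> (b i)))"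
    by (rule tens_square_repr[OF assms], rule that)
  have "tens_flip T = (\<Sum>i<N. (\<lambda>\<xi> \<eta>. c i * (b i \<otimes> a i) \<xi> \<eta>))"
    by (simp add: tens_flip_def fun_eq_iff sum_apply2 R(3) tens_def mult_ac)
  also have "\<dots> \<in> tens_square L"
    using R(1,2) unfolding tens_square_def
    by (intro module.span_sum[OF tens_module] module.span_scale[OF tens_module] module.span_base[OF tens_module]) blast
  finally show ?thesis .
qed

section \<open>Lie algebras and their direct powers\<close>

lemma lie_algebra_module: "lie_algebra L \<Longrightarrow> vector_space (lscale L)"
  unfolding lie_algebra_def by (elim conjE)

lemma lie_algebra_span: "lie_algebra L \<Longrightarrow> \<exists>B. finite B \<and> lcarrier L = module.span (lscale L) B"
  unfolding lie_algebra_def by (elim conjE)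

lemma lie_carrier:
  assumes "lie_algebra L"
  shows "0 \<in> lcarrier L" "u \<in> lcarrier L \<Longrightarrow> v \<in> lcarrier L \<Longrightarrow> u + v \<in> lcarrier L"
    "u \<in> lcarrier L \<Longrightarrow> lscale L k u \<in> lcarrier L"
proof -
  interpret V: vector_space "lscale L" by (rule lie_algebra_module[OF assms])
  obtain B where B: "lcarrier L = V.span B" using lie_algebra_span[OF assms] by blast
  show "0 \<in> lcarrier L" "u \<in> lcarrier L \<Longrightarrow> v \<in> lcarrier L \<Longrightarrow> u + v \<in> lcarrier L"
    "u \<in> lcarrier L \<Longrightarrow> lscale L k u \<in> lcarrier L"
    unfolding B by (rule V.span_zero, rule V.span_add, assumption+, rule V.span_scale)
qed

lemma lscale_zero:
  assumes "lie_algebra L" shows "lscale L k 0 = 0"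
proof -
  interpret V: vector_space "lscale L" by (rule lie_algebra_module[OF assms])
  show ?thesis by (rule V.scale_zero_right)
qed

lemma lie_br_closed: "lie_algebra L \<Longrightarrow> u \<in> lcarrier L \<Longrightarrow> v \<in> lcarrier L \<Longrightarrow> lbr L u v \<in> lcarrier L"
  unfolding lie_algebra_def by (elim conjE) blast

lemma lie_br_add:
  assumes "lie_algebra L" "u \<in> lcarrier L" "v \<in> lcarrier L" "w \<in> lcarrier L"
  shows "lbr L (u + v) w = lbr L u w + lbr L v w" "lbr L w (u + v) = lbr L w u + lbr L w v"
proof -
  have "\<forall>u\<in>lcarrier L. \<forall>v\<in>lcarrier L. \<forall>w\<in>lcarrier L.
        lbr L (u + v) w = lbr L u w + lbr L v w \<and> lbr L w (u + v) = lbr L w u + lbr L w v"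
    using assms(1) unfolding lie_algebra_def by (elim conjE)
  then show "lbr L (u + v) w = lbr L u w + lbr L v w" "lbr L w (u + v) = lbr L w u + lbr L w v"
    using assms(2-) by blast+
qed

lemma lie_br_scale:
  assumes "lie_algebra L" "u \<in> lcarrier L" "v \<in> lcarrier L"
  shows "lbr L (lscale L c u) v = lscale L c (lbr L u v)" "lbr L u (lscale L c v) = lscale L c (lbr L u v)"
proof -
  have "\<forall>c. \<forall>u\<in>lcarrier L. \<forall>v\<in>lcarrier L.
        lbr L (lscale L c u) v = lscale L c (lbr L u v) \<and>
        lbr L u (lscale L c v) = lscale L c (lbr L u v)"
    using assms(1) unfolding lie_algebra_def by (elim conjE)
  then show "lbr L (lscale L c u) v = lscale L c (lbr L u v)" "lbr L u (lscale L c v) = lscale L c (lbr L u v)"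
    using assms(2-) by blast+
qed

lemma lie_br_self: "lie_algebra L \<Longrightarrow> u \<in> lcarrier L \<Longrightarrow> lbr L u u = 0"
  unfolding lie_algebra_def by (elim conjE) blast

lemma lie_jacobi:
  assumes "lie_algebra L" "u \<in> lcarrier L" "v \<in> lcarrier L" "w \<in> lcarrier L"
  shows "lbr L u (lbr L v w) + lbr L v (lbr L w u) + lbr L w (lbr L u v) = 0"
proof -
  have "\<forall>u\<in>lcarrier L. \<forall>v\<in>lcarrier L. \<forall>w\<in>lcarrier L.
        lbr L u (lbr L v w) + lbr L v (lbr L w u) + lbr L w (lbr L u v) = 0"
    using assms(1) unfolding lie_algebra_def by (elim conjE)
  then show ?thesis using assms(2-) by blast
qed

lemma lie_br_zero:
  assumes "lie_algebra L" "u \<in> lcarrier L"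
  shows "lbr L 0 u = 0" "lbr L u 0 = 0"
  using lie_br_add[OF assms(1) lie_carrier(1)[OF assms(1)] lie_carrier(1)[OF assms(1)] assms(2)] by simp_all

lemma lie_br_skew:
  assumes L: "lie_algebra L" and u: "u \<in> lcarrier L" and v: "v \<in> lcarrier L"
  shows "lbr L u v = - lbr L v u"
proof -
  have "0 = lbr L (u + v) (u + v)" using lie_br_self[OF L lie_carrier(2)[OF L u v]] by simp
  also have "\<dots> = lbr L u v + lbr L v u"
    unfolding lie_br_add(1)[OF L u v lie_carrier(2)[OF L u v]] lie_br_add(2)[OF L u v u] lie_br_add(2)[OF L u v v]
    by (simp add: lie_br_self[OF L] u v)
  finally show ?thesis by (simp add: eq_neg_iff_add_eq_0)
qed

lemma lie_dual_add: "\<xi> \<in> lie_dual L \<Longrightarrow> u \<in> lcarrier L \<Longrightarrow> v \<in> lcarrier L \<Longrightarrow> \<xi> (u + v) = \<xi> u + \<xi> v"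
  by (simp add: lie_dual_def)

lemma lie_dual_scale: "\<xi> \<in> lie_dual L \<Longrightarrow> u \<in> lcarrier L \<Longrightarrow> \<xi> (lscale L c u) = c * \<xi> u"
  by (simp add: lie_dual_def)

lemma lie_dual_zero:
  assumes "lie_algebra L" "\<xi> \<in> lie_dual L" shows "\<xi> 0 = 0"
proof (rule add_left_imp_eq[of "\<xi> 0"])
  show "\<xi> 0 + \<xi> 0 = \<xi> 0 + 0"
    using lie_dual_add[OF assms(2) lie_carrier(1)[OF assms(1)] lie_carrier(1)[OF assms(1)]]
    by (simp only: add_0_right)
qed

lemma lie_dual_br_skew:
  assumes L: "lie_algebra L" and \<xi>: "\<xi> \<in> lie_dual L" and u: "u \<in> lcarrier L" and v: "v \<in> lcarrier L"
  shows "\<xi> (lbr L u v) = - \<xi> (lbr L v u)"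
proof -
  have "\<xi> (lbr L u v) + \<xi> (lbr L v u) = \<xi> (lbr L u v + lbr L v u)"
    by (rule lie_dual_add[OF \<xi> lie_br_closed[OF L u v] lie_br_closed[OF L v u], symmetric])
  also have "\<dots> = 0" using lie_br_skew[OF L u v] lie_dual_zero[OF L \<xi>] by simp
  finally show ?thesis by (simp add: eq_neg_iff_add_eq_0)
qed

lemma summand_simps:
  "summand j u j = u" "k \<noteq> j \<Longrightarrow> summand j u k = 0" "summand j 0 = 0"
  by (auto simp: summand_def fun_eq_iff)

lemma summand_add: "summand j (u + v) = summand j u + summand j (v::'g::ab_group_add)"
  by (auto simp: summand_def fun_eq_iff)

lemma lie_power_simps:
  "lscale (lie_power n L) c z j = lscale L c (z j)"
  "lbr (lie_power n L) z w j = lbr L (z j) (w j)"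
  "z \<in> lcarrier (lie_power n L) \<longleftrightarrow> (\<forall>j\<in>{1..n}. z j \<in> lcarrier L) \<and> (\<forall>j. j \<notin> {1..n} \<longrightarrow> z j = 0)"
  by (simp_all add: lie_power_def)

lemma lie_power_comp: "lie_algebra L \<Longrightarrow> z \<in> lcarrier (lie_power n L) \<Longrightarrow> z j \<in> lcarrier L"
  using lie_carrier(1)[of L] unfolding lie_power_simps by (cases "j \<in> {1..n}") auto

lemma summand_carrier:
  "lie_algebra L \<Longrightarrow> j \<in> {1..n} \<Longrightarrow> u \<in> lcarrier L \<Longrightarrow> summand j u \<in> lcarrier (lie_power n L)"
  using lie_carrier(1)[of L] unfolding lie_power_simps summand_def by auto

lemma summand_scale: "lie_algebra L \<Longrightarrow> summand j (lscale L c u) = lscale (lie_power n L) c (summand j u)"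
  by (auto simp: summand_def fun_eq_iff lie_power_simps lscale_zero)

lemma lbr_summand:
  assumes L: "lie_algebra L" and z: "z \<in> lcarrier (lie_power n L)" and u: "u \<in> lcarrier L"
  shows "lbr (lie_power n L) z (summand j u) = summand j (lbr L (z j) u)"
  using lie_br_zero[OF L lie_power_comp[OF L z]] by (auto simp: summand_def fun_eq_iff lie_power_simps)

lemma sum_summand: 
  assumes "finite J" "\<And>j. j \<notin> J \<Longrightarrow> z j = 0"
  shows "(\<Sum>j\<in>J. summand j (z j)) = (z :: nat \<Rightarrow> 'g::ab_group_add)"
proof
  fix k
  have "(\<Sum>j\<in>J. summand j (z j)) k = (\<Sum>j\<in>J. summand j (z j) k)"
    by (induction J rule: infinite_finite_induct) auto
  also have "\<dots> = (\<Sum>j\<in>J. if j = k then z k else 0)"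
    by (rule sum.cong[OF refl]) (auto simp: summand_def)
  finally show "(\<Sum>j\<in>J. summand j (z j)) k = z k" using assms by simp
qed

lemma lie_power_algebra:
  assumes L: "lie_algebra (L :: ('k::field, 'g::ab_group_add) lie_alg)" shows "lie_algebra (lie_power n L)"
proof -
  interpret V: vector_space "lscale L" by (rule lie_algebra_module[OF L])
  obtain B where B: "finite B" "lcarrier L = V.span B" using lie_algebra_span[OF L] by blast
  let ?s = "lscale (lie_power n L)" 
  have vs: "vector_space ?s"
    by standard (auto simp: lie_power_simps fun_eq_iff V.scale_right_distrib V.scale_left_distrib)
  interpret W: vector_space ?s by (rule vs)
  let ?B = "\<Union>j\<in>{1..n}. summand j ` B"
  have hom: "summand j u \<in> W.span ?B" if j: "j \<in> {1..n}" and u: "u \<in> V.span B" for j u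
    using u
  proof (induction rule: V.span_induct_alt)
    case base
    show ?case unfolding summand_simps by (rule W.span_zero)
  next
    case (step c x y)
    have "summand j x \<in> W.span ?B" using step(1) j by (intro W.span_base) blast
    then show ?case
      unfolding summand_add summand_scale[OF L, of j c x n] using step(2)
      by (intro W.span_add W.span_scale)
  qed
  have sub: "W.subspace (lcarrier (lie_power n L))"
    unfolding W.subspace_def
    using lie_carrier[OF L] by (auto simp: lie_power_simps V.scale_zero_right)
  have "lcarrier (lie_power n L) = W.span ?B"
  proof
    show "lcarrier (lie_power n L) \<subseteq> W.span ?B"
    proof
      fix z assume z: "z \<in> lcarrier (lie_power n L)"
      have "(\<Sum>j\<in>{1..n}. summand j (z j)) \<in> W.span ?B"
        using z unfolding lie_power_simps(3) B(2) by (intro W.span_sum hom) auto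
      then show "z \<in> W.span ?B" using sum_summand[of "{1..n}" z] z unfolding lie_power_simps(3) by simp
    qed
    have "?B \<subseteq> lcarrier (lie_power n L)"
      using summand_carrier[OF L] V.span_base[of _ B] B(2) by auto
    then show "W.span ?B \<subseteq> lcarrier (lie_power n L)" using sub by (rule W.span_minimal)
  qed
  moreover have "finite ?B" using B(1) by simp
  ultimately have "\<exists>B. finite B \<and> lcarrier (lie_power n L) = W.span B" by blast
  note span = this and comp = lie_power_comp[OF L]
  show ?thesis
    unfolding lie_algebra_def
  proof (intro conjI ballI allI)
    show "vector_space ?s" by (rule vs)
    show "\<exists>B. finite B \<and> lcarrier (lie_power n L) = W.span B" by (rule span)
  next
    fix u v assume u: "u \<in> lcarrier (lie_power n L)" and v: "v \<in> lcarrier (lie_power n L)"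
    show "lbr (lie_power n L) u v \<in> lcarrier (lie_power n L)"
      using u v lie_br_closed[OF L] lie_br_zero(1)[OF L lie_carrier(1)[OF L]] by (simp add: lie_power_simps)
    fix w assume w: "w \<in> lcarrier (lie_power n L)"
    show "lbr (lie_power n L) (u + v) w = lbr (lie_power n L) u w + lbr (lie_power n L) v w"
      "lbr (lie_power n L) w (u + v) = lbr (lie_power n L) w u + lbr (lie_power n L) w v"
      by (simp_all add: fun_eq_iff lie_power_simps(2) lie_br_add[OF L comp[OF u] comp[OF v] comp[OF w]])
    show "lbr (lie_power n L) u (lbr (lie_power n L) v w) + lbr (lie_power n L) v (lbr (lie_power n L) w u)
        + lbr (lie_power n L) w (lbr (lie_power n L) u v) = 0"
      by (simp add: fun_eq_iff lie_power_simps(2) lie_jacobi[OF L comp[OF u] comp[OF v] comp[OF w]])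
  next
    fix c u v assume u: "u \<in> lcarrier (lie_power n L)" and v: "v \<in> lcarrier (lie_power n L)"
    show "lbr (lie_power n L) (?s c u) v = ?s c (lbr (lie_power n L) u v)"
      "lbr (lie_power n L) u (?s c v) = ?s c (lbr (lie_power n L) u v)"
      by (simp_all add: fun_eq_iff lie_power_simps(1,2) lie_br_scale[OF L comp[OF u] comp[OF v]])
  next
    fix u assume u: "u \<in> lcarrier (lie_power n L)"
    show "lbr (lie_power n L) u u = 0"
      by (simp add: fun_eq_iff lie_power_simps(2) lie_br_self[OF L comp[OF u]])
  qed
qed

section \<open>The classical Yang-Baxter equation\<close>

text \<open>The left-hand side of the classical Yang-Baxter equation with independent tensors in the positions
  \<open>12\<close>, \<open>13\<close> and \<open>23\<close>.  The components of the equation for a tensor on a direct power have this form,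
  with three of its blocks.\<close>

definition cyb :: "('k::field, 'g) lie_alg \<Rightarrow> ('k, 'g) tens2 \<Rightarrow> ('k, 'g) tens2 \<Rightarrow> ('k, 'g) tens2 \<Rightarrow>
    ('g \<Rightarrow> 'k) \<Rightarrow> ('g \<Rightarrow> 'k) \<Rightarrow> ('g \<Rightarrow> 'k) \<Rightarrow> 'k" where
  "cyb L a b c \<xi> \<eta> \<zeta> = a (\<lambda>u. b (\<lambda>v. \<xi> (lbr L u v)) \<zeta>) \<eta> + a \<xi> (\<lambda>u. c (\<lambda>v. \<eta> (lbr L u v)) \<zeta>)
     + b \<xi> (\<lambda>u. c \<eta> (\<lambda>v. \<zeta> (lbr L u v)))"

definition ad_invariant :: "('k::field, 'g::ab_group_add) lie_alg \<Rightarrow> ('k, 'g) tens2 \<Rightarrow> bool" where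
  "ad_invariant L s \<longleftrightarrow> (\<forall>x\<in>lcarrier L. \<forall>\<xi>\<in>lie_dual L. \<forall>\<eta>\<in>lie_dual L. tens_ad L x s \<xi> \<eta> = 0)"

lemma quasitriangular_iff:
  fixes L :: "('k::field_char_0, 'g::ab_group_add) lie_alg"
  shows "quasitriangular L r \<longleftrightarrow> r \<in> tens_square L \<and> ad_invariant L (r + tens_flip r) \<and>
     (\<forall>\<xi>\<in>lie_dual L. \<forall>\<eta>\<in>lie_dual L. \<forall>\<zeta>\<in>lie_dual L. cyb L r r r \<xi> \<eta> \<zeta> = 0)"
proof -
  have *: "tens_ad L x (sym_part r) \<xi> \<eta> = tens_ad L x (r + tens_flip r) \<xi> \<eta> / 2" for x \<xi> \<eta>
    by (simp add: tens_ad_def sym_part_def add_divide_distrib)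
  show ?thesis
    unfolding quasitriangular_def ad_invariant_def cyb_def br12_13_def br12_23_def br13_23_def * by simp
qed

lemma ad_invariantD:
  assumes "ad_invariant L s" "x \<in> lcarrier L" "\<xi> \<in> lie_dual L" "\<eta> \<in> lie_dual L"
  shows "s (\<lambda>u. \<xi> (lbr L x u)) \<eta> = - s \<xi> (\<lambda>u. \<eta> (lbr L x u))"
proof -
  have "tens_ad L x s \<xi> \<eta> = 0" using assms unfolding ad_invariant_def by blast
  then show ?thesis by (simp add: tens_ad_def eq_neg_iff_add_eq_0)
qed

text \<open>An argument of the Yang-Baxter expression occurs in two of the three brackets.  If these combine to
  the action of elements of the Lie algebra on an invariant tensor \<open>s\<close>, that tensor can be added to the
  argument.  Here both brackets act by the first leg of \<open>b\<close>.\<close>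

lemma cyb_first:
  assumes L: "lie_algebra L" and s: "s \<in> tens_square L" "ad_invariant L s"
    and b: "b \<in> tens_square L" and \<xi>: "\<xi> \<in> lie_dual L" and \<eta>: "\<eta> \<in> lie_dual L"
  shows "cyb L (a + s) b b \<xi> \<eta> \<zeta> = cyb L a b b \<xi> \<eta> \<zeta>"
proof -
  obtain N :: nat and c p q where b': "\<And>i. i < N \<Longrightarrow> p i \<in> lcarrier L" "\<And>i. i < N \<Longrightarrow> q i \<in> lcarrier L"
    "\<And>\<xi> \<eta>. b \<xi> \<eta> = (\<Sum>i<N. c i * (\<xi> (p i) * \<eta> (q i)))"
    by (rule tens_square_repr[OF b], rule that)
  have l: "s (\<lambda>u. b (\<lambda>v. \<xi> (lbr L u v)) \<zeta>) \<eta> = (\<Sum>i<N. c i * \<zeta> (q i) * s (\<lambda>u. \<xi> (lbr L u (p i))) \<eta>)"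
    unfolding b'(3) tens_square_sum_left[OF s(1), symmetric] by (simp add: mult_ac)
  have r: "s \<xi> (\<lambda>u. b (\<lambda>v. \<eta> (lbr L u v)) \<zeta>) = (\<Sum>i<N. c i * \<zeta> (q i) * s \<xi> (\<lambda>u. \<eta> (lbr L u (p i))))"
    unfolding b'(3) tens_square_sum_right[OF s(1), symmetric] by (simp add: mult_ac)
  have "s (\<lambda>u. \<xi> (lbr L u x)) \<eta> = - s \<xi> (\<lambda>u. \<eta> (lbr L u x))" if x: "x \<in> lcarrier L" for x
  proof -
    have "s (\<lambda>u. \<xi> (lbr L u x)) \<eta> = s (\<lambda>u. - \<xi> (lbr L x u)) \<eta>"
      by (rule tens_square_cong[OF s(1)]) (simp_all add: lie_dual_br_skew[OF L \<xi> _ x])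
    moreover have "s \<xi> (\<lambda>u. \<eta> (lbr L u x)) = s \<xi> (\<lambda>u. - \<eta> (lbr L x u))"
      by (rule tens_square_cong[OF s(1)]) (simp_all add: lie_dual_br_skew[OF L \<eta> _ x])
    ultimately show ?thesis
      using ad_invariantD[OF s(2) x \<xi> \<eta>] by (simp add: tens_square_linear[OF s(1)])
  qed
  then have "s (\<lambda>u. b (\<lambda>v. \<xi> (lbr L u v)) \<zeta>) \<eta> = - s \<xi> (\<lambda>u. b (\<lambda>v. \<eta> (lbr L u v)) \<zeta>)"
    unfolding l r sum_negf[symmetric] by (intro sum.cong[OF refl]) (simp add: b'(1))
  then show ?thesis by (simp add: cyb_def)
qed

text \<open>Here both brackets act by the second leg of \<open>a\<close>.\<close>

lemma cyb_third:
  assumes s: "ad_invariant L s" and a: "a \<in> tens_square L" and \<eta>: "\<eta> \<in> lie_dual L" and \<zeta>: "\<zeta> \<in> lie_dual L"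
  shows "cyb L a a (c + s) \<xi> \<eta> \<zeta> = cyb L a a c \<xi> \<eta> \<zeta>"
proof -
  have "a \<xi> (\<lambda>u. s (\<lambda>v. \<eta> (lbr L u v)) \<zeta>) = a \<xi> (\<lambda>u. - s \<eta> (\<lambda>v. \<zeta> (lbr L u v)))"
    by (rule tens_square_cong[OF a refl ad_invariantD[OF s _ \<eta> \<zeta>]])
  then show ?thesis by (simp add: cyb_def tens_square_linear[OF a])
qed

text \<open>The two brackets act on different legs of \<open>s\<close>; the third tensor has to be the negative flip of the
  first for the acting elements to match.\<close>

lemma cyb_second:
  assumes L: "lie_algebra L" and s: "s \<in> tens_square L" "ad_invariant L s"
    and a: "a \<in> tens_square L" and \<xi>: "\<xi> \<in> lie_dual L" and \<zeta>: "\<zeta> \<in> lie_dual L"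
  shows "cyb L a (b + s) (- tens_flip a) \<xi> \<eta> \<zeta> = cyb L a b (- tens_flip a) \<xi> \<eta> \<zeta>"
proof -
  obtain N :: nat and c p q where a': "\<And>i. i < N \<Longrightarrow> p i \<in> lcarrier L" "\<And>i. i < N \<Longrightarrow> q i \<in> lcarrier L"
    "\<And>\<xi> \<eta>. a \<xi> \<eta> = (\<Sum>i<N. c i * (\<xi> (p i) * \<eta> (q i)))"
    by (rule tens_square_repr[OF a], rule that)
  have l: "a (\<lambda>u. s (\<lambda>v. \<xi> (lbr L u v)) \<zeta>) \<eta> = (\<Sum>i<N. c i * \<eta> (q i) * s (\<lambda>v. \<xi> (lbr L (p i) v)) \<zeta>)"
    unfolding a'(3) by (simp add: mult_ac)
  have "s \<xi> (\<lambda>u. (- tens_flip a) \<eta> (\<lambda>v. \<zeta> (lbr L u v))) = s \<xi> (\<lambda>u. - a (\<lambda>v. \<zeta> (lbr L u v)) \<eta>)"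
    by (simp add: tens_flip_def)
  also have "\<dots> = s \<xi> (\<lambda>u. a (\<lambda>v. \<zeta> (lbr L v u)) \<eta>)"
  proof (rule tens_square_cong[OF s(1) refl])
    fix u assume u: "u \<in> lcarrier L"
    have "a (\<lambda>v. \<zeta> (lbr L u v)) \<eta> = a (\<lambda>v. - \<zeta> (lbr L v u)) \<eta>"
      by (rule tens_square_cong[OF a]) (simp_all add: lie_dual_br_skew[OF L \<zeta> u])
    then show "- a (\<lambda>v. \<zeta> (lbr L u v)) \<eta> = a (\<lambda>v. \<zeta> (lbr L v u)) \<eta>"
      by (simp add: tens_square_linear[OF a])
  qed
  also have "\<dots> = (\<Sum>i<N. c i * \<eta> (q i) * s \<xi> (\<lambda>u. \<zeta> (lbr L (p i) u)))"
    unfolding a'(3) tens_square_sum_right[OF s(1), symmetric] by (simp add: mult_ac)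
  also have "\<dots> = - a (\<lambda>u. s (\<lambda>v. \<xi> (lbr L u v)) \<zeta>) \<eta>"
    unfolding l sum_negf[symmetric]
    by (intro sum.cong[OF refl]) (simp add: ad_invariantD[OF s(2) a'(1) \<xi> \<zeta>])
  finally have *: "s \<xi> (\<lambda>u. (- tens_flip a) \<eta> (\<lambda>v. \<zeta> (lbr L u v))) = - a (\<lambda>u. s (\<lambda>v. \<xi> (lbr L u v)) \<zeta>) \<eta>" .
  have "a (\<lambda>u. (b + s) (\<lambda>v. \<xi> (lbr L u v)) \<zeta>) \<eta> =
      a (\<lambda>u. b (\<lambda>v. \<xi> (lbr L u v)) \<zeta>) \<eta> + a (\<lambda>u. s (\<lambda>v. \<xi> (lbr L u v)) \<zeta>) \<eta>"
    by (simp add: tens_square_linear[OF a])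
  then show ?thesis using * by (simp add: cyb_def)
qed

definition signed_r :: "bool \<Rightarrow> ('k::field, 'g) tens2 \<Rightarrow> ('k, 'g) tens2" where
  "signed_r \<sigma> r = (if \<sigma> then r else - tens_flip r)"

lemma signed_r_in_square: "r \<in> tens_square L \<Longrightarrow> signed_r \<sigma> r \<in> tens_square L"
  unfolding signed_r_def by (simp add: tens_square_uminus tens_flip_in_square)

text \<open>Starting from three copies of \<open>r\<close>, the preceding lemmas exchange \<open>r\<close> for
  \<open>- r\<^sup>2\<^sup>1 = r - (r + r\<^sup>2\<^sup>1)\<close> one position at a time.  The conditions under which they apply keep
  two of the eight sign patterns out of reach.\<close>

lemma cyb_signed:
  fixes L :: "('k::field_char_0, 'g::ab_group_add) lie_alg"
  assumes L: "lie_algebra L" and r: "quasitriangular L r"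
    and \<xi>: "\<xi> \<in> lie_dual L" and \<eta>: "\<eta> \<in> lie_dual L" and \<zeta>: "\<zeta> \<in> lie_dual L"
    and \<sigma>: "\<not> (\<sigma>1 = \<sigma>3 \<and> \<sigma>2 \<noteq> \<sigma>1)"
  shows "cyb L (signed_r \<sigma>1 r) (signed_r \<sigma>2 r) (signed_r \<sigma>3 r) \<xi> \<eta> \<zeta> = 0"
proof -
  define s where "s = r + tens_flip r"
  define m where "m = - tens_flip r"
  have rs: "r \<in> tens_square L" and inv: "ad_invariant L s" and cyb: "cyb L r r r \<xi> \<eta> \<zeta> = 0"
    using r \<xi> \<eta> \<zeta> unfolding quasitriangular_iff s_def by auto
  have s: "s \<in> tens_square L" unfolding s_def by (rule tens_square_add[OF rs tens_flip_in_square[OF rs]])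
  have m: "m \<in> tens_square L" unfolding m_def by (rule tens_square_uminus[OF tens_flip_in_square[OF rs]])
  have rm: "m + s = r" by (simp add: m_def s_def)
  have mr: "- tens_flip m = r" by (simp add: m_def tens_flip_def fun_eq_iff)
  have FTT: "cyb L m r r \<xi> \<eta> \<zeta> = 0" using cyb_first[OF L s inv rs \<xi> \<eta>, of m \<zeta>] cyb rm by simp
  have TTF: "cyb L r r m \<xi> \<eta> \<zeta> = 0" using cyb_third[OF inv rs \<eta> \<zeta>, of m \<xi>] cyb rm by simp
  have FFT: "cyb L m m r \<xi> \<eta> \<zeta> = 0" using cyb_second[OF L s inv m \<xi> \<zeta>, of m \<eta>] FTT rm mr by simp
  have TFF: "cyb L r m m \<xi> \<eta> \<zeta> = 0"
    using cyb_second[OF L s inv rs \<xi> \<zeta>, of m \<eta>] TTF rm by (simp add: m_def[symmetric])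
  have FFF: "cyb L m m m \<xi> \<eta> \<zeta> = 0" using cyb_third[OF inv m \<eta> \<zeta>, of m \<xi>] FFT rm by simp
  show ?thesis using cyb FTT TTF FFT TFF FFF \<sigma> unfolding signed_r_def m_def[symmetric]
    by (cases \<sigma>1; cases \<sigma>2; cases \<sigma>3) simp_all
qed

text \<open>Modulo the symmetric part \<open>s = r + r\<^sup>2\<^sup>1\<close>, the tensor \<open>r\<close> is skew, and the three brackets of the
  Yang-Baxter equation are the cyclic permutations of \<open>[r\<^sub>1\<^sub>2, r\<^sub>2\<^sub>3]\<close>.  The correction terms combine, by
  invariance of \<open>s\<close>, to \<open>[s\<^sub>1\<^sub>3, s\<^sub>2\<^sub>3]\<close>.\<close>

lemma cyclic_br12_23:
  fixes L :: "('k::field_char_0, 'g::ab_group_add) lie_alg"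
  assumes L: "lie_algebra L" and r: "quasitriangular L r"
    and \<xi>: "\<xi> \<in> lie_dual L" and \<eta>: "\<eta> \<in> lie_dual L" and \<zeta>: "\<zeta> \<in> lie_dual L"
  shows "br12_23 L r \<xi> \<eta> \<zeta> + br12_23 L r \<eta> \<zeta> \<xi> + br12_23 L r \<zeta> \<xi> \<eta> = - br13_23 L (r + tens_flip r) \<xi> \<eta> \<zeta>"
proof -
  define s where "s = r + tens_flip r"
  have rs: "r \<in> tens_square L" and inv: "ad_invariant L s" and cyb: "cyb L r r r \<xi> \<eta> \<zeta> = 0"
    using r \<xi> \<eta> \<zeta> unfolding quasitriangular_iff s_def by auto
  have s: "s \<in> tens_square L" unfolding s_def by (rule tens_square_add[OF rs tens_flip_in_square[OF rs]])
  have s_eq: "s \<alpha> \<beta> = r \<alpha> \<beta> + r \<beta> \<alpha>" for \<alpha> \<beta> by (simp add: s_def tens_flip_def)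
  obtain N :: nat and c a b where r': "\<And>i. i < N \<Longrightarrow> a i \<in> lcarrier L" "\<And>i. i < N \<Longrightarrow> b i \<in> lcarrier L"
    "\<And>\<xi> \<eta>. r \<xi> \<eta> = (\<Sum>i<N. c i * (\<xi> (a i) * \<eta> (b i)))"
    by (rule tens_square_repr[OF rs], rule that)
  \<comment> \<open>Exchanging the two copies of \<open>r\<close> reverses the bracket.\<close>
  have J: "r (\<lambda>u. r \<beta> (\<lambda>v. \<alpha> (lbr L u v))) \<gamma> = - br12_23 L r \<beta> \<alpha> \<gamma>"
    if \<alpha>: "\<alpha> \<in> lie_dual L" for \<alpha> \<beta> \<gamma>
  proof -
    have "r (\<lambda>u. r \<beta> (\<lambda>v. \<alpha> (lbr L u v))) \<gamma> =
        (\<Sum>k<N. \<Sum>i<N. c k * (c i * (\<beta> (a i) * \<alpha> (lbr L (a k) (b i)) * \<gamma> (b k))))"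
      unfolding r'(3) by (simp add: sum_distrib_left sum_distrib_right mult_ac)
    also have "\<dots> = (\<Sum>i<N. \<Sum>k<N. - (c i * (c k * (\<beta> (a i) * \<alpha> (lbr L (b i) (a k)) * \<gamma> (b k)))))"
    proof (subst sum.swap, intro sum.cong[OF refl])
      fix i k assume "i \<in> {..<N}" "k \<in> {..<N}"
      then have "\<alpha> (lbr L (a k) (b i)) = - \<alpha> (lbr L (b i) (a k))"
        using lie_dual_br_skew[OF L \<alpha> r'(1)[of k] r'(2)[of i]] by simp
      then show "c k * (c i * (\<beta> (a i) * \<alpha> (lbr L (a k) (b i)) * \<gamma> (b k))) =
          - (c i * (c k * (\<beta> (a i) * \<alpha> (lbr L (b i) (a k)) * \<gamma> (b k))))" by simp
    qed
    also have "\<dots> = - br12_23 L r \<beta> \<alpha> \<gamma>"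
      unfolding br12_23_def r'(3) by (simp add: sum_distrib_left sum_distrib_right sum_negf mult_ac)
    finally show ?thesis .
  qed
  have "r (\<lambda>u. r (\<lambda>v. \<xi> (lbr L u v)) \<zeta>) \<eta> = r (\<lambda>u. s (\<lambda>v. \<xi> (lbr L u v)) \<zeta> + - r \<zeta> (\<lambda>v. \<xi> (lbr L u v))) \<eta>"
    by (simp add: s_eq)
  also have "\<dots> = r (\<lambda>u. s (\<lambda>v. \<xi> (lbr L u v)) \<zeta>) \<eta> + br12_23 L r \<zeta> \<xi> \<eta>"
    unfolding tens_square_linear(5)[OF rs] tens_square_linear(1)[OF rs] J[OF \<xi>] by simp
  also have "r (\<lambda>u. s (\<lambda>v. \<xi> (lbr L u v)) \<zeta>) \<eta> = r (\<lambda>u. s \<xi> (\<lambda>v. - \<zeta> (lbr L u v))) \<eta>"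
    by (rule tens_square_cong[OF rs]) (simp_all add: ad_invariantD[OF inv _ \<xi> \<zeta>] tens_square_linear[OF s])
  also have "\<dots> = r (\<lambda>u. s \<xi> (\<lambda>v. \<zeta> (lbr L v u))) \<eta>"
  proof (rule tens_square_cong[OF rs _ refl], rule tens_square_cong[OF s refl])
    show "- \<zeta> (lbr L u v) = \<zeta> (lbr L v u)" if "u \<in> lcarrier L" "v \<in> lcarrier L" for u v
      by (rule lie_dual_br_skew[OF L \<zeta> that(2,1), symmetric])
  qed
  also have "\<dots> = s \<xi> (\<lambda>v. r (\<lambda>u. \<zeta> (lbr L v u)) \<eta>)"
  proof -
    have "s \<xi> (\<lambda>v. r (\<lambda>u. \<zeta> (lbr L v u)) \<eta>) = s \<xi> (\<lambda>v. \<Sum>i<N. (c i * \<eta> (b i)) * \<zeta> (lbr L v (a i)))"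
      unfolding r'(3) by (simp add: mult_ac)
    also have "\<dots> = (\<Sum>i<N. (c i * \<eta> (b i)) * s \<xi> (\<lambda>v. \<zeta> (lbr L v (a i))))"
      by (rule tens_square_sum_right[OF s])
    also have "\<dots> = r (\<lambda>u. s \<xi> (\<lambda>v. \<zeta> (lbr L v u))) \<eta>"
      unfolding r'(3) by (simp add: mult_ac)
    finally show ?thesis by simp
  qed
  finally have 1: "r (\<lambda>u. r (\<lambda>v. \<xi> (lbr L u v)) \<zeta>) \<eta> = s \<xi> (\<lambda>v. r (\<lambda>u. \<zeta> (lbr L v u)) \<eta>) + br12_23 L r \<zeta> \<xi> \<eta>" .
  have 2: "r \<xi> (\<lambda>u. r \<eta> (\<lambda>v. \<zeta> (lbr L u v))) = s \<xi> (\<lambda>u. r \<eta> (\<lambda>v. \<zeta> (lbr L u v))) + br12_23 L r \<eta> \<zeta> \<xi>"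
    unfolding s_eq J[OF \<zeta>] by simp
  have 3: "br13_23 L s \<xi> \<eta> \<zeta> = s \<xi> (\<lambda>u. r \<eta> (\<lambda>v. \<zeta> (lbr L u v))) + s \<xi> (\<lambda>v. r (\<lambda>u. \<zeta> (lbr L v u)) \<eta>)"
    unfolding br13_23_def s_eq[of \<eta>] by (rule tens_square_linear(6)[OF s])
  have "0 = r (\<lambda>u. r (\<lambda>v. \<xi> (lbr L u v)) \<zeta>) \<eta> + br12_23 L r \<xi> \<eta> \<zeta> + r \<xi> (\<lambda>u. r \<eta> (\<lambda>v. \<zeta> (lbr L u v)))"
    using cyb by (simp add: cyb_def br12_23_def)
  then have "br12_23 L r \<xi> \<eta> \<zeta> + br12_23 L r \<eta> \<zeta> \<xi> + br12_23 L r \<zeta> \<xi> \<eta> + br13_23 L s \<xi> \<eta> \<zeta> = 0"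
    unfolding 1 2 3 by (simp add: add_ac)
  then show ?thesis unfolding s_def[symmetric] by (simp add: eq_neg_iff_add_eq_0)
qed

section \<open>Block tensors on a direct power\<close>

definition slot :: "nat \<Rightarrow> ((nat \<Rightarrow> 'g::zero) \<Rightarrow> 'k) \<Rightarrow> 'g \<Rightarrow> 'k" where
  "slot j \<xi> = (\<lambda>u. \<xi> (summand j u))"

definition block_tensor :: "nat \<Rightarrow> (nat \<Rightarrow> nat \<Rightarrow> ('k::field, 'g::zero) tens2) \<Rightarrow> ('k, nat \<Rightarrow> 'g) tens2" where
  "block_tensor n \<rho> = (\<lambda>\<xi> \<eta>. \<Sum>j\<in>{1..n}. \<Sum>k\<in>{1..n}. \<rho> j k (slot j \<xi>) (slot k \<eta>))"

lemma slot_dual: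
  assumes "lie_algebra L" "\<xi> \<in> lie_dual (lie_power n L)" "j \<in> {1..n}" shows "slot j \<xi> \<in> lie_dual L"
  unfolding lie_dual_def slot_def
  using lie_dual_add[OF assms(2)] lie_dual_scale[OF assms(2)] summand_carrier[OF assms(1,3)]
    summand_scale[OF assms(1), where n = n]
  by (auto simp: summand_add)

lemma block_tensor_in_square:
  assumes L: "lie_algebra L" and \<rho>: "\<forall>j\<in>{1..n}. \<forall>k\<in>{1..n}. \<rho> j k \<in> tens_square L"
  shows "block_tensor n \<rho> \<in> tens_square (lie_power n L)"
proof -
  have "(\<lambda>\<xi> \<eta>. \<rho> j k (slot j \<xi>) (slot k \<eta>)) \<in> tens_square (lie_power n L)"
    if jk: "j \<in> {1..n}" "k \<in> {1..n}" for j k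
  proof -
    obtain N :: nat and c a b where R: "\<And>i. i < N \<Longrightarrow> a i \<in> lcarrier L" "\<And>i. i < N \<Longrightarrow> b i \<in> lcarrier L"
      "\<And>\<xi> \<eta>. \<rho> j k \<xi> \<eta> = (\<Sum>i<N. c i * (\<xi> (a i) * \<eta> (b i)))"
      by (rule tens_square_repr[OF \<rho>[rule_format, OF jk]], rule that)
    have "(\<lambda>\<xi> \<eta>. \<rho> j k (slot j \<xi>) (slot k \<eta>)) = (\<Sum>i<N. (\<lambda>\<xi> \<eta>. c i * (summand j (a i) \<otimes> summand k (b i)) \<xi> \<eta>))"
      by (simp add: fun_eq_iff sum_apply2 R(3) tens_def slot_def)
    also have "\<dots> \<in> tens_square (lie_power n L)"
      using R(1,2) summand_carrier[OF L jk(1)] summand_carrier[OF L jk(2)] unfolding tens_square_def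
      by (intro module.span_sum[OF tens_module] module.span_scale[OF tens_module] module.span_base[OF tens_module]) blast
    finally show ?thesis .
  qed
  then have "(\<Sum>j\<in>{1..n}. \<Sum>k\<in>{1..n}. (\<lambda>\<xi> \<eta>. \<rho> j k (slot j \<xi>) (slot k \<eta>))) \<in> tens_square (lie_power n L)"
    by (intro tens_square_sum)
  also have "(\<Sum>j\<in>{1..n}. \<Sum>k\<in>{1..n}. (\<lambda>\<xi> \<eta>. \<rho> j k (slot j \<xi>) (slot k \<eta>))) = block_tensor n \<rho>"
    by (simp add: block_tensor_def fun_eq_iff sum_apply2)
  finally show ?thesis .
qed

lemma slot_ad:
  assumes L: "lie_algebra L" and z: "z \<in> lcarrier (lie_power n L)" and u: "u \<in> lcarrier L"
  shows "slot m (\<lambda>w. \<xi> (lbr (lie_power n L) z w)) u = slot m \<xi> (lbr L (z m) u)"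
  unfolding slot_def lbr_summand[OF L z u] by (rule refl)

lemma block_tensor_ad:
  assumes L: "lie_algebra L" and \<rho>: "\<forall>j\<in>{1..n}. \<forall>k\<in>{1..n}. \<rho> j k \<in> tens_square L"
    and z: "z \<in> lcarrier (lie_power n L)"
  shows "block_tensor n \<rho> (\<lambda>w. \<xi> (lbr (lie_power n L) z w)) \<eta> =
      (\<Sum>j\<in>{1..n}. \<Sum>k\<in>{1..n}. \<rho> j k (\<lambda>u. slot j \<xi> (lbr L (z j) u)) (slot k \<eta>))"
    and "block_tensor n \<rho> \<xi> (\<lambda>w. \<eta> (lbr (lie_power n L) z w)) =
      (\<Sum>j\<in>{1..n}. \<Sum>k\<in>{1..n}. \<rho> j k (slot j \<xi>) (\<lambda>u. slot k \<eta> (lbr L (z k) u)))"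
  unfolding block_tensor_def
  by (intro sum.cong[OF refl] tens_square_cong[OF \<rho>[rule_format]] slot_ad[OF L z] refl; assumption)+

text \<open>When the acting element sits in a single summand, one of the two sums over slots collapses.\<close>

lemma block_tensor_ad_summand:
  assumes L: "lie_algebra L" and \<rho>: "\<forall>j\<in>{1..n}. \<forall>k\<in>{1..n}. \<rho> j k \<in> tens_square L"
    and m: "m \<in> {1..n}" and u: "u \<in> lcarrier L" and \<xi>: "\<xi> \<in> lie_dual (lie_power n L)"
  shows "block_tensor n \<rho> (\<lambda>w. \<xi> (lbr (lie_power n L) (summand m u) w)) \<eta> =
      (\<Sum>k\<in>{1..n}. \<rho> m k (\<lambda>v. slot m \<xi> (lbr L u v)) (slot k \<eta>))"
    and "block_tensor n \<rho> \<eta> (\<lambda>w. \<xi> (lbr (lie_power n L) (summand m u) w)) =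
      (\<Sum>j\<in>{1..n}. \<rho> j m (slot j \<eta>) (\<lambda>v. slot m \<xi> (lbr L u v)))"
proof -
  have z: "summand m u \<in> lcarrier (lie_power n L)" by (rule summand_carrier[OF L m u])
  have zero: "slot j \<xi> (lbr L (summand m u j) v) = 0" if "j \<in> {1..n}" "j \<noteq> m" "v \<in> lcarrier L" for j v
    using lie_dual_zero[OF L slot_dual[OF L \<xi> that(1)]] lie_br_zero(1)[OF L that(3)] that(2)
    by (simp add: summand_simps)
  have 1: "\<rho> j k (\<lambda>v. slot j \<xi> (lbr L (summand m u j) v)) (slot k \<eta>) =
      (if j = m then \<rho> m k (\<lambda>v. slot m \<xi> (lbr L u v)) (slot k \<eta>) else 0)" if jk: "j \<in> {1..n}" "k \<in> {1..n}" for j k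
  proof (cases "j = m")
    case False
    have "\<rho> j k (\<lambda>v. slot j \<xi> (lbr L (summand m u j) v)) (slot k \<eta>) = \<rho> j k (\<lambda>v. 0) (slot k \<eta>)"
      by (rule tens_square_cong[OF \<rho>[rule_format, OF jk] zero[OF jk(1) False] refl])
    then show ?thesis using False by (simp add: tens_square_linear[OF \<rho>[rule_format, OF jk]])
  qed (simp add: summand_simps)
  have 2: "\<rho> k j (slot k \<eta>) (\<lambda>v. slot j \<xi> (lbr L (summand m u j) v)) =
      (if j = m then \<rho> k m (slot k \<eta>) (\<lambda>v. slot m \<xi> (lbr L u v)) else 0)" if jk: "j \<in> {1..n}" "k \<in> {1..n}" for j k
  proof (cases "j = m")
    case False
    have "\<rho> k j (slot k \<eta>) (\<lambda>v. slot j \<xi> (lbr L (summand m u j) v)) = \<rho> k j (slot k \<eta>) (\<lambda>v. 0)"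
      by (rule tens_square_cong[OF \<rho>[rule_format, OF jk(2,1)] refl zero[OF jk(1) False]])
    then show ?thesis using False by (simp add: tens_square_linear[OF \<rho>[rule_format, OF jk(2,1)]])
  qed (simp add: summand_simps)
  have "block_tensor n \<rho> (\<lambda>w. \<xi> (lbr (lie_power n L) (summand m u) w)) \<eta> =
      (\<Sum>j\<in>{1..n}. \<Sum>k\<in>{1..n}. if j = m then \<rho> m k (\<lambda>v. slot m \<xi> (lbr L u v)) (slot k \<eta>) else 0)"
    unfolding block_tensor_ad(1)[OF L \<rho> z] by (intro sum.cong[OF refl] 1)
  also have "\<dots> = (\<Sum>k\<in>{1..n}. \<rho> m k (\<lambda>v. slot m \<xi> (lbr L u v)) (slot k \<eta>))"
    by (subst sum.swap) (use m in simp)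
  finally show "block_tensor n \<rho> (\<lambda>w. \<xi> (lbr (lie_power n L) (summand m u) w)) \<eta> =
      (\<Sum>k\<in>{1..n}. \<rho> m k (\<lambda>v. slot m \<xi> (lbr L u v)) (slot k \<eta>))" .
  have "block_tensor n \<rho> \<eta> (\<lambda>w. \<xi> (lbr (lie_power n L) (summand m u) w)) =
      (\<Sum>j\<in>{1..n}. \<Sum>k\<in>{1..n}. if k = m then \<rho> j m (slot j \<eta>) (\<lambda>v. slot m \<xi> (lbr L u v)) else 0)"
    unfolding block_tensor_ad(2)[OF L \<rho> z] by (intro sum.cong[OF refl] 2)
  also have "\<dots> = (\<Sum>j\<in>{1..n}. \<rho> j m (slot j \<eta>) (\<lambda>v. slot m \<xi> (lbr L u v)))"
    using m by simp
  finally show "block_tensor n \<rho> \<eta> (\<lambda>w. \<xi> (lbr (lie_power n L) (summand m u) w)) =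
      (\<Sum>j\<in>{1..n}. \<rho> j m (slot j \<eta>) (\<lambda>v. slot m \<xi> (lbr L u v)))" .
qed

lemma tens_square_plain_sum:
  assumes "T \<in> tens_square L"
  shows "T (\<lambda>u. \<Sum>s\<in>S. F s u) \<eta> = (\<Sum>s\<in>S. T (F s) \<eta>)" "T \<xi> (\<lambda>u. \<Sum>s\<in>S. F s u) = (\<Sum>s\<in>S. T \<xi> (F s))"
  using tens_square_sum_left[OF assms, of "\<lambda>_. 1" F S \<eta>] tens_square_sum_right[OF assms, of \<xi> "\<lambda>_. 1" F S] by simp_all

text \<open>A bracket of elements in different summands vanishes, which identifies the slots of the two factors
  of a bracket.\<close>

lemma cyb_block_tensor:
  assumes L: "lie_algebra L" and \<rho>: "\<forall>j\<in>{1..n}. \<forall>k\<in>{1..n}. \<rho> j k \<in> tens_square L"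
    and \<xi>: "\<xi> \<in> lie_dual (lie_power n L)" and \<eta>: "\<eta> \<in> lie_dual (lie_power n L)" and \<zeta>: "\<zeta> \<in> lie_dual (lie_power n L)"
  shows "cyb (lie_power n L) (block_tensor n \<rho>) (block_tensor n \<rho>) (block_tensor n \<rho>) \<xi> \<eta> \<zeta> =
    (\<Sum>j\<in>{1..n}. \<Sum>k\<in>{1..n}. \<Sum>m\<in>{1..n}. cyb L (\<rho> j k) (\<rho> j m) (\<rho> k m) (slot j \<xi>) (slot k \<eta>) (slot m \<zeta>))"
proof -
  let ?R = "block_tensor n \<rho>" and ?br = "lbr (lie_power n L)"
  have "?R (\<lambda>z. ?R (\<lambda>w. \<xi> (?br z w)) \<zeta>) \<eta> =
      (\<Sum>j\<in>{1..n}. \<Sum>k\<in>{1..n}. \<rho> j k (\<lambda>u. ?R (\<lambda>w. \<xi> (?br (summand j u) w)) \<zeta>) (slot k \<eta>))"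
    by (subst (1) block_tensor_def) (simp only: slot_def[of _ "\<lambda>z. ?R (\<lambda>w. \<xi> (?br z w)) \<zeta>"])
  also have "\<dots> = (\<Sum>j\<in>{1..n}. \<Sum>k\<in>{1..n}. \<Sum>m\<in>{1..n}. \<rho> j k (\<lambda>u. \<rho> j m (\<lambda>v. slot j \<xi> (lbr L u v)) (slot m \<zeta>)) (slot k \<eta>))"
    by (intro sum.cong[OF refl], subst tens_square_plain_sum(1)[OF \<rho>[rule_format], symmetric], assumption+)
       (intro tens_square_cong[OF \<rho>[rule_format]] block_tensor_ad_summand(1)[OF L \<rho>] \<xi> refl; assumption)
  finally have 1: "?R (\<lambda>z. ?R (\<lambda>w. \<xi> (?br z w)) \<zeta>) \<eta> =
    (\<Sum>j\<in>{1..n}. \<Sum>k\<in>{1..n}. \<Sum>m\<in>{1..n}. \<rho> j k (\<lambda>u. \<rho> j m (\<lambda>v. slot j \<xi> (lbr L u v)) (slot m \<zeta>)) (slot k \<eta>))" .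
  have "?R \<xi> (\<lambda>z. ?R (\<lambda>w. \<eta> (?br z w)) \<zeta>) =
      (\<Sum>j\<in>{1..n}. \<Sum>k\<in>{1..n}. \<rho> j k (slot j \<xi>) (\<lambda>u. ?R (\<lambda>w. \<eta> (?br (summand k u) w)) \<zeta>))"
    by (subst (1) block_tensor_def) (simp only: slot_def[of _ "\<lambda>z. ?R (\<lambda>w. \<eta> (?br z w)) \<zeta>"])
  also have "\<dots> = (\<Sum>j\<in>{1..n}. \<Sum>k\<in>{1..n}. \<Sum>m\<in>{1..n}. \<rho> j k (slot j \<xi>) (\<lambda>u. \<rho> k m (\<lambda>v. slot k \<eta> (lbr L u v)) (slot m \<zeta>)))"
    by (intro sum.cong[OF refl], subst tens_square_plain_sum(2)[OF \<rho>[rule_format], symmetric], assumption+)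
       (intro tens_square_cong[OF \<rho>[rule_format]] block_tensor_ad_summand(1)[OF L \<rho>] \<eta> refl; assumption)
  finally have 2: "?R \<xi> (\<lambda>z. ?R (\<lambda>w. \<eta> (?br z w)) \<zeta>) =
    (\<Sum>j\<in>{1..n}. \<Sum>k\<in>{1..n}. \<Sum>m\<in>{1..n}. \<rho> j k (slot j \<xi>) (\<lambda>u. \<rho> k m (\<lambda>v. slot k \<eta> (lbr L u v)) (slot m \<zeta>)))" .
  have "?R \<xi> (\<lambda>z. ?R \<eta> (\<lambda>w. \<zeta> (?br z w))) =
      (\<Sum>j\<in>{1..n}. \<Sum>m\<in>{1..n}. \<rho> j m (slot j \<xi>) (\<lambda>u. ?R \<eta> (\<lambda>w. \<zeta> (?br (summand m u) w))))"
    by (subst (1) block_tensor_def) (simp only: slot_def[of _ "\<lambda>z. ?R \<eta> (\<lambda>w. \<zeta> (?br z w))"])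
  also have "\<dots> = (\<Sum>j\<in>{1..n}. \<Sum>m\<in>{1..n}. \<Sum>k\<in>{1..n}. \<rho> j m (slot j \<xi>) (\<lambda>u. \<rho> k m (slot k \<eta>) (\<lambda>v. slot m \<zeta> (lbr L u v))))"
    by (intro sum.cong[OF refl], subst tens_square_plain_sum(2)[OF \<rho>[rule_format], symmetric], assumption+)
       (intro tens_square_cong[OF \<rho>[rule_format]] block_tensor_ad_summand(2)[OF L \<rho>] \<zeta> refl; assumption)
  also have "\<dots> = (\<Sum>j\<in>{1..n}. \<Sum>k\<in>{1..n}. \<Sum>m\<in>{1..n}. \<rho> j m (slot j \<xi>) (\<lambda>u. \<rho> k m (slot k \<eta>) (\<lambda>v. slot m \<zeta> (lbr L u v))))"
    by (rule sum.cong[OF refl], rule sum.swap)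
  finally have 3: "?R \<xi> (\<lambda>z. ?R \<eta> (\<lambda>w. \<zeta> (?br z w))) =
    (\<Sum>j\<in>{1..n}. \<Sum>k\<in>{1..n}. \<Sum>m\<in>{1..n}. \<rho> j m (slot j \<xi>) (\<lambda>u. \<rho> k m (slot k \<eta>) (\<lambda>v. slot m \<zeta> (lbr L u v))))" .
  show ?thesis unfolding cyb_def 1 2 3 by (simp only: sum.distrib)
qed

lemma block_tensor_symmetric_part:
  "block_tensor n \<rho> + tens_flip (block_tensor n \<rho>) = block_tensor n (\<lambda>j k. \<rho> j k + tens_flip (\<rho> k j))"
proof (intro ext)
  fix \<xi> \<eta>
  have "(\<Sum>j\<in>{1..n}. \<Sum>k\<in>{1..n}. \<rho> j k (slot j \<eta>) (slot k \<xi>)) = (\<Sum>k\<in>{1..n}. \<Sum>j\<in>{1..n}. \<rho> j k (slot j \<eta>) (slot k \<xi>))"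
    by (rule sum.swap)
  then show "(block_tensor n \<rho> + tens_flip (block_tensor n \<rho>)) \<xi> \<eta> =
      block_tensor n (\<lambda>j k. \<rho> j k + tens_flip (\<rho> k j)) \<xi> \<eta>"
    by (simp add: block_tensor_def tens_flip_def sum.distrib)
qed

lemma quasitriangular_block_tensor:
  fixes L :: "('k::field_char_0, 'g::ab_group_add) lie_alg"
  assumes L: "lie_algebra L" and \<rho>: "\<forall>j\<in>{1..n}. \<forall>k\<in>{1..n}. \<rho> j k \<in> tens_square L"
    and diag: "\<And>j. j \<in> {1..n} \<Longrightarrow> ad_invariant L (\<rho> j j + tens_flip (\<rho> j j))"
    and off: "\<And>j k. j \<in> {1..n} \<Longrightarrow> k \<in> {1..n} \<Longrightarrow> j \<noteq> k \<Longrightarrow> \<rho> j k + tens_flip (\<rho> k j) = 0"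
    and cyb: "\<And>j k m \<xi> \<eta> \<zeta>. j \<in> {1..n} \<Longrightarrow> k \<in> {1..n} \<Longrightarrow> m \<in> {1..n} \<Longrightarrow> \<xi> \<in> lie_dual L \<Longrightarrow> \<eta> \<in> lie_dual L \<Longrightarrow>
       \<zeta> \<in> lie_dual L \<Longrightarrow> cyb L (\<rho> j k) (\<rho> j m) (\<rho> k m) \<xi> \<eta> \<zeta> = 0"
  shows "quasitriangular (lie_power n L) (block_tensor n \<rho>)"
  unfolding quasitriangular_iff
proof (intro conjI ballI)
  show "block_tensor n \<rho> \<in> tens_square (lie_power n L)" by (rule block_tensor_in_square[OF L \<rho>])
  let ?s = "\<lambda>j k. \<rho> j k + tens_flip (\<rho> k j)"
  have s: "\<forall>j\<in>{1..n}. \<forall>k\<in>{1..n}. ?s j k \<in> tens_square L"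
    by (intro ballI tens_square_add tens_flip_in_square \<rho>[rule_format])
  show "ad_invariant (lie_power n L) (block_tensor n \<rho> + tens_flip (block_tensor n \<rho>))"
    unfolding block_tensor_symmetric_part ad_invariant_def
  proof (intro ballI)
    fix z \<xi> \<eta> assume z: "z \<in> lcarrier (lie_power n L)"
      and \<xi>: "\<xi> \<in> lie_dual (lie_power n L)" and \<eta>: "\<eta> \<in> lie_dual (lie_power n L)"
    have "tens_ad (lie_power n L) z (block_tensor n ?s) \<xi> \<eta> =
      (\<Sum>j\<in>{1..n}. \<Sum>k\<in>{1..n}. ?s j k (\<lambda>u. slot j \<xi> (lbr L (z j) u)) (slot k \<eta>)
         + ?s j k (slot j \<xi>) (\<lambda>u. slot k \<eta> (lbr L (z k) u)))"
      unfolding tens_ad_def block_tensor_ad(1)[OF L s z] block_tensor_ad(2)[OF L s z] by (simp only: sum.distrib)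
    also have "\<dots> = 0"
    proof (intro sum.neutral ballI)
      fix j k assume jk: "j \<in> {1..n}" "k \<in> {1..n}"
      show "?s j k (\<lambda>u. slot j \<xi> (lbr L (z j) u)) (slot k \<eta>) + ?s j k (slot j \<xi>) (\<lambda>u. slot k \<eta> (lbr L (z k) u)) = 0"
      proof (cases "j = k")
        case True
        have "z j \<in> lcarrier L" using z jk(1) unfolding lie_power_simps(3) by blast
        then have "tens_ad L (z j) (?s j j) (slot j \<xi>) (slot j \<eta>) = 0"
          using diag[OF jk(1)] slot_dual[OF L \<xi> jk(1)] slot_dual[OF L \<eta> jk(1)] unfolding ad_invariant_def by blast
        then show ?thesis using True by (simp add: tens_ad_def)
      next
        case False
        show ?thesis unfolding off[OF jk False] by simp
      qed
    qed
    finally show "tens_ad (lie_power n L) z (block_tensor n ?s) \<xi> \<eta> = 0" .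
  qed
  fix \<xi> \<eta> \<zeta> assume d: "\<xi> \<in> lie_dual (lie_power n L)" "\<eta> \<in> lie_dual (lie_power n L)" "\<zeta> \<in> lie_dual (lie_power n L)"
  show "cyb (lie_power n L) (block_tensor n \<rho>) (block_tensor n \<rho>) (block_tensor n \<rho>) \<xi> \<eta> \<zeta> = 0"
    unfolding cyb_block_tensor[OF L \<rho> d] by (intro sum.neutral ballI cyb slot_dual[OF L d(1)] slot_dual[OF L d(2)] slot_dual[OF L d(3)])
qed

lemma tens_flip_simps:
  "tens_flip (tens_flip T) = T" "tens_flip (- T) = - tens_flip T" "tens_flip 0 = 0"
  "tens_flip (T + T') = tens_flip T + tens_flip T'"
  by (simp_all add: tens_flip_def fun_eq_iff)

text \<open>The sign of the block \<open>(j, k)\<close> of \<open>r\<^sup>(\<^sup>n\<^sup>)\<close>: true for \<open>r\<close>, false for \<open>- r\<^sup>2\<^sup>1\<close>.\<close>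

definition mixed_sign :: "nat \<Rightarrow> nat \<Rightarrow> bool" where
  "mixed_sign j k \<longleftrightarrow> k < j \<or> (k = j \<and> odd j)"

definition direct_block :: "('k::field, 'g) tens2 \<Rightarrow> nat \<Rightarrow> nat \<Rightarrow> ('k, 'g) tens2" where
  "direct_block r j k = (if k = j then signed_r (odd j) r else 0)"

text \<open>\<open>r_mixed\<close> is \<open>r\<^sup>(\<^sup>n\<^sup>)\<close> in terms of blocks (see \<open>r_power_eq\<close> below), and \<open>r_direct\<close> is its block
  diagonal part.\<close>

definition r_direct :: "nat \<Rightarrow> ('k::field, 'g::zero) tens2 \<Rightarrow> ('k, nat \<Rightarrow> 'g) tens2" where
  "r_direct n r = block_tensor n (direct_block r)"

definition r_mixed :: "nat \<Rightarrow> ('k::field, 'g::zero) tens2 \<Rightarrow> ('k, nat \<Rightarrow> 'g) tens2" where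
  "r_mixed n r = block_tensor n (\<lambda>j k. signed_r (mixed_sign j k) r)"

lemma signed_r_symmetric_part:
  "signed_r \<sigma> r + tens_flip (signed_r (\<not> \<sigma>) r) = 0"
  by (simp add: signed_r_def tens_flip_simps)

lemma signed_r_ad_invariant:
  assumes "ad_invariant L (r + tens_flip r)" shows "ad_invariant L (signed_r \<sigma> r + tens_flip (signed_r \<sigma> r))"
proof (cases \<sigma>)
  case False
  have "tens_ad L x (signed_r \<sigma> r + tens_flip (signed_r \<sigma> r)) \<xi> \<eta> = - tens_ad L x (r + tens_flip r) \<xi> \<eta>" for x \<xi> \<eta>
    using False by (simp add: signed_r_def tens_flip_simps tens_ad_def)
  then show ?thesis using assms by (simp add: ad_invariant_def)
qed (use assms in \<open>simp add: signed_r_def\<close>)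

text \<open>The signs of three blocks \<open>(j, k)\<close>, \<open>(j, m)\<close>, \<open>(k, m)\<close> of the mixed tensor are never of an excluded
  pattern, because the sign compares indices and comparison is transitive.\<close>

lemma quasitriangular_r_mixed:
  fixes L :: "('k::field_char_0, 'g::ab_group_add) lie_alg"
  assumes L: "lie_algebra L" and r: "quasitriangular L r"
  shows "quasitriangular (lie_power n L) (r_mixed n r)"
  unfolding r_mixed_def
proof (rule quasitriangular_block_tensor[OF L])
  have rs: "r \<in> tens_square L" and inv: "ad_invariant L (r + tens_flip r)"
    using r unfolding quasitriangular_iff by auto
  show "\<forall>j\<in>{1..n}. \<forall>k\<in>{1..n}. signed_r (mixed_sign j k) r \<in> tens_square L"
    by (intro ballI signed_r_in_square[OF rs])
  show "ad_invariant L (signed_r (mixed_sign j j) r + tens_flip (signed_r (mixed_sign j j) r))" for j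
    by (rule signed_r_ad_invariant[OF inv])
  show "signed_r (mixed_sign j k) r + tens_flip (signed_r (mixed_sign k j) r) = 0" if "j \<noteq> k" for j k
  proof -
    have "mixed_sign k j = (\<not> mixed_sign j k)" using that by (auto simp: mixed_sign_def)
    then show ?thesis by (simp only: signed_r_symmetric_part)
  qed
  fix j k m \<xi> \<eta> \<zeta> assume d: "\<xi> \<in> lie_dual L" "\<eta> \<in> lie_dual L" "\<zeta> \<in> lie_dual L"
  show "cyb L (signed_r (mixed_sign j k) r) (signed_r (mixed_sign j m) r) (signed_r (mixed_sign k m) r) \<xi> \<eta> \<zeta> = 0"
    by (rule cyb_signed[OF L r d]) (auto simp: mixed_sign_def)
qed

lemma quasitriangular_r_direct:
  fixes L :: "('k::field_char_0, 'g::ab_group_add) lie_alg"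
  assumes L: "lie_algebra L" and r: "quasitriangular L r"
  shows "quasitriangular (lie_power n L) (r_direct n r)"
  unfolding r_direct_def
proof (rule quasitriangular_block_tensor[OF L])
  have rs: "r \<in> tens_square L" and inv: "ad_invariant L (r + tens_flip r)"
    using r unfolding quasitriangular_iff by auto
  have ts: "direct_block r j k \<in> tens_square L" for j k
    unfolding direct_block_def using signed_r_in_square[OF rs, of "odd j"] tens_square_zero[of L]
    by (cases "k = j") simp_all
  then show "\<forall>j\<in>{1..n}. \<forall>k\<in>{1..n}. direct_block r j k \<in> tens_square L" by blast
  show "ad_invariant L (direct_block r j j + tens_flip (direct_block r j j))" for j
    using signed_r_ad_invariant[OF inv] by (simp add: direct_block_def)
  show "direct_block r j k + tens_flip (direct_block r k j) = 0" if "j \<noteq> k" for j k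
    using that by (simp add: direct_block_def tens_flip_simps)
  fix j k m \<xi> \<eta> \<zeta> assume d: "\<xi> \<in> lie_dual L" "\<eta> \<in> lie_dual L" "\<zeta> \<in> lie_dual L"
  show "cyb L (direct_block r j k) (direct_block r j m) (direct_block r k m) \<xi> \<eta> \<zeta> = 0"
  proof (cases "j = k \<and> k = m")
    case True
    then show ?thesis using cyb_signed[OF L r d, of "odd j" "odd j" "odd j"] by (simp add: direct_block_def)
  next
    case False
    then have "j \<noteq> k \<and> j \<noteq> m \<or> j \<noteq> k \<and> k \<noteq> m \<or> j \<noteq> m \<and> k \<noteq> m" by auto
    moreover have "direct_block r p q = 0" if "p \<noteq> q" for p q using that by (simp add: direct_block_def)
    ultimately show ?thesis
      by (elim disjE conjE) (simp_all add: cyb_def tens_square_linear[OF ts])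
  qed
qed

text \<open>Off the diagonal both tensors have skew-symmetric block patterns, and on the diagonal they agree.\<close>

lemma r_direct_r_mixed_symmetric_part:
  "r_direct n r + tens_flip (r_direct n r) = r_mixed n r + tens_flip (r_mixed n r)"
proof -
  have "direct_block r j k + tens_flip (direct_block r k j) =
      signed_r (mixed_sign j k) r + tens_flip (signed_r (mixed_sign k j) r)" for j k
  proof (cases "j = k")
    case False
    then have "mixed_sign k j = (\<not> mixed_sign j k)" by (auto simp: mixed_sign_def)
    then have "signed_r (mixed_sign j k) r + tens_flip (signed_r (mixed_sign k j) r) = 0"
      by (simp only: signed_r_symmetric_part)
    with False show ?thesis by (simp add: direct_block_def tens_flip_simps)
  qed (simp add: direct_block_def mixed_sign_def)
  then show ?thesis unfolding r_direct_def r_mixed_def block_tensor_symmetric_part by simp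
qed

lemma sum_by_order:
  fixes A C :: "nat \<Rightarrow> nat \<Rightarrow> 'b::comm_monoid_add"
  shows "(\<Sum>j\<in>{1..n}. \<Sum>k\<in>{1..n}. if k < j then A j k else if k = j then B j else C j k) =
    (\<Sum>j\<in>{1..n}. B j) + (\<Sum>j\<in>{1..n}. \<Sum>k\<in>{j<..n}. A k j + C j k)"
proof -
  have restrict: "(\<Sum>k\<in>{1..n}. if j < k then F k else 0) = (\<Sum>k\<in>{j<..n}. F k)" if "j \<in> {1..n}" for j and F :: "nat \<Rightarrow> 'b"
    by (rule sum.mono_neutral_cong_right) (use that in auto)
  have "(\<Sum>j\<in>{1..n}. \<Sum>k\<in>{1..n}. if k < j then A j k else if k = j then B j else C j k) =
    (\<Sum>j\<in>{1..n}. \<Sum>k\<in>{1..n}. (if k < j then A j k else 0) + (if k = j then B j else 0) + (if j < k then C j k else 0))"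
    by (intro sum.cong[OF refl]) auto
  also have "\<dots> = (\<Sum>j\<in>{1..n}. \<Sum>k\<in>{1..n}. if k < j then A j k else 0) + (\<Sum>j\<in>{1..n}. B j)
      + (\<Sum>j\<in>{1..n}. \<Sum>k\<in>{1..n}. if j < k then C j k else 0)"
    by (simp add: sum.distrib)
  also have "(\<Sum>j\<in>{1..n}. \<Sum>k\<in>{1..n}. if k < j then A j k else 0) = (\<Sum>k\<in>{1..n}. \<Sum>j\<in>{1..n}. if k < j then A j k else 0)"
    by (rule sum.swap)
  also have "\<dots> = (\<Sum>k\<in>{1..n}. \<Sum>j\<in>{k<..n}. A j k)"
    by (intro sum.cong[OF refl] restrict)
  also have "(\<Sum>j\<in>{1..n}. \<Sum>k\<in>{1..n}. if j < k then C j k else 0) = (\<Sum>j\<in>{1..n}. \<Sum>k\<in>{j<..n}. C j k)"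
    by (intro sum.cong[OF refl] restrict)
  finally show ?thesis by (simp add: sum.distrib add_ac)
qed

lemma Mix_apply:
  "Mix n I x y \<xi> \<eta> = (\<Sum>j\<in>{1..n}. \<Sum>k\<in>{j<..n}.
     tens_flip (\<Sum>i\<in>I. x i \<otimes> y i) (slot j \<xi>) (slot k \<eta>) - (\<Sum>i\<in>I. x i \<otimes> y i) (slot k \<xi>) (slot j \<eta>))"
  unfolding Mix_def sum_apply2 wedge_def
  by (intro sum.cong[OF refl]) (simp add: tens_flip_def sum_apply2 tens_def slot_def sum_subtractf mult_ac)

lemma r_direct_apply: "r_direct n r \<xi> \<eta> = (\<Sum>j\<in>{1..n}. signed_r (odd j) r (slot j \<xi>) (slot j \<eta>))"
  unfolding r_direct_def block_tensor_def
  by (rule sum.cong[OF refl]) (simp add: direct_block_def if_distrib[of "\<lambda>T. T _ _"] cong: if_cong)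

lemma r_mixed_eq:
  fixes x y :: "'i \<Rightarrow> 'g::zero"
  shows "(r_mixed n (\<Sum>i\<in>I. x i \<otimes> y i) :: ('k::field, nat \<Rightarrow> 'g) tens2) = r_direct n (\<Sum>i\<in>I. x i \<otimes> y i) - Mix n I x y"
proof (intro ext)
  fix \<xi> \<eta> :: "(nat \<Rightarrow> 'g) \<Rightarrow> 'k"
  let ?r = "(\<Sum>i\<in>I. x i \<otimes> y i) :: ('k, 'g) tens2"
  have "r_mixed n ?r \<xi> \<eta> = (\<Sum>j\<in>{1..n}. \<Sum>k\<in>{1..n}. if k < j then ?r (slot j \<xi>) (slot k \<eta>)
     else if k = j then signed_r (odd j) ?r (slot j \<xi>) (slot j \<eta>) else - tens_flip ?r (slot j \<xi>) (slot k \<eta>))"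
    unfolding r_mixed_def block_tensor_def
    by (intro sum.cong[OF refl]) (auto simp: signed_r_def mixed_sign_def)
  also have "\<dots> = r_direct n ?r \<xi> \<eta> - Mix n I x y \<xi> \<eta>"
    unfolding sum_by_order r_direct_apply Mix_apply by (simp add: sum_subtractf)
  finally show "r_mixed n ?r \<xi> \<eta> = (r_direct n ?r - Mix n I x y) \<xi> \<eta>" by simp
qed

lemma r_power_eq:
  fixes x y :: "'i \<Rightarrow> 'g::zero"
  shows "(r_power n I x y :: ('k::field, nat \<Rightarrow> 'g) tens2) = r_mixed n (\<Sum>i\<in>I. x i \<otimes> y i)"
proof -
  let ?r = "(\<Sum>i\<in>I. x i \<otimes> y i) :: ('k, 'g) tens2"
  have "(\<Sum>j\<in>{j\<in>{1..n}. odd j}. tens_summand j ?r) + (\<Sum>j\<in>{j\<in>{1..n}. even j}. tens_summand j (- (\<Sum>i\<in>I. y i \<otimes> x i)))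
      = r_direct n ?r"
  proof (intro ext)
    fix \<xi> \<eta> :: "(nat \<Rightarrow> 'g) \<Rightarrow> 'k"
    have flip: "(\<Sum>i\<in>I. y i \<otimes> x i) \<alpha> \<beta> = tens_flip ?r \<alpha> \<beta>" for \<alpha> \<beta> :: "'g \<Rightarrow> 'k"
      by (simp add: tens_flip_def sum_apply2 tens_def mult_ac)
    have "(\<Sum>j\<in>{j\<in>{1..n}. odd j}. tens_summand j ?r \<xi> \<eta>)
        + (\<Sum>j\<in>{j\<in>{1..n}. even j}. tens_summand j (- (\<Sum>i\<in>I. y i \<otimes> x i)) \<xi> \<eta>) =
      (\<Sum>j\<in>{j\<in>{1..n}. odd j}. signed_r (odd j) ?r (slot j \<xi>) (slot j \<eta>))
        + (\<Sum>j\<in>{j\<in>{1..n}. even j}. signed_r (odd j) ?r (slot j \<xi>) (slot j \<eta>))"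
      by (intro arg_cong2[where f = "(+)"] sum.cong[OF refl]) (auto simp: tens_summand_def signed_r_def slot_def flip)
    also have "\<dots> = (\<Sum>j\<in>{j\<in>{1..n}. odd j} \<union> {j\<in>{1..n}. even j}. signed_r (odd j) ?r (slot j \<xi>) (slot j \<eta>))"
      by (rule sum.union_disjoint[symmetric]) auto
    also have "{j\<in>{1..n}. odd j} \<union> {j\<in>{1..n}. even j} = {1..n}" by auto
    finally have *: "(\<Sum>j\<in>{j\<in>{1..n}. odd j}. tens_summand j ?r \<xi> \<eta>)
        + (\<Sum>j\<in>{j\<in>{1..n}. even j}. tens_summand j (- (\<Sum>i\<in>I. y i \<otimes> x i)) \<xi> \<eta>)
        = (\<Sum>j\<in>{1..n}. signed_r (odd j) ?r (slot j \<xi>) (slot j \<eta>))" .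
    show "((\<Sum>j\<in>{j\<in>{1..n}. odd j}. tens_summand j ?r)
        + (\<Sum>j\<in>{j\<in>{1..n}. even j}. tens_summand j (- (\<Sum>i\<in>I. y i \<otimes> x i)))) \<xi> \<eta> = r_direct n ?r \<xi> \<eta>"
      unfolding plus_fun_apply sum_apply2[where \<xi> = \<xi> and \<eta> = \<eta>] r_direct_apply by (rule *)
  qed
  then show ?thesis unfolding r_power_def r_mixed_eq by simp
qed

section \<open>Twisting the bivector field of a Poisson space\<close>

lemma left_action_vector_field: "left_action L M l \<Longrightarrow> u \<in> lcarrier L \<Longrightarrow> vector_field M (l u)"
  unfolding left_action_def by blast

lemma left_action_add:
  "left_action L M l \<Longrightarrow> u \<in> lcarrier L \<Longrightarrow> v \<in> lcarrier L \<Longrightarrow> l (u + v) p f = l u p f + l v p f"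
  unfolding left_action_def by simp

lemma left_action_scale:
  "left_action L M l \<Longrightarrow> u \<in> lcarrier L \<Longrightarrow> l (lscale L c u) p f = c * l u p f"
  unfolding left_action_def by simp

lemma left_action_bracket:
  assumes "left_action L M l" "u \<in> lcarrier L" "v \<in> lcarrier L" "smooth_at M p f"
  shows "l (lbr L u v) p f = l v p (\<lambda>q. l u q f) - l u p (\<lambda>q. l v q f)"
proof -
  have "l (lbr L u v) = - vf_bracket M (l u) (l v)" using assms(1-3) unfolding left_action_def by blast
  then show ?thesis using assms(4) by (simp add: vf_bracket_def)
qed

lemma left_action_dual: "left_action L M l \<Longrightarrow> (\<lambda>u. l u p f) \<in> lie_dual L"
  unfolding lie_dual_def by (simp add: left_action_add left_action_scale)

lemma left_action_not_smooth: "left_action L M l \<Longrightarrow> u \<in> lcarrier L \<Longrightarrow> \<not> smooth_at M p f \<Longrightarrow> l u p f = 0"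
  using left_action_vector_field[of L M l u] unfolding vector_field_def by blast

lemma left_action_smooth:
  "manifold M \<Longrightarrow> left_action L M l \<Longrightarrow> u \<in> lcarrier L \<Longrightarrow> smooth_at M p f \<Longrightarrow> smooth_at M p (\<lambda>q. l u q f)"
  by (rule vector_field_smooth[OF _ left_action_vector_field])

lemma left_action_derivation:
  "manifold M \<Longrightarrow> left_action L M l \<Longrightarrow> u \<in> lcarrier L \<Longrightarrow> smooth_at M p f \<Longrightarrow> derivation_at M p (l u p)"
  by (rule vector_field_derivation[OF _ left_action_vector_field smooth_at_topspace])

text \<open>The sign comes from the action being an anti-homomorphism.\<close>

lemma schouten_act2:
  assumes L: "lie_algebra L" and M: "manifold M" and l: "left_action L M l" and T: "T \<in> tens_square L"
    and x: "x \<in> lcarrier L"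
  shows "schouten M (l x) (act2 l T) = - act2 l (tens_ad L x T)"
proof (intro ext)
  fix p f g
  obtain N :: nat and c a b where R: "\<And>i. i < N \<Longrightarrow> a i \<in> lcarrier L" "\<And>i. i < N \<Longrightarrow> b i \<in> lcarrier L"
    "\<And>\<xi> \<eta>. T \<xi> \<eta> = (\<Sum>i<N. c i * (\<xi> (a i) * \<eta> (b i)))"
    by (rule tens_square_repr[OF T], rule that)
  note br = lie_br_closed[OF L x]
  show "schouten M (l x) (act2 l T) p f g = (- act2 l (tens_ad L x T)) p f g"
  proof (cases "smooth_at M p f \<and> smooth_at M p g")
    case False
    have "c i * (l (lbr L x (a i)) p f * l (b i) p g) = 0" "c i * (l (a i) p f * l (lbr L x (b i)) p g) = 0" if "i < N" for i
      using False left_action_not_smooth[OF l R(1)[OF that]] left_action_not_smooth[OF l R(2)[OF that]]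
        left_action_not_smooth[OF l br[OF R(1)[OF that]]] left_action_not_smooth[OF l br[OF R(2)[OF that]]] by auto
    then have "(\<Sum>i<N. c i * (l (lbr L x (a i)) p f * l (b i) p g)) = 0"
      "(\<Sum>i<N. c i * (l (a i) p f * l (lbr L x (b i)) p g)) = 0"
      by (intro sum.neutral ballI; simp)+
    then have "act2 l (tens_ad L x T) p f g = 0"
      unfolding act2_def tens_ad_def R(3) by simp
    then show ?thesis unfolding schouten_def if_not_P[OF False] by simp
  next
    case fg: True
    then have f: "smooth_at M p f" and g: "smooth_at M p g" by auto
    note D = left_action_derivation[OF M l x f]
    note sf = left_action_smooth[OF M l _ f] and sg = left_action_smooth[OF M l _ g]
    have 1: "l x p (\<lambda>q. act2 l T q f g) =
       (\<Sum>i<N. c i * (l (a i) p f * l x p (\<lambda>q. l (b i) q g) + l x p (\<lambda>q. l (a i) q f) * l (b i) p g))"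
    proof -
      have "l x p (\<lambda>q. act2 l T q f g) = l x p (\<lambda>q. \<Sum>i<N. c i * (l (a i) q f * l (b i) q g))"
        by (simp add: act2_def R(3))
      also have "\<dots> = (\<Sum>i<N. l x p (\<lambda>q. c i * (l (a i) q f * l (b i) q g)))"
      proof (rule derivation_at_sum[OF M D])
        fix i assume "i \<in> {..<N}"
        then have i: "i < N" by simp
        show "smooth_at M p (\<lambda>q. c i * (l (a i) q f * l (b i) q g))"
          by (intro smooth_at_mult[OF M] smooth_at_const[OF M smooth_at_topspace[OF f]] sf[OF R(1)[OF i]] sg[OF R(2)[OF i]])
      qed
      also have "\<dots> = (\<Sum>i<N. c i * (l (a i) p f * l x p (\<lambda>q. l (b i) q g) + l x p (\<lambda>q. l (a i) q f) * l (b i) p g))"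
      proof (rule sum.cong[OF refl])
        fix i assume "i \<in> {..<N}"
        then have i: "i < N" by simp
        note s = sf[OF R(1)[OF i]] sg[OF R(2)[OF i]]
        show "l x p (\<lambda>q. c i * (l (a i) q f * l (b i) q g)) =
          c i * (l (a i) p f * l x p (\<lambda>q. l (b i) q g) + l x p (\<lambda>q. l (a i) q f) * l (b i) p g)"
          unfolding derivation_at_scale[OF M D smooth_at_mult[OF M s]] derivation_at_mult[OF M D s] by (rule refl)
      qed
      finally show ?thesis .
    qed
    have 2: "act2 l T p (\<lambda>q. l x q f) g = (\<Sum>i<N. c i * (l (a i) p (\<lambda>q. l x q f) * l (b i) p g))"
      "act2 l T p f (\<lambda>q. l x q g) = (\<Sum>i<N. c i * (l (a i) p f * l (b i) p (\<lambda>q. l x q g)))"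
      by (simp_all add: act2_def R(3))
    have "act2 l (tens_ad L x T) p f g = (\<Sum>i<N. c i * (l (lbr L x (a i)) p f * l (b i) p g) + c i * (l (a i) p f * l (lbr L x (b i)) p g))"
      by (simp add: act2_def tens_ad_def R(3) sum.distrib)
    also have "\<dots> = - (l x p (\<lambda>q. act2 l T q f g) - act2 l T p (\<lambda>q. l x q f) g - act2 l T p f (\<lambda>q. l x q g))"
      unfolding 1 2 sum_subtractf[symmetric] sum_negf[symmetric]
      by (rule sum.cong[OF refl])
         (simp add: left_action_bracket[OF l x _ f] left_action_bracket[OF l x _ g] R(1,2) algebra_simps)
    finally show ?thesis using fg by (simp add: schouten_def)
  qed
qed

lemma bivector_field_act2:
  assumes M: "manifold M" and l: "left_action L M l" and T: "T \<in> tens_square L"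
    and skew: "\<And>\<xi> \<eta>. T \<xi> \<eta> = - T \<eta> \<xi>"
  shows "bivector_field M (act2 l T)"
  unfolding bivector_field_def
proof (intro conjI allI impI ballI)
  obtain N :: nat and c a b where R: "\<And>i. i < N \<Longrightarrow> a i \<in> lcarrier L" "\<And>i. i < N \<Longrightarrow> b i \<in> lcarrier L"
    "\<And>\<xi> \<eta>. T \<xi> \<eta> = (\<Sum>i<N. c i * (\<xi> (a i) * \<eta> (b i)))"
    by (rule tens_square_repr[OF T], rule that)
  show "act2 l T p f g = 0" if "\<not> (smooth_at M p f \<and> smooth_at M p g)" for p f g
    unfolding act2_def R(3)
    using that left_action_not_smooth[OF l R(1)] left_action_not_smooth[OF l R(2)] by (intro sum.neutral) auto
  show "act2 l T p f g = - act2 l T p g f" for p f g unfolding act2_def by (rule skew)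
  fix C assume C: "C \<in> matlas M"
  have C': "(fst C, snd C) \<in> matlas M" using C by simp
  obtain \<alpha> where \<alpha>: "\<forall>i\<in>{..<N}. \<forall>m<mdim M. smooth_on M (fst C) (\<alpha> i m)"
    "\<forall>i\<in>{..<N}. \<forall>p\<in>fst C. \<forall>f. smooth_at M p f \<longrightarrow> l (a i) p f = (\<Sum>m<mdim M. \<alpha> i m p * chart_deriv C m f p)"
    by (rule vector_field_family[OF _ C, of "{..<N}" "\<lambda>i. l (a i)"],
        use left_action_vector_field[OF l R(1)] in blast, rule that)
  obtain \<beta> where \<beta>: "\<forall>i\<in>{..<N}. \<forall>m<mdim M. smooth_on M (fst C) (\<beta> i m)"
    "\<forall>i\<in>{..<N}. \<forall>p\<in>fst C. \<forall>f. smooth_at M p f \<longrightarrow> l (b i) p f = (\<Sum>m<mdim M. \<beta> i m p * chart_deriv C m f p)"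
    by (rule vector_field_family[OF _ C, of "{..<N}" "\<lambda>i. l (b i)"],
        use left_action_vector_field[OF l R(2)] in blast, rule that)
  note o = chart_openin[OF M C']
  show "\<exists>A. (\<forall>i<mdim M. \<forall>k<mdim M. smooth_on M (fst C) (A i k)) \<and>
     (\<forall>p\<in>fst C. \<forall>f g. smooth_at M p f \<and> smooth_at M p g \<longrightarrow> act2 l T p f g =
        (\<Sum>i<mdim M. \<Sum>k<mdim M. A i k p * chart_deriv C i f p * chart_deriv C k g p))"
  proof (intro exI[of _ "\<lambda>m k p. \<Sum>i<N. c i * (\<alpha> i m p * \<beta> i k p)"] conjI allI impI ballI)
    show "smooth_on M (fst C) (\<lambda>p. \<Sum>i<N. c i * (\<alpha> i m p * \<beta> i k p))" if "m < mdim M" "k < mdim M" for m k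
      using \<alpha> \<beta> that by (intro smooth_on_sum[OF M o] smooth_on_mult[OF M] smooth_on_const[OF M o]) auto
    show "act2 l T p f g =
        (\<Sum>m<mdim M. \<Sum>k<mdim M. (\<Sum>i<N. c i * (\<alpha> i m p * \<beta> i k p)) * chart_deriv C m f p * chart_deriv C k g p)"
      if p: "p \<in> fst C" and fg: "smooth_at M p f \<and> smooth_at M p g" for p f g
    proof -
      have "act2 l T p f g = (\<Sum>i<N. c i * ((\<Sum>m<mdim M. \<alpha> i m p * chart_deriv C m f p) * (\<Sum>k<mdim M. \<beta> i k p * chart_deriv C k g p)))"
        unfolding act2_def R(3) by (rule sum.cong[OF refl]) (use \<alpha> \<beta> p fg in auto)
      also have "\<dots> = (\<Sum>i<N. \<Sum>m<mdim M. \<Sum>k<mdim M. c i * (\<alpha> i m p * \<beta> i k p) * chart_deriv C m f p * chart_deriv C k g p)"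
        unfolding sum_product by (simp add: sum_distrib_left mult_ac)
      also have "\<dots> = (\<Sum>m<mdim M. \<Sum>k<mdim M. \<Sum>i<N. c i * (\<alpha> i m p * \<beta> i k p) * chart_deriv C m f p * chart_deriv C k g p)"
        by (subst sum.swap, rule sum.cong[OF refl], rule sum.swap)
      finally show ?thesis by (simp add: sum_distrib_right)
    qed
  qed
qed

text \<open>The right-hand side depends on \<open>P\<close> and \<open>R\<close> only through \<open>Q\<close> and \<open>s\<close>.  The proof substitutes
  \<open>P = Q - \<lambda>(R)\<close>.  Terms with one copy of \<open>R\<close> pair up, under cyclic permutation, to the symmetric part
  either of \<open>R\<close> or of \<open>Q\<close>, and the latter is \<open>\<lambda>(s)\<close> as \<open>P\<close> is skew.  Terms with two copies of \<open>R\<close> then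
  cancel up to commutators of the vector fields of the action.\<close>

lemma jacobi_via_invariant:
  fixes L :: "('k::real_normed_field, 'g::ab_group_add) lie_alg"
  assumes L: "lie_algebra L" and r: "quasitriangular L R" and M: "manifold M" and l: "left_action L M l"
    and P: "bivector_field M P" and S: "\<forall>x\<in>lcarrier L. schouten M (l x) P = act2 l (tens_ad L x R)"
    and Q_def: "Q = P + act2 l R" and s_def: "s = R + tens_flip R"
    and f: "smooth_at M p f" and g: "smooth_at M p g" and h: "smooth_at M p h"
  shows "P p f (\<lambda>q. P q g h) + P p g (\<lambda>q. P q h f) + P p h (\<lambda>q. P q f g) =
    Q p f (\<lambda>q. Q q g h) + Q p g (\<lambda>q. Q q h f) + Q p h (\<lambda>q. Q q f g)
    - (s (\<lambda>u. Q p f (\<lambda>q. l u q g)) (\<lambda>u. l u p h) + s (\<lambda>u. Q p g (\<lambda>q. l u q h)) (\<lambda>u. l u p f)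
       + s (\<lambda>u. Q p h (\<lambda>q. l u q f)) (\<lambda>u. l u p g))
    + br13_23 L s (\<lambda>u. l u p f) (\<lambda>u. l u p g) (\<lambda>u. l u p h)"
proof -
  have Rs: "R \<in> tens_square L" using r unfolding quasitriangular_iff by blast
  obtain N :: nat and c a b where R: "\<And>i. i < N \<Longrightarrow> a i \<in> lcarrier L" "\<And>i. i < N \<Longrightarrow> b i \<in> lcarrier L"
    "\<And>\<xi> \<eta>. R \<xi> \<eta> = (\<Sum>i<N. c i * (\<xi> (a i) * \<eta> (b i)))"
    by (rule tens_square_repr[OF Rs], rule that)
  note top = smooth_at_topspace[OF f]
  define A where "A i f q = l (a i) q f" for i f q
  define B where "B i f q = l (b i) q f" for i f q
  have Q: "Q q f g = P q f g + (\<Sum>i<N. c i * (A i f q * B i g q))" for q f g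
    by (simp add: Q_def act2_def R(3) A_def B_def)
  have sA: "smooth_at M p (A i f)" if "i < N" "smooth_at M p f" for i f
    unfolding A_def by (rule left_action_smooth[OF M l R(1)[OF that(1)] that(2)])
  have sB: "smooth_at M p (B i f)" if "i < N" "smooth_at M p f" for i f
    unfolding B_def by (rule left_action_smooth[OF M l R(2)[OF that(1)] that(2)])
  have sAB: "smooth_at M p (\<lambda>q. A i f q * B i g q)" if "i < N" "smooth_at M p f" "smooth_at M p g" for i f g
    by (rule smooth_at_mult[OF M sA[OF that(1,2)] sB[OF that(1,3)]])
  have scAB: "smooth_at M p (\<lambda>q. c i * (A i f q * B i g q))" if "i < N" "smooth_at M p f" "smooth_at M p g" for i f g
    by (rule smooth_at_mult[OF M smooth_at_const[OF M top] sAB[OF that]])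
  have sP: "smooth_at M p (\<lambda>q. P q f g)" if "smooth_at M p f" "smooth_at M p g" for f g
    by (rule bivector_field_smooth[OF M P that])
  have sQ: "smooth_at M p (\<lambda>q. Q q f g)" if "smooth_at M p f" "smooth_at M p g" for f g
    unfolding Q using that by (intro smooth_at_add[OF M] sP smooth_at_sum[OF M top] scAB) auto
  \<comment> \<open>\<open>Q\<close> is a derivation in its second argument because \<open>P\<close> and the vector fields are.\<close>
  have Q_mult: "Q p f (\<lambda>q. F q * G q) = F p * Q p f G + Q p f F * G p"
    if f: "smooth_at M p f" and F: "smooth_at M p F" and G: "smooth_at M p G" for f F G
  proof -
    have "(\<Sum>i<N. c i * (A i f p * B i (\<lambda>q. F q * G q) p)) =
        F p * (\<Sum>i<N. c i * (A i f p * B i G p)) + (\<Sum>i<N. c i * (A i f p * B i F p)) * G p"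
      unfolding sum_distrib_left sum_distrib_right sum.distrib[symmetric]
      by (rule sum.cong[OF refl])
         (simp add: B_def derivation_at_mult[OF M left_action_derivation[OF M l R(2) F] F G] algebra_simps)
    then show ?thesis
      unfolding Q derivation_at_mult[OF M bivector_field_derivation[OF M P f] F G] by (simp add: algebra_simps)
  qed
  have Q_diff: "Q p f (\<lambda>q. F q + (\<Sum>i<N. k i * G i q)) = Q p f F + (\<Sum>i<N. k i * Q p f (G i))"
    if f: "smooth_at M p f" and F: "smooth_at M p F" and G: "\<And>i. i < N \<Longrightarrow> smooth_at M p (G i)" for f F G k
  proof -
    have skG: "smooth_at M p (\<lambda>q. k i * G i q)" if "i \<in> {..<N}" for i
      using that by (intro smooth_at_mult[OF M smooth_at_const[OF M top]] G) simp
    have D: "D (\<lambda>q. F q + (\<Sum>i<N. k i * G i q)) = D F + (\<Sum>i<N. k i * D (G i))" if D: "derivation_at M p D" for D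
    proof -
      have sS: "smooth_at M p (\<lambda>q. \<Sum>i<N. k i * G i q)" by (rule smooth_at_sum[OF M top skG])
      have "D (\<lambda>q. \<Sum>i<N. k i * G i q) = (\<Sum>i<N. D (\<lambda>q. k i * G i q))"
        by (rule derivation_at_sum[OF M D skG])
      then have "D (\<lambda>q. F q + (\<Sum>i<N. k i * G i q)) = D F + (\<Sum>i<N. D (\<lambda>q. k i * G i q))"
        using derivation_at_add[OF M D F sS] by simp
      also have "(\<Sum>i<N. D (\<lambda>q. k i * G i q)) = (\<Sum>i<N. k i * D (G i))"
        by (rule sum.cong[OF refl]) (simp add: derivation_at_scale[OF M D G])
      finally show ?thesis .
    qed
    have "(\<Sum>m<N. c m * (A m f p * B m (\<lambda>q. F q + (\<Sum>i<N. k i * G i q)) p)) =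
        (\<Sum>m<N. c m * (A m f p * (B m F p + (\<Sum>i<N. k i * B m (G i) p))))"
      by (rule sum.cong[OF refl]) (simp add: B_def D[OF left_action_derivation[OF M l R(2) F]])
    also have "\<dots> = (\<Sum>m<N. c m * (A m f p * B m F p)) + (\<Sum>m<N. \<Sum>i<N. k i * (c m * (A m f p * B m (G i) p)))"
      unfolding sum.distrib[symmetric]
      by (rule sum.cong[OF refl]) (simp add: ring_distribs sum_distrib_left mult_ac)
    also have "(\<Sum>m<N. \<Sum>i<N. k i * (c m * (A m f p * B m (G i) p))) = (\<Sum>i<N. \<Sum>m<N. k i * (c m * (A m f p * B m (G i) p)))"
      by (rule sum.swap)
    finally show ?thesis
      unfolding Q D[OF bivector_field_derivation[OF M P f]] by (simp add: ring_distribs sum.distrib sum_distrib_left)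
  qed
  \<comment> \<open>Invariance of \<open>Q\<close>: the compatibility of \<open>P\<close> cancels the variation of \<open>\<lambda>(R)\<close>.\<close>
  have Q_inv: "l x p (\<lambda>q. Q q f g) = Q p (\<lambda>q. l x q f) g + Q p f (\<lambda>q. l x q g)"
    if x: "x \<in> lcarrier L" and f: "smooth_at M p f" and g: "smooth_at M p g" for x f g
  proof -
    have "schouten M (l x) P p f g + schouten M (l x) (act2 l R) p f g = 0"
      using S[rule_format, OF x] schouten_act2[OF L M l Rs x] by simp
    moreover have "l x p (\<lambda>q. Q q f g) = l x p (\<lambda>q. P q f g) + l x p (\<lambda>q. act2 l R q f g)"
    proof -
      have "smooth_at M p (\<lambda>q. act2 l R q f g)"
        unfolding act2_def R(3) A_def[symmetric] B_def[symmetric]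
        using f g by (intro smooth_at_sum[OF M top] scAB) auto
      then show ?thesis
        using derivation_at_add[OF M left_action_derivation[OF M l x f] sP[OF f g]] by (simp add: Q_def)
    qed
    ultimately show ?thesis using f g by (simp add: schouten_def Q_def algebra_simps)
  qed
  have s: "s \<xi> \<eta> = (\<Sum>i<N. c i * (\<xi> (a i) * \<eta> (b i) + \<eta> (a i) * \<xi> (b i)))" for \<xi> \<eta>
    by (simp add: s_def tens_flip_def R(3) sum.distrib[symmetric] ring_distribs)
  have Q_sym: "Q p u v + Q p v u = (\<Sum>i<N. c i * (A i u p * B i v p + A i v p * B i u p))" for u v
    unfolding Q using bivector_field_skew[OF P, of p u v] by (simp add: sum.distrib ring_distribs)
  \<comment> \<open>The terms of the expansion, in the order in which they arise.\<close>
  define X2 where "X2 f g h = (\<Sum>i<N. c i * (Q p f (A i g) * B i h p))" for f g h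
  define X3 where "X3 f g h = (\<Sum>i<N. c i * (A i g p * Q p f (B i h)))" for f g h
  define X4 where "X4 f g h = (\<Sum>k<N. c k * (A k f p * Q p (B k g) h))" for f g h
  define X5 where "X5 f g h = (\<Sum>k<N. c k * (A k f p * Q p g (B k h)))" for f g h
  define X6 where "X6 f g h = (\<Sum>k<N. \<Sum>i<N. c k * c i * (A k f p * B k (A i g) p * B i h p))" for f g h
  define X7 where "X7 f g h = (\<Sum>k<N. \<Sum>i<N. c k * c i * (A k f p * A i g p * B k (B i h) p))" for f g h
  \<comment> \<open>Substitute \<open>P = Q - \<lambda>(R)\<close> in the iterated bracket and expand.\<close>
  have expand: "P p f (\<lambda>q. P q g h) = Q p f (\<lambda>q. Q q g h) - X2 f g h - X3 f g h - X4 f g h - X5 f g h + X6 f g h + X7 f g h"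
    if f: "smooth_at M p f" and g: "smooth_at M p g" and h: "smooth_at M p h" for f g h
  proof -
    have P_eq: "(\<lambda>q. P q g h) = (\<lambda>q. Q q g h + (\<Sum>i<N. - c i * (A i g q * B i h q)))"
      by (simp add: Q sum_negf)
    note sAB' = sAB[OF _ g h]
    have 1: "Q p f (\<lambda>q. P q g h) = Q p f (\<lambda>q. Q q g h) - X2 f g h - X3 f g h"
    proof -
      have "Q p f (\<lambda>q. P q g h) = Q p f (\<lambda>q. Q q g h) + (\<Sum>i<N. - c i * Q p f (\<lambda>q. A i g q * B i h q))"
        unfolding P_eq by (rule Q_diff[OF f sQ[OF g h] sAB'])
      also have "(\<Sum>i<N. - c i * Q p f (\<lambda>q. A i g q * B i h q)) = - X3 f g h - X2 f g h"
        unfolding X2_def X3_def sum_negf[symmetric] sum_subtractf[symmetric]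
        by (rule sum.cong[OF refl]) (simp add: Q_mult[OF f sA[OF _ g] sB[OF _ h]] algebra_simps)
      finally show ?thesis by simp
    qed
    have 2: "B k (\<lambda>q. P q g h) p = Q p (B k g) h + Q p g (B k h)
        - (\<Sum>i<N. c i * (A i g p * B k (B i h) p + B k (A i g) p * B i h p))" if k: "k < N" for k
    proof -
      note D = left_action_derivation[OF M l R(2)[OF k] f]
      have "B k (\<lambda>q. Q q g h) p = B k (\<lambda>q. P q g h + (\<Sum>i<N. c i * (A i g q * B i h q))) p"
        by (simp add: Q)
      also have "\<dots> = B k (\<lambda>q. P q g h) p + (\<Sum>i<N. B k (\<lambda>q. c i * (A i g q * B i h q)) p)"
        unfolding B_def[of k]
        using derivation_at_add[OF M D sP[OF g h] smooth_at_sum[OF M top scAB[OF _ g h], of "{..<N}"]]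
          derivation_at_sum[OF M D scAB[OF _ g h], of "{..<N}"] by simp
      also have "(\<Sum>i<N. B k (\<lambda>q. c i * (A i g q * B i h q)) p) =
          (\<Sum>i<N. c i * (A i g p * B k (B i h) p + B k (A i g) p * B i h p))"
      proof (rule sum.cong[OF refl])
        fix i assume "i \<in> {..<N}"
        then have i: "i < N" by simp
        show "B k (\<lambda>q. c i * (A i g q * B i h q)) p = c i * (A i g p * B k (B i h) p + B k (A i g) p * B i h p)"
          unfolding B_def[of k] derivation_at_scale[OF M D sAB'[OF i]] derivation_at_mult[OF M D sA[OF i g] sB[OF i h]]
          by (rule refl)
      qed
      finally show ?thesis using Q_inv[OF R(2)[OF k] g h] by (simp add: B_def[abs_def])
    qed
    have "P p f (\<lambda>q. P q g h) = Q p f (\<lambda>q. P q g h) - (\<Sum>k<N. c k * (A k f p * B k (\<lambda>q. P q g h) p))"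
      by (simp add: Q)
    also have "(\<Sum>k<N. c k * (A k f p * B k (\<lambda>q. P q g h) p)) = X4 f g h + X5 f g h - X7 f g h - X6 f g h"
      unfolding X4_def X5_def X6_def X7_def sum_subtractf[symmetric] sum.distrib[symmetric]
      by (rule sum.cong[OF refl]) (simp add: 2 sum.distrib sum_distrib_left sum_negf algebra_simps)
    finally show ?thesis unfolding 1 by simp
  qed
  have 25: "X2 f g h + X5 h f g = s (\<lambda>u. Q p f (\<lambda>q. l u q g)) (\<lambda>u. l u p h)" for f g h
    unfolding X2_def X5_def s sum.distrib[symmetric]
    by (rule sum.cong[OF refl]) (simp add: A_def[abs_def] B_def[abs_def] algebra_simps)
  \<comment> \<open>Of the two sums that the symmetric part of \<open>Q\<close> produces, one is \<open>X7\<close>, the other combines with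
    \<open>X6\<close> to a commutator of vector fields.\<close>
  have 3467: "X3 f g h + X4 g h f - X6 g h f - X7 f g h = br12_23 L R (\<lambda>u. l u p g) (\<lambda>u. l u p h) (\<lambda>u. l u p f)"
    if h: "smooth_at M p h" for f g h
  proof -
    define Y where "Y = (\<Sum>k<N. \<Sum>i<N. c k * c i * (A k g p * B i f p * A i (B k h) p))"
    have "X3 f g h + X4 g h f = (\<Sum>k<N. c k * (A k g p * (Q p f (B k h) + Q p (B k h) f)))"
      unfolding X3_def X4_def sum.distrib[symmetric] by (simp add: ring_distribs)
    also have "\<dots> = (\<Sum>k<N. \<Sum>i<N. c k * c i * (A k g p * A i f p * B i (B k h) p)
        + c k * c i * (A k g p * B i f p * A i (B k h) p))"
      unfolding Q_sym sum_distrib_left by (simp add: algebra_simps)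
    also have "\<dots> = (\<Sum>k<N. \<Sum>i<N. c k * c i * (A k g p * A i f p * B i (B k h) p)) + Y"
      by (simp add: sum.distrib Y_def)
    also have "(\<Sum>k<N. \<Sum>i<N. c k * c i * (A k g p * A i f p * B i (B k h) p)) = X7 f g h"
      unfolding X7_def by (subst sum.swap) (simp add: mult_ac)
    finally have 1: "X3 f g h + X4 g h f - X6 g h f - X7 f g h = Y - X6 g h f" by simp
    have "Y - X6 g h f = (\<Sum>k<N. \<Sum>i<N. c k * c i * (A k g p * B i f p * l (lbr L (b k) (a i)) p h))"
      unfolding Y_def X6_def sum_subtractf[symmetric]
    proof (intro sum.cong[OF refl])
      fix k i assume "k \<in> {..<N}" "i \<in> {..<N}"
      then have br: "l (lbr L (b k) (a i)) p h = A i (B k h) p - B k (A i h) p"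
        using left_action_bracket[OF l R(2)[of k] R(1)[of i] h] by (simp add: A_def[abs_def] B_def[abs_def])
      show "c k * c i * (A k g p * B i f p * A i (B k h) p) - c k * c i * (A k g p * B k (A i h) p * B i f p) =
          c k * c i * (A k g p * B i f p * l (lbr L (b k) (a i)) p h)"
        unfolding br by (simp add: algebra_simps)
    qed
    also have "\<dots> = br12_23 L R (\<lambda>u. l u p g) (\<lambda>u. l u p h) (\<lambda>u. l u p f)"
      unfolding br12_23_def R(3) A_def B_def by (simp add: sum_distrib_left mult_ac)
    finally show ?thesis unfolding 1 .
  qed
  note d = left_action_dual[OF l, of p]
  have cyc: "br12_23 L R (\<lambda>u. l u p g) (\<lambda>u. l u p h) (\<lambda>u. l u p f) + br12_23 L R (\<lambda>u. l u p h) (\<lambda>u. l u p f) (\<lambda>u. l u p g)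
      + br12_23 L R (\<lambda>u. l u p f) (\<lambda>u. l u p g) (\<lambda>u. l u p h) = - br13_23 L s (\<lambda>u. l u p f) (\<lambda>u. l u p g) (\<lambda>u. l u p h)"
    using cyclic_br12_23[OF L r d[of f] d[of g] d[of h]] by (simp add: s_def add_ac)
  show ?thesis
    unfolding expand[OF f g h] expand[OF g h f] expand[OF h f g] 25[symmetric]
    using cyc unfolding 3467[OF h, symmetric] 3467[OF f, symmetric] 3467[OF g, symmetric]
    by (simp add: algebra_simps)
qed

text \<open>The operator \<open>P + \<lambda>(R)\<close> and the symmetric part of \<open>R\<close> are the same before and after the twist, and
  so is the Jacobiator.\<close>

lemma left_poisson_space_twist:
  fixes L :: "('k::real_normed_field, 'g::ab_group_add) lie_alg"
  assumes PS: "left_poisson_space L R M P l" and R': "quasitriangular L R'"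
    and sym: "R + tens_flip R = R' + tens_flip R'"
  shows "left_poisson_space L R' M (P + act2 l (R - R')) l"
proof -
  have L: "lie_algebra L" and R: "quasitriangular L R" and PM: "poisson_manifold M P" and l: "left_action L M l"
    and S: "\<forall>x\<in>lcarrier L. schouten M (l x) P = act2 l (tens_ad L x R)"
    using PS unfolding left_poisson_space_def by auto
  have M: "manifold M" and P: "bivector_field M P" using PM unfolding poisson_manifold_def by blast+
  have ts: "R \<in> tens_square L" "R' \<in> tens_square L" using R R' unfolding quasitriangular_iff by blast+
  note tsd = tens_square_diff[OF ts]
  let ?P = "P + act2 l (R - R')"
  have skew: "(R - R') \<xi> \<eta> = - (R - R') \<eta> \<xi>" for \<xi> \<eta>
    using fun_cong[OF fun_cong[OF sym, of \<xi>], of \<eta>] by (simp add: tens_flip_def algebra_simps)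
  have bvt: "bivector_field M (act2 l (R - R'))" by (rule bivector_field_act2[OF M l tsd skew])
  have P': "bivector_field M ?P"
  proof -
    have "bivector_field M (\<Sum>i\<in>{0, 1::nat}. if i = 0 then P else act2 l (R - R'))"
      by (rule bivector_field_sum[OF M]) (use P bvt in auto)
    then show ?thesis by simp
  qed
  have S': "schouten M (l x) ?P = act2 l (tens_ad L x R')" if x: "x \<in> lcarrier L" for x
  proof (intro ext)
    fix p f g
    have "act2 l (tens_ad L x (R - R')) p f g = act2 l (tens_ad L x R) p f g - act2 l (tens_ad L x R') p f g"
      by (simp add: act2_def tens_ad_def)
    moreover have "schouten M (l x) ?P p f g = schouten M (l x) P p f g + schouten M (l x) (act2 l (R - R')) p f g"
    proof (cases "smooth_at M p f \<and> smooth_at M p g")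
      case True
      then show ?thesis
        using derivation_at_add[OF M left_action_derivation[OF M l x, of p f] bivector_field_smooth[OF M P, of p f g]
            bivector_field_smooth[OF M bvt, of p f g]]
        by (simp add: schouten_def)
    next
      case False
      show ?thesis unfolding schouten_def if_not_P[OF False] by simp
    qed
    ultimately show "schouten M (l x) ?P p f g = act2 l (tens_ad L x R') p f g"
      using S[rule_format, OF x] schouten_act2[OF L M l tsd x] by simp
  qed
  then have S'': "\<forall>x\<in>lcarrier L. schouten M (l x) ?P = act2 l (tens_ad L x R')" by blast
  have Q: "P + act2 l R = ?P + act2 l R'" by (simp add: act2_def fun_eq_iff)
  have "poisson_manifold M ?P"
    unfolding poisson_manifold_def
  proof (intro conjI M P' allI impI)
    fix p f g h assume "smooth_at M p f \<and> smooth_at M p g \<and> smooth_at M p h"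
    then have s: "smooth_at M p f" "smooth_at M p g" "smooth_at M p h" by auto
    have "\<forall>p f g h. smooth_at M p f \<and> smooth_at M p g \<and> smooth_at M p h \<longrightarrow>
        P p f (\<lambda>q. P q g h) + P p g (\<lambda>q. P q h f) + P p h (\<lambda>q. P q f g) = 0"
      using PM unfolding poisson_manifold_def by (elim conjE)
    from this[rule_format, OF conjI[OF s(1) conjI[OF s(2,3)]]]
    have "P p f (\<lambda>q. P q g h) + P p g (\<lambda>q. P q h f) + P p h (\<lambda>q. P q f g) = 0" .
    with trans[OF jacobi_via_invariant[OF L R' M l P' S'' Q sym s]
        jacobi_via_invariant[OF L R M l P S refl refl s, symmetric]]
    show "?P p f (\<lambda>q. ?P q g h) + ?P p g (\<lambda>q. ?P q h f) + ?P p h (\<lambda>q. ?P q f g) = 0"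
      by (rule trans)
  qed
  then show ?thesis unfolding left_poisson_space_def using L R' l S'' by blast
qed

section \<open>Direct products of Poisson spaces\<close>

lemma left_action_zero:
  assumes L: "lie_algebra L" and l: "left_action L N l" shows "l 0 = 0"
proof (intro ext)
  fix p f
  have "l (0 + 0) p f = l 0 p f + l 0 p f"
    by (rule left_action_add[OF l lie_carrier(1)[OF L] lie_carrier(1)[OF L]])
  then show "l 0 p f = 0 p f" by simp
qed

lemma tens_ad_signed_r:
  fixes L :: "('k::field_char_0, 'g::ab_group_add) lie_alg"
  assumes r: "quasitriangular L r" and x: "x \<in> lcarrier L" and \<xi>: "\<xi> \<in> lie_dual L" and \<eta>: "\<eta> \<in> lie_dual L"
  shows "tens_ad L x (signed_r \<sigma> r) \<xi> \<eta> = tens_ad L x r \<xi> \<eta>"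
proof (cases \<sigma>)
  case False
  have "tens_ad L x (r + tens_flip r) \<xi> \<eta> = 0"
    using r x \<xi> \<eta> unfolding quasitriangular_iff ad_invariant_def by blast
  moreover have "tens_ad L x (r + tens_flip r) \<xi> \<eta> = tens_ad L x r \<xi> \<eta> - tens_ad L x (signed_r \<sigma> r) \<xi> \<eta>"
    using False by (simp add: tens_ad_def signed_r_def)
  ultimately show ?thesis by simp
qed (simp add: signed_r_def)

lemma r_direct_ad:
  assumes L: "lie_algebra L" and r: "r \<in> tens_square L" and z: "z \<in> lcarrier (lie_power n L)"
  shows "tens_ad (lie_power n L) z (r_direct n r) \<xi> \<eta> =
    (\<Sum>j\<in>{1..n}. tens_ad L (z j) (signed_r (odd j) r) (slot j \<xi>) (slot j \<eta>))"
  unfolding tens_ad_def r_direct_apply sum.distrib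
  by (intro arg_cong2[where f = "(+)"] sum.cong[OF refl] tens_square_cong[OF signed_r_in_square[OF r]]
      slot_ad[OF L z] refl; assumption)

context mfd_product
begin

lemma prod_action_apply: "prod_action n Y l z p f = (\<Sum>j\<in>{1..n}. lift1 M j (l j (z j)) p f)"
  unfolding prod_action_def by (rule prod_tfield1_apply)

lemma diag_action_apply: "diag_action n Y l u p f = (\<Sum>j\<in>{1..n}. lift1 M j (l j u) p f)"
  unfolding diag_action_def by (rule prod_tfield1_apply)

lemma slot_prod_action:
  assumes L: "lie_algebra L" and l: "\<forall>j\<in>{1..n}. left_action L (Y j) (l j)" and j: "j \<in> {1..n}"
  shows "slot j (\<lambda>z. prod_action n Y l z p f) = (\<lambda>u. lift1 M j (l j u) p f)"
proof
  fix u
  have "(\<Sum>k\<in>{1..n}. lift1 M k (l k (summand j u k)) p f) = (\<Sum>k\<in>{1..n}. if k = j then lift1 M j (l j u) p f else 0)"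
    by (rule sum.cong[OF refl]) (auto simp: summand_def lift1_def left_action_zero[OF L l[rule_format]])
  then show "slot j (\<lambda>z. prod_action n Y l z p f) u = lift1 M j (l j u) p f"
    using j by (simp add: slot_def prod_action_apply)
qed

lemma lift1_dual:
  assumes "left_action L (Y j) l" shows "(\<lambda>u. lift1 M j (l u) p f) \<in> lie_dual L"
  unfolding lie_dual_def lift1_def using left_action_add[OF assms] left_action_scale[OF assms] by simp

lemma left_action_prod:
  assumes L: "lie_algebra L" and l: "\<And>j. j \<in> {1..n} \<Longrightarrow> left_action L (Y j) (l j)"
  shows "left_action (lie_power n L) M (prod_action n Y l)"
  unfolding left_action_def
proof (intro conjI ballI allI)
  note comp = lie_power_comp[OF L]
  have vf: "vector_field (Y j) (l j (z j))" if "j \<in> {1..n}" "z \<in> lcarrier (lie_power n L)" for j z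
    by (rule left_action_vector_field[OF l[OF that(1)] comp[OF that(2)]])
  show "vector_field M (prod_action n Y l z)" if "z \<in> lcarrier (lie_power n L)" for z
    unfolding prod_action_def by (rule vector_field_prod) (rule vf[OF _ that])
  fix z w assume z: "z \<in> lcarrier (lie_power n L)" and w: "w \<in> lcarrier (lie_power n L)"
  show "prod_action n Y l (z + w) = prod_action n Y l z + prod_action n Y l w"
  proof (intro ext)
    fix p f
    show "prod_action n Y l (z + w) p f = (prod_action n Y l z + prod_action n Y l w) p f"
      unfolding plus_fun_apply prod_action_apply sum.distrib[symmetric]
      by (rule sum.cong[OF refl]) (simp add: lift1_def left_action_add[OF l comp[OF z] comp[OF w]])
  qed
  show "prod_action n Y l (lbr (lie_power n L) z w) = - vf_bracket M (prod_action n Y l z) (prod_action n Y l w)"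
  proof (intro ext)
    fix p f
    have "prod_action n Y l (lbr (lie_power n L) z w) p f =
        (\<Sum>j\<in>{1..n}. - lift1 M j (vf_bracket (Y j) (l j (z j)) (l j (w j))) p f)"
      unfolding prod_action_apply
    proof (rule sum.cong[OF refl])
      fix j assume j: "j \<in> {1..n}"
      have "l j (lbr L (z j) (w j)) = - vf_bracket (Y j) (l j (z j)) (l j (w j))"
        using l[OF j] comp[OF z] comp[OF w] unfolding left_action_def by blast
      then show "lift1 M j (l j (lbr (lie_power n L) z w j)) p f =
          - lift1 M j (vf_bracket (Y j) (l j (z j)) (l j (w j))) p f"
        by (simp add: lie_power_simps(2) lift1_def)
    qed
    also have "\<dots> = - vf_bracket M (prod_action n Y l z) (prod_action n Y l w) p f"
    proof -
      have "vf_bracket M (prod_action n Y l z) (prod_action n Y l w) =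
          prod_tfield1 n Y (\<lambda>j. vf_bracket (Y j) (l j (z j)) (l j (w j)))"
        unfolding prod_action_def by (rule prod_bracket[OF vf[OF _ z] vf[OF _ w]])
      then show ?thesis by (simp only: prod_tfield1_apply sum_negf)
    qed
    finally show "prod_action n Y l (lbr (lie_power n L) z w) p f =
        (- vf_bracket M (prod_action n Y l z) (prod_action n Y l w)) p f" by simp
  qed
next
  fix c z assume z: "z \<in> lcarrier (lie_power n L)"
  show "prod_action n Y l (lscale (lie_power n L) c z) = (\<lambda>p f. c * prod_action n Y l z p f)"
  proof (intro ext)
    fix p f
    show "prod_action n Y l (lscale (lie_power n L) c z) p f = c * prod_action n Y l z p f"
      unfolding prod_action_apply sum_distrib_left
      by (rule sum.cong[OF refl])
         (simp add: lift1_def lie_power_simps(1) left_action_scale[OF l lie_power_comp[OF L z]])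
  qed
qed

text \<open>The even slots carry \<open>- r\<^sup>2\<^sup>1\<close> instead of \<open>r\<close>; the two have the same cobracket.\<close>

lemma left_poisson_space_direct:
  assumes L: "lie_algebra L" and r: "quasitriangular L r"
    and PS: "\<And>j. j \<in> {1..n} \<Longrightarrow> left_poisson_space L r (Y j) (P j) (l j)"
  shows "left_poisson_space (lie_power n L) (r_direct n r) M (prod_tfield2 n Y P) (prod_action n Y l)"
  unfolding left_poisson_space_def
proof (intro conjI ballI)
  have PM: "poisson_manifold (Y j) (P j)" and l: "left_action L (Y j) (l j)"
    and S: "\<forall>x\<in>lcarrier L. schouten (Y j) (l j x) (P j) = act2 (l j) (tens_ad L x r)" if "j \<in> {1..n}" for j
    using PS[OF that] unfolding left_poisson_space_def by auto
  have l': "\<forall>j\<in>{1..n}. left_action L (Y j) (l j)" using l by blast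
  have bv: "bivector_field (Y j) (P j)" if "j \<in> {1..n}" for j
    using PM[OF that] unfolding poisson_manifold_def by (elim conjE)
  have rs: "r \<in> tens_square L" using r unfolding quasitriangular_iff by blast
  show "lie_algebra (lie_power n L)" by (rule lie_power_algebra[OF L])
  show "quasitriangular (lie_power n L) (r_direct n r)" by (rule quasitriangular_r_direct[OF L r])
  show "poisson_manifold M (prod_tfield2 n Y P)" by (rule prod_poisson[OF PM])
  show "left_action (lie_power n L) M (prod_action n Y l)" by (rule left_action_prod[OF L l])
  fix z assume z: "z \<in> lcarrier (lie_power n L)"
  note zj = lie_power_comp[OF L z]
  show "schouten M (prod_action n Y l z) (prod_tfield2 n Y P) =
      act2 (prod_action n Y l) (tens_ad (lie_power n L) z (r_direct n r))"
  proof (intro ext)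
    fix p f g
    let ?\<xi> = "\<lambda>j u. lift1 M j (l j u) p f" and ?\<eta> = "\<lambda>j u. lift1 M j (l j u) p g"
    have "schouten M (prod_action n Y l z) (prod_tfield2 n Y P) =
        prod_tfield2 n Y (\<lambda>j. schouten (Y j) (l j (z j)) (P j))"
      unfolding prod_action_def by (rule prod_schouten[OF left_action_vector_field[OF l zj] bv])
    then have "schouten M (prod_action n Y l z) (prod_tfield2 n Y P) p f g =
        (\<Sum>j\<in>{1..n}. lift2 M j (schouten (Y j) (l j (z j)) (P j)) p f g)"
      by (simp add: prod_tfield2_apply)
    also have "\<dots> = (\<Sum>j\<in>{1..n}. tens_ad L (z j) (signed_r (odd j) r) (?\<xi> j) (?\<eta> j))"
    proof (rule sum.cong[OF refl])
      fix j assume j: "j \<in> {1..n}"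
      have "schouten (Y j) (l j (z j)) (P j) = act2 (l j) (tens_ad L (z j) r)"
        using S[OF j] zj by blast
      then have "lift2 M j (schouten (Y j) (l j (z j)) (P j)) p f g = tens_ad L (z j) r (?\<xi> j) (?\<eta> j)"
        by (auto simp: lift2_def act2_def lift1_def tens_ad_def tens_square_linear[OF rs])
      then show "lift2 M j (schouten (Y j) (l j (z j)) (P j)) p f g =
          tens_ad L (z j) (signed_r (odd j) r) (?\<xi> j) (?\<eta> j)"
        using tens_ad_signed_r[OF r zj lift1_dual[OF l[OF j]] lift1_dual[OF l[OF j]]] by simp
    qed
    also have "\<dots> = act2 (prod_action n Y l) (tens_ad (lie_power n L) z (r_direct n r)) p f g"
      unfolding act2_def r_direct_ad[OF L rs z]
      by (rule sum.cong[OF refl]) (simp only: slot_prod_action[OF L l'])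
    finally show "schouten M (prod_action n Y l z) (prod_tfield2 n Y P) p f g =
        act2 (prod_action n Y l) (tens_ad (lie_power n L) z (r_direct n r)) p f g" .
  qed
qed

text \<open>The diagonal embedding intertwines the cobrackets of \<open>r\<close> and of the mixed tensor: by invariance
  every block of the mixed tensor has the same adjoint variation as \<open>r\<close>.\<close>

lemma left_poisson_space_diag:
  assumes L: "lie_algebra L" and r: "quasitriangular L r"
    and l: "\<And>j. j \<in> {1..n} \<Longrightarrow> left_action L (Y j) (l j)"
    and PS: "left_poisson_space (lie_power n L) (r_mixed n r) M \<pi> (prod_action n Y l)"
  shows "left_poisson_space L r M \<pi> (diag_action n Y l)"
  unfolding left_poisson_space_def
proof (intro conjI ballI L r)
  let ?G = "lie_power n L"
  have l': "\<forall>j\<in>{1..n}. left_action L (Y j) (l j)" using l by blast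
  define dg where "dg u = (\<lambda>j. if j \<in> {1..n} then u else (0::'b))" for u
  have PM: "poisson_manifold M \<pi>" and lp: "left_action ?G M (prod_action n Y l)"
    and S: "\<forall>z\<in>lcarrier ?G. schouten M (prod_action n Y l z) \<pi> = act2 (prod_action n Y l) (tens_ad ?G z (r_mixed n r))"
    using PS unfolding left_poisson_space_def by auto
  have rs: "r \<in> tens_square L" using r unfolding quasitriangular_iff by blast
  show "poisson_manifold M \<pi>" by (rule PM)
  have da: "diag_action n Y l u = prod_action n Y l (dg u)" for u
    unfolding diag_action_def prod_action_def prod_tfield1_def by (rule sum.cong[OF refl]) (simp add: dg_def)
  have dgc: "dg u \<in> lcarrier ?G" if "u \<in> lcarrier L" for u
    using that unfolding lie_power_simps(3) by (simp add: dg_def)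
  have dg_add: "dg (u + v) = dg u + dg v" for u v by (auto simp: dg_def fun_eq_iff)
  have dg_scale: "dg (lscale L c u) = lscale ?G c (dg u)" for c u
    by (auto simp: dg_def fun_eq_iff lie_power_simps(1) lscale_zero[OF L])
  have dg_br: "dg (lbr L u v) = lbr ?G (dg u) (dg v)" for u v
    by (auto simp: dg_def fun_eq_iff lie_power_simps(2) lie_br_zero[OF L lie_carrier(1)[OF L]])
  show "left_action L M (diag_action n Y l)"
    unfolding left_action_def da dg_add dg_scale dg_br
    using lp dgc unfolding left_action_def by blast
  fix x assume x: "x \<in> lcarrier L"
  show "schouten M (diag_action n Y l x) \<pi> = act2 (diag_action n Y l) (tens_ad L x r)"
  proof (intro ext)
    fix p f g
    let ?\<xi> = "\<lambda>j u. lift1 M j (l j u) p f" and ?\<eta> = "\<lambda>j u. lift1 M j (l j u) p g"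
    let ?F = "\<lambda>z. prod_action n Y l z p f" and ?H = "\<lambda>z. prod_action n Y l z p g"
    have ts: "\<forall>j\<in>{1..n}. \<forall>k\<in>{1..n}. signed_r (mixed_sign j k) r \<in> tens_square L"
      by (intro ballI signed_r_in_square[OF rs])
    have "schouten M (diag_action n Y l x) \<pi> p f g = tens_ad ?G (dg x) (r_mixed n r) ?F ?H"
      using S dgc[OF x] by (simp add: da act2_def)
    also have "\<dots> = (\<Sum>j\<in>{1..n}. \<Sum>k\<in>{1..n}.
        signed_r (mixed_sign j k) r (\<lambda>u. slot j ?F (lbr L (dg x j) u)) (slot k ?H)
        + signed_r (mixed_sign j k) r (slot j ?F) (\<lambda>u. slot k ?H (lbr L (dg x k) u)))"
      unfolding tens_ad_def r_mixed_def block_tensor_ad(1)[OF L ts dgc[OF x]] block_tensor_ad(2)[OF L ts dgc[OF x]]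
        sum.distrib by (rule refl)
    also have "\<dots> = (\<Sum>j\<in>{1..n}. \<Sum>k\<in>{1..n}. tens_ad L x r (?\<xi> j) (?\<eta> k))"
    proof (intro sum.cong[OF refl])
      fix j k assume j: "j \<in> {1..n}" and k: "k \<in> {1..n}"
      have "dg x j = x" "dg x k = x" using j k by (simp_all add: dg_def)
      then show "signed_r (mixed_sign j k) r (\<lambda>u. slot j ?F (lbr L (dg x j) u)) (slot k ?H)
          + signed_r (mixed_sign j k) r (slot j ?F) (\<lambda>u. slot k ?H (lbr L (dg x k) u)) = tens_ad L x r (?\<xi> j) (?\<eta> k)"
        unfolding slot_prod_action[OF L l' j] slot_prod_action[OF L l' k]
        using tens_ad_signed_r[OF r x lift1_dual[OF l[OF j]] lift1_dual[OF l[OF k]], of "mixed_sign j k" p f p g]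
        by (simp add: tens_ad_def)
    qed
    also have "\<dots> = act2 (diag_action n Y l) (tens_ad L x r) p f g"
      unfolding act2_def tens_ad_def diag_action_apply tens_square_plain_sum[OF rs] sum.distrib by (rule refl)
    finally show "schouten M (diag_action n Y l x) \<pi> p f g = act2 (diag_action n Y l) (tens_ad L x r) p f g" .
  qed
qed

text \<open>In an even slot, \<open>\<lambda>\<^sub>j(r\<^sup>2\<^sup>1) = - \<lambda>\<^sub>j(r)\<close>, because \<open>\<lambda>\<^sub>j(r)\<close> is a bivector field.\<close>

lemma prod_bivector_of_action:
  assumes L: "lie_algebra L" and rs: "r \<in> tens_square L"
    and l: "\<And>j. j \<in> {1..n} \<Longrightarrow> left_action L (Y j) (l j)"
    and bv: "\<And>j. j \<in> {1..n} \<Longrightarrow> bivector_field (Y j) (P j)"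
    and P: "\<And>j. j \<in> {1..n} \<Longrightarrow> P j = - act2 (l j) r"
  shows "prod_tfield2 n Y P = - act2 (prod_action n Y l) (r_direct n r)"
proof (intro ext)
  fix p f g
  have l': "\<forall>j\<in>{1..n}. left_action L (Y j) (l j)" using l by blast
  let ?\<xi> = "\<lambda>j u. lift1 M j (l j u) p f" and ?\<eta> = "\<lambda>j u. lift1 M j (l j u) p g"
  have "prod_tfield2 n Y P p f g = (\<Sum>j\<in>{1..n}. - signed_r (odd j) r (?\<xi> j) (?\<eta> j))"
    unfolding prod_tfield2_apply
  proof (rule sum.cong[OF refl])
    fix j assume j: "j \<in> {1..n}"
    have P_eq: "P j q u v = - r (\<lambda>x. l j x q u) (\<lambda>x. l j x q v)" for q u v
      unfolding P[OF j] by (simp add: act2_def)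
    have lift: "lift2 M j (P j) p f g = - r (?\<xi> j) (?\<eta> j)" "lift2 M j (P j) p g f = - r (?\<eta> j) (?\<xi> j)"
      by (auto simp: lift2_def lift1_def P_eq tens_square_linear[OF rs])
    have "lift2 M j (P j) p f g = - lift2 M j (P j) p g f"
      by (rule bivector_field_skew[OF bivector_field_lift2[OF bv[OF j] j]])
    then show "lift2 M j (P j) p f g = - signed_r (odd j) r (?\<xi> j) (?\<eta> j)"
      unfolding lift by (simp add: signed_r_def tens_flip_def)
  qed
  also have "\<dots> = - act2 (prod_action n Y l) (r_direct n r) p f g"
    unfolding act2_def r_direct_apply sum_negf[symmetric]
    by (rule sum.cong[OF refl]) (simp only: slot_prod_action[OF L l'])
  finally show "prod_tfield2 n Y P p f g = (- act2 (prod_action n Y l) (r_direct n r)) p f g" by simp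
qed

end

theorem theorem6p8:
  fixes L :: "('k::{real_normed_field, euclidean_space}, 'g::ab_group_add) lie_alg"
    and n :: nat
    and I :: "'i set" and x y :: "'i \<Rightarrow> 'g"
    and r :: "('k, 'g) tens2"
    and Y :: "nat \<Rightarrow> ('a, 'k) mfd"
    and P :: "nat \<Rightarrow> ('a, 'k) tfield2"
    and l :: "nat \<Rightarrow> 'g \<Rightarrow> ('a, 'k) tfield1"
  assumes "lie_algebra L"
    and "1 \<le> n"
    and "finite I"
    and "\<forall>i\<in>I. x i \<in> lcarrier L \<and> y i \<in> lcarrier L"
    and "r = (\<Sum>i\<in>I. x i \<otimes> y i)"
    and "quasitriangular L r"
    and "\<forall>j\<in>{1..n}. left_poisson_space L r (Y j) (P j) (l j)"
  shows "left_poisson_space (lie_power n L) (r_power n I x y)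
           (prod_mfd n Y) (mixed_bivector n I x y Y P l) (prod_action n Y l) \<and>
         left_poisson_space L r
           (prod_mfd n Y) (mixed_bivector n I x y Y P l) (diag_action n Y l) \<and>
         ((\<forall>j\<in>{1..n}. P j = - act2 (l j) r) \<longrightarrow>
           mixed_bivector n I x y Y P l = - act2 (prod_action n Y l) (r_power n I x y))"
proof -
  note L = assms(1) and r = assms(6)
  have PS: "left_poisson_space L r (Y j) (P j) (l j)" if "j \<in> {1..n}" for j
    using assms(7) that by blast
  have l: "left_action L (Y j) (l j)" and bv: "bivector_field (Y j) (P j)" and mf: "manifold (Y j)"
    if "j \<in> {1..n}" for j
    using PS[OF that] unfolding left_poisson_space_def poisson_manifold_def by blast+
  interpret mfd_product n Y by standard (rule mf)
  have rp: "r_power n I x y = r_mixed n r" unfolding assms(5) by (rule r_power_eq)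
  have Mix: "Mix n I x y = r_direct n r - r_mixed n r" unfolding assms(5) r_mixed_eq by simp
  have \<pi>: "mixed_bivector n I x y Y P l = prod_tfield2 n Y P + act2 (prod_action n Y l) (r_direct n r - r_mixed n r)"
    unfolding mixed_bivector_def Mix ..
  have 1: "left_poisson_space (lie_power n L) (r_mixed n r) (prod_mfd n Y) (mixed_bivector n I x y Y P l) (prod_action n Y l)"
    unfolding \<pi> by (rule left_poisson_space_twist[OF left_poisson_space_direct[OF L r PS]
        quasitriangular_r_mixed[OF L r] r_direct_r_mixed_symmetric_part])
  have 2: "left_poisson_space L r (prod_mfd n Y) (mixed_bivector n I x y Y P l) (diag_action n Y l)"
    by (rule left_poisson_space_diag[OF L r l 1])
  have 3: "mixed_bivector n I x y Y P l = - act2 (prod_action n Y l) (r_mixed n r)"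
    if P: "\<forall>j\<in>{1..n}. P j = - act2 (l j) r"
  proof -
    have rs: "r \<in> tens_square L" using r unfolding quasitriangular_iff by blast
    have "prod_tfield2 n Y P = - act2 (prod_action n Y l) (r_direct n r)"
      by (rule prod_bivector_of_action[OF L rs l bv]) (use P in blast)+
    then show ?thesis unfolding \<pi> by (simp add: act2_def fun_eq_iff)
  qed
  show ?thesis unfolding rp using 1 2 3 by blast
qed

end
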